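(* Let $p$ be a prime. For every integer $k\geq 1$, the fixed point space $\left(\mathcal{L}_{p^{k}}\right)^{\Gamma_{k}}$ is homeomorphic to the symplectic Tits building $T\mathrm{Sp}_{k}(\mathbb{F}_{p})$.
   Context: Decomposition spaces. A proper orthogonal decomposition of $\mathbb{C}^{n}$ is an unordered collection of nonzero, pairwise orthogonal, proper subspaces of $\mathbb{C}^{n}$ whose sum is $\mathbb{C}^{n}$. These form a poset under coarsening (there is a unique morphism $\lambda\to\mu$ exactly when $\lambda$ refines $\mu$), denoted $\mathcal{L}_{n}$. It is a category internal to topological spaces: $U(n)$ acts on the object set and on the morphism set, and each is topologized as the disjoint union of its $U(n)$-orbits. $\mathcal{L}_{n}$ also denotes the (geometric realization of the) nerve of this topological poset. For a closed subgroup $H\subseteq U(n)$, $(\mathcal{L}_{n})^{H}$ is the fixed point space of $H$; it is the nerve of the topological subposet of decompositions $\lambda$ stabilized by $H$ (elements of $H$ may permute the components of $\lambda$). The group $\Gamma_{k}$. Let $S^{1}$ denote the center of $U(p^{k})$. $\Gamma_{k}\subset U(p^{k})$ is the subgroup, unique up to conjugacy, which acts irreducibly on $\mathbb{C}^{p^{k}}$ and is given by an extension $1\to S^{1}\to\Gamma_{k}\to(\mathbb{Z}/p)^{2k}\to 1$. Explicitly, index the standard basis of $\mathbb{C}^{p^{k}}$ as $\{e_{x}\}_{x\in\mathbb{F}_{p}^{k}}$ and let $\zeta=e^{2\pi i/p}$; then $\Gamma_{k}$ may be taken to be generated by $S^{1}$, the permutation matrices $e_{x}\mapsto e_{x+a}$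 ($a\in\mathbb{F}_{p}^{k}$), and the diagonal matrices $e_{x}\mapsto\zeta^{b\cdot x}e_{x}$ ($b\in\mathbb{F}_{p}^{k}$). Lifting two elements of $(\mathbb{Z}/p)^{2k}$ to $\Gamma_{k}$ and taking the commutator, which is a $p$-th root of unity in $S^{1}$, defines a symplectic (nondegenerate alternating bilinear) form on $(\mathbb{Z}/p)^{2k}$. Symplectic Tits building. A subspace $W$ of a symplectic vector space is coisotropic if $W^{\perp}\subseteq W$. A subgroup of $\Gamma_{k}$ is coisotropic if it is the inverse image in $\Gamma_{k}$ of a coisotropic subspace of $(\mathbb{Z}/p)^{2k}$. $T\mathrm{Sp}_{k}(\mathbb{F}_{p})$ is the (discrete) poset of proper coisotropic subgroups of $\Gamma_{k}$ ordered by inclusion; the same symbol denotes (the geometric realization of) its nerve. *)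

theory Defs
  imports
    "HOL-Analysis.Analysis"
    "HOL-Homology.Homology"
    "HOL-Algebra.Generated_Groups"
    "Berlekamp_Zassenhaus.Finite_Field"
begin

section \<open>Quotient topologies and sums of orbits\<close>

definition quotient_topology :: "'a topology \<Rightarrow> ('a \<Rightarrow> 'b) \<Rightarrow> 'b topology" where
  "quotient_topology X f =
     topology (\<lambda>W. W \<subseteq> f ` topspace X \<and> openin X {x \<in> topspace X. f x \<in> W})"

lemma openin_quotient_topology:
  "openin (quotient_topology X f) W \<longleftrightarrow>
     W \<subseteq> f ` topspace X \<and> openin X {x \<in> topspace X. f x \<in> W}"
proof -
  have "istopology (\<lambda>W. W \<subseteq> f ` topspace X \<and> openin X {x \<in> topspace X. f x \<in> W})"
  proof (unfold istopology_def, intro conjI allI impI)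
    fix S T
    assume S: "S \<subseteq> f ` topspace X \<and> openin X {x \<in> topspace X. f x \<in> S}"
      and T: "T \<subseteq> f ` topspace X \<and> openin X {x \<in> topspace X. f x \<in> T}"
    have "{x \<in> topspace X. f x \<in> S \<inter> T} =
            {x \<in> topspace X. f x \<in> S} \<inter> {x \<in> topspace X. f x \<in> T}"
      by blast
    with S T show "openin X {x \<in> topspace X. f x \<in> S \<inter> T}"
      by (simp add: openin_Int)
    from S show "S \<inter> T \<subseteq> f ` topspace X"
      by blast
  next
    fix K
    assume K: "\<forall>S\<in>K. S \<subseteq> f ` topspace X \<and> openin X {x \<in> topspace X. f x \<in> S}"
    have "{x \<in> topspace X. f x \<in> \<Union>K} = (\<Union>S\<in>K. {x \<in> topspace X. f x \<in> S})"
      by blast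
    moreover have "openin X (\<Union>S\<in>K. {x \<in> topspace X. f x \<in> S})"
      using K by (intro openin_Union) blast
    ultimately show "openin X {x \<in> topspace X. f x \<in> \<Union>K}"
      by simp
    show "\<Union>K \<subseteq> f ` topspace X"
      using K by (intro Union_least) blast
  qed
  then show ?thesis
    by (simp add: quotient_topology_def)
qed

text \<open>
  For an action of \<open>G\<close> on the set \<open>D\<close>: each orbit is the quotient \<open>G/Stab(x)\<close>, and \<open>D\<close> is the
  disjoint union of its orbits.
\<close>

definition orbit_sum_topology :: "'g topology \<Rightarrow> ('g \<Rightarrow> 'a \<Rightarrow> 'a) \<Rightarrow> 'a set \<Rightarrow> 'a topology" where
  "orbit_sum_topology G act D =
     topology (\<lambda>W. W \<subseteq> D \<and>
       (\<forall>x\<in>D. openin (quotient_topology G (\<lambda>g. act g x)) (W \<inter> (\<lambda>g. act g x) ` topspace G)))"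

lemma openin_orbit_sum_topology:
  "openin (orbit_sum_topology G act D) W \<longleftrightarrow>
     W \<subseteq> D \<and>
     (\<forall>x\<in>D. openin (quotient_topology G (\<lambda>g. act g x)) (W \<inter> (\<lambda>g. act g x) ` topspace G))"
proof -
  have "istopology (\<lambda>W. W \<subseteq> D \<and>
     (\<forall>x\<in>D. openin (quotient_topology G (\<lambda>g. act g x)) (W \<inter> (\<lambda>g. act g x) ` topspace G)))"
    (is "istopology ?P")
  proof (unfold istopology_def, intro conjI allI impI ballI)
    fix S T
    assume S: "?P S" and T: "?P T"
    from S show "S \<inter> T \<subseteq> D"
      by blast
    fix x
    assume "x \<in> D"
    moreover have "S \<inter> T \<inter> (\<lambda>g. act g x) ` topspace G =
        (S \<inter> (\<lambda>g. act g x) ` topspace G) \<inter> (T \<inter> (\<lambda>g. act g x) ` topspace G)"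
      by blast
    ultimately show "openin (quotient_topology G (\<lambda>g. act g x))
        (S \<inter> T \<inter> (\<lambda>g. act g x) ` topspace G)"
      using S T by (simp only: openin_Int)
  next
    fix K
    assume K: "\<forall>S\<in>K. ?P S"
    then show "\<Union>K \<subseteq> D"
      by (intro Union_least) blast
    fix x
    assume "x \<in> D"
    with K have *: "openin (quotient_topology G (\<lambda>g. act g x))
        (\<Union>S\<in>K. S \<inter> (\<lambda>g. act g x) ` topspace G)"
      by (intro openin_Union) blast
    have **: "\<Union>K \<inter> (\<lambda>g. act g x) ` topspace G =
        (\<Union>S\<in>K. S \<inter> (\<lambda>g. act g x) ` topspace G)"
      by blast
    show "openin (quotient_topology G (\<lambda>g. act g x))
        (\<Union>K \<inter> (\<lambda>g. act g x) ` topspace G)"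
      unfolding ** by (rule *)
  qed
  then show ?thesis
    by (simp add: orbit_sum_topology_def)
qed

section \<open>Nerve and realization of a topological poset\<close>

text \<open>
  A topological poset is given by a space \<open>obj\<close> of objects and a space \<open>mor\<close> of morphisms, a
  morphism being the pair of its source and its target. An \<open>m\<close>-simplex of the nerve is the
  sequence of its vertices. It is topologized by its vertices and its successive morphisms: for
  \<open>m \<ge> 1\<close>, source and target being continuous, this is the iterated fibre product of \<open>m\<close> copies
  of \<open>mor\<close> over \<open>obj\<close>, and for \<open>m = 0\<close> it is \<open>obj\<close>.
\<close>

definition nerve_simplices :: "'a topology \<Rightarrow> ('a \<times> 'a) topology \<Rightarrow> nat \<Rightarrow> (nat \<Rightarrow> 'a) set" where
  "nerve_simplices obj mor m =
     {c \<in> {..m} \<rightarrow>\<^sub>E topspace obj. \<forall>i<m. (c i, c (Suc i)) \<in> topspace mor}"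

definition nerve :: "'a topology \<Rightarrow> ('a \<times> 'a) topology \<Rightarrow> nat \<Rightarrow> (nat \<Rightarrow> 'a) topology" where
  "nerve obj mor m =
     pullback_topology (nerve_simplices obj mor m)
       (\<lambda>c. (c, \<lambda>i\<in>{..<m}. (c i, c (Suc i))))
       (prod_topology (product_topology (\<lambda>_. obj) {..m}) (product_topology (\<lambda>_. mor) {..<m}))"

text \<open>A triple \<open>(m, c, t)\<close> is the point with barycentric coordinates \<open>t\<close> of the \<open>m\<close>-simplex \<open>c\<close>.\<close>

type_synonym 'a simplex_point = "nat \<times> (nat \<Rightarrow> 'a) \<times> (nat \<Rightarrow> real)"

definition simplex_sum :: "'a topology \<Rightarrow> ('a \<times> 'a) topology \<Rightarrow> 'a simplex_point topology" where
  "simplex_sum obj mor =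
     sum_topology
       (\<lambda>m. prod_topology (nerve obj mor m) (subtopology (powertop_real UNIV) (standard_simplex m)))
       UNIV"

text \<open>\<open>(\<theta>\<^sup>*c, t) \<sim> (c, \<theta>\<^sub>*t)\<close> for every monotone map \<open>\<theta>\<close> from \<open>{0, \<dots>, m}\<close> to \<open>{0, \<dots>, n}\<close>.\<close>

inductive realization_step ::
  "'a topology \<Rightarrow> ('a \<times> 'a) topology \<Rightarrow> 'a simplex_point \<Rightarrow> 'a simplex_point \<Rightarrow> bool"
  for obj mor where
  "\<lbrakk>mono_on {..m} \<theta>; \<theta> \<in> {..m} \<rightarrow> {..n};
    c \<in> nerve_simplices obj mor n; t \<in> standard_simplex m\<rbrakk> \<Longrightarrow>
   realization_step obj mor
     (m, (\<lambda>i\<in>{..m}. c (\<theta> i)), t)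
     (n, c, \<lambda>j. \<Sum>i\<in>{i. i \<le> m \<and> \<theta> i = j}. t i)"

definition realization ::
  "'a topology \<Rightarrow> ('a \<times> 'a) topology \<Rightarrow> 'a simplex_point set topology" where
  "realization obj mor =
     quotient_topology (simplex_sum obj mor) (\<lambda>z. {w. equivclp (realization_step obj mor) z w})"

definition realization_map ::
  "('a \<Rightarrow> 'b) \<Rightarrow> 'a simplex_point set \<Rightarrow> 'b simplex_point set" where
  "realization_map f x = (\<lambda>(m, c, t). (m, \<lambda>i\<in>{..m}. f (c i), t)) ` x"

definition realization_fixed_points ::
  "'a topology \<Rightarrow> ('a \<times> 'a) topology \<Rightarrow> ('g \<Rightarrow> 'a \<Rightarrow> 'a) \<Rightarrow> 'g set \<Rightarrow>
   'a simplex_point set topology" where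
  "realization_fixed_points obj mor act H =
     subtopology (realization obj mor) {x. \<forall>h\<in>H. realization_map (act h) x = x}"

section \<open>The topological poset of proper orthogonal decompositions\<close>

type_synonym 'n cmatrix = "complex^'n^'n"
type_synonym 'n decomposition = "(complex^'n) set set"

definition conj_transpose :: "'n::finite cmatrix \<Rightarrow> 'n cmatrix" where
  "conj_transpose A = (\<chi> i j. cnj (A $ j $ i))"

definition unitary :: "'n::finite cmatrix set" where
  "unitary = {A. A ** conj_transpose A = mat 1 \<and> conj_transpose A ** A = mat 1}"

definition hermitian_inner :: "complex^'n::finite \<Rightarrow> complex^'n \<Rightarrow> complex" where
  "hermitian_inner x y = (\<Sum>i\<in>UNIV. cnj (x $ i) * y $ i)"

definition proper_decompositions :: "'n::finite decomposition set" where
  "proper_decompositions =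
     {L. (\<forall>V\<in>L. vec.subspace V \<and> V \<noteq> {0} \<and> V \<noteq> UNIV) \<and>
         (\<forall>V\<in>L. \<forall>W\<in>L. V \<noteq> W \<longrightarrow> (\<forall>x\<in>V. \<forall>y\<in>W. hermitian_inner x y = 0)) \<and>
         vec.span (\<Union>L) = UNIV}"

definition refines :: "'n::finite decomposition \<Rightarrow> 'n decomposition \<Rightarrow> bool" where
  "refines L M \<longleftrightarrow> (\<forall>V\<in>L. \<exists>W\<in>M. V \<subseteq> W)"

definition decomposition_act :: "'n::finite cmatrix \<Rightarrow> 'n decomposition \<Rightarrow> 'n decomposition" where
  "decomposition_act A L = (\<lambda>V. (\<lambda>x. A *v x) ` V) ` L"

definition decomposition_obj :: "'n::finite decomposition topology" where
  "decomposition_obj =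
     orbit_sum_topology (top_of_set unitary) decomposition_act proper_decompositions"

definition decomposition_mor :: "('n::finite decomposition \<times> 'n decomposition) topology" where
  "decomposition_mor =
     orbit_sum_topology (top_of_set unitary)
       (\<lambda>A. map_prod (decomposition_act A) (decomposition_act A))
       {(L, M). L \<in> proper_decompositions \<and> M \<in> proper_decompositions \<and> refines L M}"

text \<open>The space \<open>(\<L>\<^sub>n)\<^sup>H\<close> for a subgroup \<open>H\<close> of \<open>U(n)\<close>, where \<open>n\<close> is the cardinality of \<open>'n\<close>.\<close>

definition decomposition_fixed_points ::
  "'n::finite cmatrix set \<Rightarrow> 'n decomposition simplex_point set topology" where
  "decomposition_fixed_points H =
     realization_fixed_points decomposition_obj decomposition_mor decomposition_act H"

section \<open>The group \<open>\<Gamma>\<^sub>k\<close>\<close>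

text \<open>
  The prime \<open>p\<close> is the cardinality of \<open>'p\<close> and \<open>k \<ge> 1\<close> that of \<open>'k\<close>. The standard basis of
  \<open>\<complex>\<^bsup>p^k\<^esup>\<close> is indexed by the vectors of \<open>\<F>\<^sub>p\<^sup>k\<close>.
\<close>

type_synonym ('p, 'k) Fpk = "'p mod_ring ^ 'k"

definition zeta_power :: "'p::prime_card mod_ring \<Rightarrow> complex" where
  "zeta_power c = exp (2 * pi * \<i> / of_nat CARD('p)) ^ nat (to_int_mod_ring c)"

definition shift_matrix :: "('p::prime_card, 'k::finite) Fpk \<Rightarrow> ('p, 'k) Fpk cmatrix" where
  "shift_matrix a = (\<chi> y x. if y = x + a then 1 else 0)"

definition clock_matrix :: "('p::prime_card, 'k::finite) Fpk \<Rightarrow> ('p, 'k) Fpk cmatrix" where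
  "clock_matrix b = (\<chi> y x. if y = x then zeta_power (\<Sum>i\<in>UNIV. b $ i * x $ i) else 0)"

definition unitary_group :: "'n::finite cmatrix monoid" where
  "unitary_group = \<lparr>carrier = unitary, mult = (**), one = mat 1\<rparr>"

definition Gamma_group ::
  "'p::prime_card itself \<Rightarrow> 'k::finite itself \<Rightarrow> ('p, 'k) Fpk cmatrix set" where
  "Gamma_group _ _ =
     generate unitary_group
       ({mat z |z. cmod z = 1} \<union> range shift_matrix \<union> range clock_matrix)"

text \<open>
  The projection of \<open>\<Gamma>\<^sub>k\<close> onto \<open>(\<int>/p)\<^bsup>2k\<^esup>\<close> sends \<open>z X\<^sub>a Z\<^sub>b\<close> to \<open>(a, b)\<close>; here \<open>X\<^sub>a\<close> is the shift by
  \<open>a\<close>, \<open>Z\<^sub>b\<close> is the diagonal matrix of \<open>b\<close>, and \<open>|z| = 1\<close>.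
\<close>

definition Gamma_proj ::
  "('p::prime_card, 'k::finite) Fpk cmatrix \<Rightarrow> ('p, 'k + 'k) Fpk" where
  "Gamma_proj g =
     (THE v. \<exists>z. cmod z = 1 \<and>
        g = mat z ** shift_matrix (\<chi> i. v $ Inl i) ** clock_matrix (\<chi> i. v $ Inr i))"

definition commutator_form ::
  "('p::prime_card, 'k::finite + 'k) Fpk \<Rightarrow> ('p, 'k + 'k) Fpk \<Rightarrow> 'p mod_ring" where
  "commutator_form v w =
     (THE c. \<forall>g\<in>Gamma_group TYPE('p) TYPE('k). \<forall>h\<in>Gamma_group TYPE('p) TYPE('k).
        Gamma_proj g = v \<and> Gamma_proj h = w \<longrightarrow>
        g ** h ** matrix_inv g ** matrix_inv h = mat (zeta_power c))"

section \<open>The symplectic Tits building\<close>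

definition perp :: "('p::prime_card, 'k::finite + 'k) Fpk set \<Rightarrow> ('p, 'k + 'k) Fpk set" where
  "perp W = {v. \<forall>w\<in>W. commutator_form v w = 0}"

definition coisotropic :: "('p::prime_card, 'k::finite + 'k) Fpk set \<Rightarrow> bool" where
  "coisotropic W \<longleftrightarrow> vec.subspace W \<and> perp W \<subseteq> W"

definition coisotropic_subgroups ::
  "'p::prime_card itself \<Rightarrow> 'k::finite itself \<Rightarrow> ('p, 'k) Fpk cmatrix set set" where
  "coisotropic_subgroups _ _ =
     {{g \<in> Gamma_group TYPE('p) TYPE('k). Gamma_proj g \<in> W} |W. coisotropic W}"

definition proper_coisotropic_subgroups ::
  "'p::prime_card itself \<Rightarrow> 'k::finite itself \<Rightarrow> ('p, 'k) Fpk cmatrix set set" where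
  "proper_coisotropic_subgroups p k = {K \<in> coisotropic_subgroups p k. K \<noteq> Gamma_group p k}"

definition symplectic_building ::
  "'p::prime_card itself \<Rightarrow> 'k::finite itself \<Rightarrow>
   ('p, 'k) Fpk cmatrix set simplex_point set topology" where
  "symplectic_building p k =
     realization
       (discrete_topology (proper_coisotropic_subgroups p k))
       (discrete_topology
         {(K, K'). K \<in> proper_coisotropic_subgroups p k \<and>
                   K' \<in> proper_coisotropic_subgroups p k \<and> K \<subseteq> K'})"

end

theory Submission
  imports Defs
begin

text \<open>
  The theorem splits into a statement about realizations and one about representations.

  A point of the realization of a topological poset is a finite chain of objects carrying positive
  weights of sum 1: two points of the simplices are identified exactly when they give the same weight
  to every object (\<open>equivclp_iff_weight\<close>), because every point has one nondegenerate representative.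
  A group of automorphisms therefore fixes a point iff it fixes every object of positive weight, and as
  a set \<open>(\<L>\<^sub>n)\<^sup>H\<close> is the realization of the poset of decompositions that \<open>H\<close> fixes. For \<open>H = \<Gamma>\<^sub>k\<close>
  this poset is finite, so its realization, with the discrete topology on the poset, is compact. On the
  other side \<open>\<L>\<^sub>n\<close> is Hausdorff: a continuous function \<open>f\<close> on objects extends to the function
  \<open>\<Sum>\<^sub>i t\<^sub>i f(c\<^sub>i)\<close> on the realization, these extensions separate weights as soon as the functions \<open>f\<close>
  separate objects, and a decomposition \<open>L\<close> is separated from the others by the distances of vectors
  to the closed set \<open>\<Union>L\<close>. The continuous bijection from a compact space to a Hausdorff space is a
  homeomorphism (\<open>realization_fixed_points_homeomorphic\<close>).

  It remains to identify the poset of \<open>\<Gamma>\<close>-invariant decompositions with that of proper coisotropic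
  subgroups. The isomorphism sends \<open>L\<close> to the subgroup \<open>K\<close> of the elements that map every component of
  \<open>L\<close> to itself; let \<open>W\<close> be its image in \<open>(\<int>/p)\<^bsup>2k\<^esup>\<close>. Since \<open>\<Gamma>\<close> acts irreducibly, it permutes the
  components transitively, and since commutators are scalars, an element that preserves one component
  preserves all of them. The main point (\<open>perp_acts_by_scalars\<close>) is a form of Schur's lemma: elements
  over \<open>W\<^sup>\<bottom>\<close> commute with \<open>K\<close>, and irreducibility of \<open>\<Gamma>\<close> forces them to act on every component as
  scalars. Hence they lie in \<open>K\<close>, which says that \<open>W\<close> is coisotropic. Two components differ by some \<open>h\<close>
  outside \<open>K\<close>; as \<open>W\<^sup>\<bottom>\<^sup>\<bottom> = W\<close>, some element over \<open>W\<^sup>\<bottom>\<close> has a nontrivial commutator with \<open>h\<close> and so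
  acts on the two components by different scalars. The components of \<open>L\<close> are thus the joint
  eigenspaces of the abelian group over \<open>W\<^sup>\<bottom>\<close>, which makes \<open>L \<mapsto> K\<close> an order embedding. Conversely, for a
  proper coisotropic \<open>W\<close> the joint eigenspaces over \<open>W\<^sup>\<bottom>\<close> form an invariant decomposition, and the
  elements of \<open>\<Gamma>\<close> that preserve them are those whose image is orthogonal to \<open>W\<^sup>\<bottom>\<close>, that is, lies in
  \<open>W\<close> (\<open>eigenspace_decomposition_invariant\<close>).
\<close>

section \<open>Continuous maps out of quotients and sums\<close>

lemma topspace_quotient_topology [simp]: "topspace (quotient_topology X f) = f ` topspace X"
proof -
  have "openin (quotient_topology X f) (f ` topspace X)"
    unfolding openin_quotient_topology
    by (simp add: Collect_conj_eq[symmetric] cong: conj_cong)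
  moreover have "W \<subseteq> f ` topspace X" if "openin (quotient_topology X f) W" for W
    using that by (simp add: openin_quotient_topology)
  ultimately show ?thesis
    by (metis openin_subset openin_topspace subset_antisym)
qed

lemma continuous_map_quotient_topology: "continuous_map X (quotient_topology X f) f"
  by (auto simp: continuous_map_def openin_quotient_topology)

lemma continuous_map_from_quotient_topology:
  assumes "continuous_map X Y (\<lambda>x. g (f x))"
  shows "continuous_map (quotient_topology X f) Y g"
  unfolding continuous_map_def
proof (intro conjI allI impI)
  show "g \<in> topspace (quotient_topology X f) \<rightarrow> topspace Y"
    using assms by (auto simp: continuous_map_def)
  fix U assume "openin Y U"
  then have "openin X {x \<in> topspace X. g (f x) \<in> U}"
    using assms by (auto simp: continuous_map_def)
  moreover have "{x \<in> topspace X. f x \<in> {y \<in> f ` topspace X. g y \<in> U}} = {x \<in> topspace X. g (f x) \<in> U}"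
    by auto
  ultimately show "openin (quotient_topology X f) {y \<in> topspace (quotient_topology X f). g y \<in> U}"
    by (auto simp: openin_quotient_topology)
qed

lemma continuous_map_from_sum_topology:
  assumes "\<And>i. i \<in> I \<Longrightarrow> continuous_map (X i) Y (\<lambda>x. f (i, x))"
  shows "continuous_map (sum_topology X I) Y f"
  unfolding continuous_map_def
proof (intro conjI allI impI)
  show "f \<in> topspace (sum_topology X I) \<rightarrow> topspace Y"
    using assms by (force simp: continuous_map_def Pi_iff)
  fix U assume U: "openin Y U"
  have "openin (X i) {x \<in> topspace (X i). f (i, x) \<in> U}" if "i \<in> I" for i
    using assms[OF that] U by (auto simp: continuous_map_def)
  moreover have "{x. (i, x) \<in> {x \<in> topspace (sum_topology X I). f x \<in> U}} = {x \<in> topspace (X i). f (i, x) \<in> U}"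
    if "i \<in> I" for i
    using that by auto
  ultimately show "openin (sum_topology X I) {x \<in> topspace (sum_topology X I). f x \<in> U}"
    by (auto simp: openin_sum_topology)
qed

lemma Hausdorff_space_if_separated_by_real_functions:
  assumes "\<And>x y. \<lbrakk>x \<in> topspace X; y \<in> topspace X; x \<noteq> y\<rbrakk> \<Longrightarrow>
             \<exists>f. continuous_map X euclideanreal f \<and> f x \<noteq> f y"
  shows "Hausdorff_space X"
  unfolding Hausdorff_space_def
proof (intro allI impI)
  fix x y assume xy: "x \<in> topspace X \<and> y \<in> topspace X \<and> x \<noteq> y"
  then obtain f where f: "continuous_map X euclideanreal f" "f x \<noteq> f y"
    using assms by blast
  obtain U V where UV: "open U" "open V" "f x \<in> U" "f y \<in> V" "U \<inter> V = {}"
    using f(2) separation_t2[of "f x" "f y"] by auto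
  have "openin X {z \<in> topspace X. f z \<in> U}" "openin X {z \<in> topspace X. f z \<in> V}"
    using f(1) UV(1,2) by (auto simp: continuous_map_def)
  moreover have "disjnt {z \<in> topspace X. f z \<in> U} {z \<in> topspace X. f z \<in> V}"
    using UV(5) by (auto simp: disjnt_iff)
  ultimately show "\<exists>U V. openin X U \<and> openin X V \<and> x \<in> U \<and> y \<in> V \<and> disjnt U V"
    using xy UV(3,4) by blast
qed

section \<open>The nerve\<close>

lemma topspace_nerve [simp]: "topspace (nerve obj mor m) = nerve_simplices obj mor m"
  by (auto simp: nerve_def topspace_pullback_topology nerve_simplices_def PiE_iff extensional_def)

lemma continuous_map_nerve_vertex:
  assumes "i \<le> m"
  shows "continuous_map (nerve obj mor m) obj (\<lambda>c. c i)"
proof -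
  have "continuous_map (nerve obj mor m) obj
      ((\<lambda>x. fst x i) \<circ> (\<lambda>c. (c, \<lambda>i\<in>{..<m}. (c i, c (Suc i)))))"
    unfolding nerve_def using assms
    by (intro continuous_map_pullback continuous_map_compose[OF continuous_map_fst, unfolded comp_def]
        continuous_map_product_projection) auto
  then show ?thesis
    by (simp add: comp_def)
qed

lemma continuous_map_nerve_edge:
  assumes "i < m"
  shows "continuous_map (nerve obj mor m) mor (\<lambda>c. (c i, c (Suc i)))"
proof -
  have "continuous_map (nerve obj mor m) mor
      ((\<lambda>x. snd x i) \<circ> (\<lambda>c. (c, \<lambda>i\<in>{..<m}. (c i, c (Suc i)))))"
    unfolding nerve_def using assms
    by (intro continuous_map_pullback continuous_map_compose[OF continuous_map_snd, unfolded comp_def]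
        continuous_map_product_projection) auto
  then show ?thesis
    using assms by (simp add: comp_def)
qed

lemma continuous_map_into_nerve:
  assumes vertex: "\<And>i. i \<le> m \<Longrightarrow> continuous_map X obj (\<lambda>x. g x i)"
    and edge: "\<And>i. i < m \<Longrightarrow> continuous_map X mor (\<lambda>x. (g x i, g x (Suc i)))"
    and ext: "\<And>x. x \<in> topspace X \<Longrightarrow> g x \<in> extensional {..m}"
  shows "continuous_map X (nerve obj mor m) g"
  unfolding nerve_def
proof (rule continuous_map_pullback')
  have "continuous_map X (product_topology (\<lambda>_. obj) {..m}) g"
    using vertex ext by (auto simp: continuous_map_componentwise)
  moreover have "continuous_map X (product_topology (\<lambda>_. mor) {..<m})
      (\<lambda>x. \<lambda>i\<in>{..<m}. (g x i, g x (Suc i)))"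
    using edge by (auto simp: continuous_map_componentwise)
  ultimately show "continuous_map X
     (prod_topology (product_topology (\<lambda>_. obj) {..m}) (product_topology (\<lambda>_. mor) {..<m}))
     ((\<lambda>c. (c, \<lambda>i\<in>{..<m}. (c i, c (Suc i)))) \<circ> g)"
    by (simp add: comp_def continuous_map_pairedI)
  show "topspace X \<subseteq> g -` nerve_simplices obj mor m"
    using assms by (fastforce simp: nerve_simplices_def PiE_iff continuous_map_def Pi_iff)
qed

lemma topspace_simplex_sum:
  "topspace (simplex_sum obj mor) =
     {(m, c, t). c \<in> nerve_simplices obj mor m \<and> t \<in> standard_simplex m}"
  by (auto simp: simplex_sum_def)

section \<open>Nondegenerate representatives\<close>

text \<open>
  The finitely supported probability measure on objects that a point of a simplex describes.
\<close>

definition weight :: "'a simplex_point \<Rightarrow> 'a \<Rightarrow> real" where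
  "weight z a = (case z of (m, c, t) \<Rightarrow> \<Sum>i | i \<le> m \<and> c i = a. t i)"

definition point_class ::
  "'a topology \<Rightarrow> ('a \<times> 'a) topology \<Rightarrow> 'a simplex_point \<Rightarrow> 'a simplex_point set" where
  "point_class obj mor z = {w. equivclp (realization_step obj mor) z w}"

definition nondegenerate :: "'a simplex_point \<Rightarrow> bool" where
  "nondegenerate z = (case z of (m, c, t) \<Rightarrow> inj_on c {..m} \<and> (\<forall>i\<le>m. 0 < t i))"

lemma topspace_realization:
  "topspace (realization obj mor) = point_class obj mor ` topspace (simplex_sum obj mor)"
  by (simp add: realization_def point_class_def)

lemma point_class_eq_iff:
  "point_class obj mor z = point_class obj mor w \<longleftrightarrow> equivclp (realization_step obj mor) z w"
  unfolding point_class_def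
  by (auto intro: equivclp_trans equivclp_sym dest: equivclp_sym)

lemma self_in_point_class: "z \<in> point_class obj mor z"
  by (simp add: point_class_def)

text \<open>
  Both sides push the measure \<open>t\<close> on \<open>{0, \<dots>, m}\<close> forward along \<open>c \<circ> \<theta>\<close>, once directly and once through
  \<open>{0, \<dots>, n}\<close>.
\<close>

lemma weight_realization_step:
  assumes "realization_step obj mor z w"
  shows "weight z = weight w"
  using assms
proof cases
  case (1 m \<theta> n c t)
  show ?thesis
  proof
    fix a
    let ?S = "{i. i \<le> m \<and> c (\<theta> i) = a}" and ?T = "{j. j \<le> n \<and> c j = a}"
    have "(\<Sum>j\<in>?T. \<Sum>i\<in>{i\<in>?S. \<theta> i = j}. t i) = sum t ?S"
      using 1(4) by (intro sum.group) auto
    moreover have "{i\<in>?S. \<theta> i = j} = {i. i \<le> m \<and> \<theta> i = j}" if "j \<in> ?T" for j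
      using that by auto
    moreover have "{i. i \<le> m \<and> (\<lambda>i\<in>{..m}. c (\<theta> i)) i = a} = ?S"
      by auto
    ultimately show "weight z a = weight w a"
      by (simp add: weight_def 1)
  qed
qed

lemma weight_equivclp:
  assumes "equivclp (realization_step obj mor) z w"
  shows "weight z = weight w"
  using assms by (induction rule: equivclp_induct) (auto dest: weight_realization_step)

lemma weight_nondegenerate:
  assumes "nondegenerate (m, c, t)" "i \<le> m"
  shows "weight (m, c, t) (c i) = t i"
proof -
  have "{j. j \<le> m \<and> c j = c i} = {i}"
    using assms by (auto simp: nondegenerate_def inj_on_def)
  then show ?thesis
    by (simp add: weight_def)
qed

lemma support_weight_nondegenerate:
  assumes "nondegenerate (m, c, t)"
  shows "{a. weight (m, c, t) a \<noteq> 0} = c ` {..m}"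
proof
  show "{a. weight (m, c, t) a \<noteq> 0} \<subseteq> c ` {..m}"
  proof
    fix a assume "a \<in> {a. weight (m, c, t) a \<noteq> 0}"
    then have "(\<Sum>i | i \<le> m \<and> c i = a. t i) \<noteq> 0"
      by (simp add: weight_def)
    then have "{i. i \<le> m \<and> c i = a} \<noteq> {}"
      by (metis sum.empty)
    then show "a \<in> c ` {..m}"
      by auto
  qed
  have "0 < t i" if "i \<le> m" for i
    using assms that by (auto simp: nondegenerate_def)
  then show "c ` {..m} \<subseteq> {a. weight (m, c, t) a \<noteq> 0}"
    using weight_nondegenerate[OF assms] by force
qed

lemma standard_simplex_pushforward:
  assumes "\<theta> \<in> {..m} \<rightarrow> {..n}" "t \<in> standard_simplex m"
  shows "(\<lambda>j. \<Sum>i\<in>{i. i \<le> m \<and> \<theta> i = j}. t i) \<in> standard_simplex n"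
proof -
  have t: "0 \<le> t i" for i
    using assms by (auto simp: standard_simplex_def)
  have one: "(\<Sum>i\<le>m. t i) = 1"
    using assms by (auto simp: standard_simplex_def)
  have "(\<Sum>j\<le>n. \<Sum>i\<in>{i\<in>{..m}. \<theta> i = j}. t i) = sum t {..m}"
    using assms by (intro sum.group) auto
  then have "(\<Sum>j\<le>n. \<Sum>i\<in>{i. i \<le> m \<and> \<theta> i = j}. t i) = 1"
    using one by simp
  moreover have "(\<Sum>i\<in>{i. i \<le> m \<and> \<theta> i = j}. t i) \<le> 1" for j
  proof -
    have "(\<Sum>i\<in>{i. i \<le> m \<and> \<theta> i = j}. t i) \<le> (\<Sum>i\<le>m. t i)"
      using t by (intro sum_mono2) auto
    then show ?thesis
      using one by simp
  qed
  moreover have "(\<Sum>i\<in>{i. i \<le> m \<and> \<theta> i = j}. t i) = 0" if "j > n" for j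
  proof -
    have "{i. i \<le> m \<and> \<theta> i = j} = {}"
      using assms(1) that by force
    then show ?thesis
      by (simp only: sum.empty)
  qed
  ultimately show ?thesis
    using t by (auto simp: standard_simplex_def intro: sum_nonneg)
qed

locale topological_poset =
  fixes obj :: "'a topology" and mor :: "('a \<times> 'a) topology"
  assumes poset: "partial_order_on (topspace obj) (topspace mor)"
begin

abbreviation step where "step \<equiv> realization_step obj mor"

lemma refl_mor: "a \<in> topspace obj \<Longrightarrow> (a, a) \<in> topspace mor"
  using partial_order_onD(1)[OF poset] by (auto simp: refl_on_def)

lemma trans_mor: "(a, b) \<in> topspace mor \<Longrightarrow> (b, c) \<in> topspace mor \<Longrightarrow> (a, c) \<in> topspace mor"
  using partial_order_onD(2)[OF poset] by (rule transD)

lemma antisym_mor: "(a, b) \<in> topspace mor \<Longrightarrow> (b, a) \<in> topspace mor \<Longrightarrow> a = b"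
  using partial_order_onD(3)[OF poset] by (auto dest: antisymD)

lemma simplex_vertex: "c \<in> nerve_simplices obj mor n \<Longrightarrow> i \<le> n \<Longrightarrow> c i \<in> topspace obj"
  by (auto simp: nerve_simplices_def)

lemma simplex_mono:
  assumes "c \<in> nerve_simplices obj mor n" "i \<le> j" "j \<le> n"
  shows "(c i, c j) \<in> topspace mor"
  using assms(2,3)
proof (induction j rule: dec_induct)
  case base
  then show ?case using assms(1) by (simp add: refl_mor simplex_vertex)
next
  case (step k)
  then have "(c k, c (Suc k)) \<in> topspace mor"
    using assms(1) by (auto simp: nerve_simplices_def)
  with step show ?case
    by (auto intro: trans_mor)
qed

lemma nerve_simplices_reindex:
  assumes "mono_on {..m} \<theta>" "\<theta> \<in> {..m} \<rightarrow> {..n}" "c \<in> nerve_simplices obj mor n"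
  shows "(\<lambda>i\<in>{..m}. c (\<theta> i)) \<in> nerve_simplices obj mor m"
proof -
  have "(c (\<theta> i), c (\<theta> (Suc i))) \<in> topspace mor" if "i < m" for i
    using assms that by (intro simplex_mono[of c n]) (auto simp: mono_on_def)
  then show ?thesis
    using assms by (auto simp: nerve_simplices_def PiE_iff)
qed

lemma realization_step_in_simplex_sum:
  assumes "step z w"
  shows "z \<in> topspace (simplex_sum obj mor)" "w \<in> topspace (simplex_sum obj mor)"
  using assms
  by (cases; simp add: topspace_simplex_sum nerve_simplices_reindex standard_simplex_pushforward)+

lemma point_class_subset:
  assumes "z \<in> topspace (simplex_sum obj mor)"
  shows "point_class obj mor z \<subseteq> topspace (simplex_sum obj mor)"
proof
  fix w assume "w \<in> point_class obj mor z"
  then have "equivclp step z w"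
    by (simp add: point_class_def)
  then show "w \<in> topspace (simplex_sum obj mor)"
    using assms by (induction rule: equivclp_induct) (auto dest: realization_step_in_simplex_sum)
qed

text \<open>
  A vertex of weight 0 can be omitted: the point lies on the face opposite to it.
\<close>

lemma equivclp_delete_vertex:
  assumes c: "c \<in> nerve_simplices obj mor (Suc k)" and t: "t \<in> standard_simplex (Suc k)"
    and i: "i \<le> Suc k" "t i = 0"
  obtains c' t' where "c' \<in> nerve_simplices obj mor k" "t' \<in> standard_simplex k"
    "equivclp step (Suc k, c, t) (k, c', t')"
proof -
  \<comment> \<open>the coface map that skips \<open>i\<close>\<close>
  define \<theta> where "\<theta> j = (if j < i then j else Suc j)" for j :: nat
  have mono: "mono_on {..k} \<theta>"
    by (auto simp: mono_on_def \<theta>_def)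
  have range: "\<theta> \<in> {..k} \<rightarrow> {..Suc k}"
    by (auto simp: \<theta>_def)
  have inj: "inj \<theta>"
    by (auto simp: inj_def \<theta>_def split: if_splits)
  have image: "\<theta> ` {..k} = {..Suc k} - {i}"
  proof
    show "{..Suc k} - {i} \<subseteq> \<theta> ` {..k}"
    proof
      fix l assume "l \<in> {..Suc k} - {i}"
      then have "l = \<theta> (if l < i then l else l - 1)" "(if l < i then l else l - 1) \<le> k"
        using i by (auto simp: \<theta>_def)
      then show "l \<in> \<theta> ` {..k}" by blast
    qed
  qed (use i in \<open>auto simp: \<theta>_def\<close>)
  have t_simps: "\<And>j. 0 \<le> t j" "\<And>j. t j \<le> 1" "\<And>j. j > Suc k \<Longrightarrow> t j = 0" "(\<Sum>j\<le>Suc k. t j) = 1"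
    using t by (auto simp: standard_simplex_def)
  have "(\<Sum>j\<le>k. t (\<theta> j)) = sum t ({..Suc k} - {i})"
    using inj by (simp add: image[symmetric] sum.reindex inj_on_subset)
  also have "\<dots> = 1"
    using i t_simps(4) by (simp add: sum_diff1)
  finally have t': "(\<lambda>j. t (\<theta> j)) \<in> standard_simplex k"
    using t_simps i(1) by (auto simp: standard_simplex_def \<theta>_def)
  have push: "(\<Sum>j\<in>{j. j \<le> k \<and> \<theta> j = l}. t (\<theta> j)) = t l" for l
  proof (cases "l \<le> Suc k \<and> l \<noteq> i")
    case True
    then obtain j where j: "j \<le> k" "l = \<theta> j"
      using image by (metis DiffI atMost_iff imageE singletonD)
    then have "{j. j \<le> k \<and> \<theta> j = l} = {j}"
      using inj by (auto dest: injD)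
    then show ?thesis
      by (simp add: j(2))
  next
    case False
    then have "{j. j \<le> k \<and> \<theta> j = l} = {}"
      using image by force
    moreover have "t l = 0"
      using False i t_simps(3) by (cases "l = i") auto
    ultimately show ?thesis
      by simp
  qed
  have "step (k, (\<lambda>j\<in>{..k}. c (\<theta> j)), \<lambda>j. t (\<theta> j)) (Suc k, c, t)"
    using realization_step.intros[OF mono range c t'] by (simp only: push)
  then show ?thesis
    using that nerve_simplices_reindex[OF mono range c] t' by blast
qed

text \<open>
  Two consecutive equal vertices can be merged: the simplex is degenerate along that edge.
\<close>

lemma equivclp_collapse_edge:
  assumes c: "c \<in> nerve_simplices obj mor (Suc k)" and t: "t \<in> standard_simplex (Suc k)"
    and i: "i \<le> k" "c i = c (Suc i)"
  obtains c' t' where "c' \<in> nerve_simplices obj mor k" "t' \<in> standard_simplex k"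
    "equivclp step (Suc k, c, t) (k, c', t')"
proof -
  \<comment> \<open>\<open>\<sigma>\<close> is the codegeneracy that takes the value \<open>i\<close> twice, and \<open>\<delta>\<close> is a section of it;
    \<open>c \<circ> \<delta> \<circ> \<sigma> = c\<close> because \<open>c i = c (Suc i)\<close>\<close>
  define \<delta> where "\<delta> j = (if j \<le> i then j else Suc j)" for j :: nat
  define \<sigma> where "\<sigma> j = (if j \<le> i then j else j - 1)" for j :: nat
  define c' where "c' = (\<lambda>j\<in>{..k}. c (\<delta> j))"
  define t' where "t' = (\<lambda>l. \<Sum>j\<in>{j. j \<le> Suc k \<and> \<sigma> j = l}. t j)"
  have c': "c' \<in> nerve_simplices obj mor k"
    unfolding c'_def using i(1)
    by (intro nerve_simplices_reindex[OF _ _ c]) (auto simp: mono_on_def \<delta>_def)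
  have mono: "mono_on {..Suc k} \<sigma>" and range: "\<sigma> \<in> {..Suc k} \<rightarrow> {..k}"
    using i(1) by (auto simp: mono_on_def \<sigma>_def)
  have t': "t' \<in> standard_simplex k"
    unfolding t'_def using range t by (rule standard_simplex_pushforward)
  have "c' (\<sigma> j) = c j" if "j \<le> Suc k" for j
  proof (cases "j = Suc i")
    case False
    then have "\<delta> (\<sigma> j) = j" "\<sigma> j \<le> k"
      using that i(1) by (auto simp: \<delta>_def \<sigma>_def)
    then show ?thesis
      by (simp add: c'_def)
  qed (use i in \<open>simp add: c'_def \<sigma>_def \<delta>_def\<close>)
  moreover have "c \<in> extensional {..Suc k}"
    using c by (auto simp: nerve_simplices_def PiE_iff)
  ultimately have "(\<lambda>j\<in>{..Suc k}. c' (\<sigma> j)) = c"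
    by (intro extensionalityI[of _ "{..Suc k}"]) auto
  then have "step (Suc k, c, t) (k, c', t')"
    using realization_step.intros[OF mono range c' t] by (simp add: t'_def)
  then show ?thesis
    using that c' t' by blast
qed

text \<open>
  A degenerate point has either a vertex of weight 0 or, by antisymmetry, two consecutive equal
  vertices; in both cases it is equivalent to a point of a simplex of smaller dimension.
\<close>

lemma exists_nondegenerate:
  assumes "z \<in> topspace (simplex_sum obj mor)"
  obtains w where "w \<in> topspace (simplex_sum obj mor)" "nondegenerate w" "equivclp step z w"
proof -
  have "\<exists>w\<in>topspace (simplex_sum obj mor). nondegenerate w \<and> equivclp step (m, c, t) w"
    if "c \<in> nerve_simplices obj mor m" "t \<in> standard_simplex m" for m c t
    using that
  proof (induction m arbitrary: c t)
    case 0
    then have "nondegenerate (0, c, t)"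
      by (auto simp: nondegenerate_def standard_simplex_0)
    then show ?case
      using 0 by (intro bexI[of _ "(0, c, t)"]) (auto simp: topspace_simplex_sum)
  next
    case (Suc k)
    show ?case
    proof (cases "nondegenerate (Suc k, c, t)")
      case True
      then show ?thesis
        using Suc.prems by (intro bexI[of _ "(Suc k, c, t)"]) (auto simp: topspace_simplex_sum)
    next
      case False
      have nonneg: "0 \<le> t i" for i
        using Suc.prems(2) by (auto simp: standard_simplex_def)
      consider (zero) i where "i \<le> Suc k" "t i = 0" | (equal) i where "i \<le> k" "c i = c (Suc i)"
      proof (cases "\<exists>i\<le>Suc k. t i = 0")
        case no_zero: False
        then have "\<not> inj_on c {..Suc k}"
          using False nonneg by (auto simp: nondegenerate_def order_le_less)
        then obtain i j where ij: "i < j" "j \<le> Suc k" "c i = c j"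
          by (metis (no_types, lifting) atMost_iff linorder_inj_onI' nat_less_le)
        then have "(c i, c (Suc i)) \<in> topspace mor" "(c (Suc i), c i) \<in> topspace mor"
          using simplex_mono[OF Suc.prems(1), of i "Suc i"] simplex_mono[OF Suc.prems(1), of "Suc i" j]
          by auto
        then show ?thesis
          using equal[of i] antisym_mor ij by auto
      qed (use zero in blast)
      then obtain c' t' where *: "c' \<in> nerve_simplices obj mor k" "t' \<in> standard_simplex k"
        "equivclp step (Suc k, c, t) (k, c', t')"
        using equivclp_delete_vertex[OF Suc.prems] equivclp_collapse_edge[OF Suc.prems]
        by (metis (full_types))
      then show ?thesis
        using Suc.IH[OF *(1,2)] by (meson equivclp_trans)
    qed
  qed
  moreover obtain m c t where "z = (m, c, t)" "c \<in> nerve_simplices obj mor m" "t \<in> standard_simplex m"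
    using assms by (auto simp: topspace_simplex_sum)
  ultimately show thesis
    using that by blast
qed

text \<open>
  The position of a vertex in a strictly increasing chain can be read off the set of vertices. Hence
  the support of the weight determines the chain.
\<close>

lemma nondegenerate_rank:
  assumes "nondegenerate (m, c, t)" "c \<in> nerve_simplices obj mor m" "i \<le> m"
  shows "card {a \<in> c ` {..m}. a \<noteq> c i \<and> (a, c i) \<in> topspace mor} = i"
proof -
  have inj: "inj_on c {..m}"
    using assms by (simp add: nondegenerate_def)
  have "{a \<in> c ` {..m}. a \<noteq> c i \<and> (a, c i) \<in> topspace mor} = c ` {..<i}"
  proof
    show "c ` {..<i} \<subseteq> {a \<in> c ` {..m}. a \<noteq> c i \<and> (a, c i) \<in> topspace mor}"
      using assms(3) inj simplex_mono[OF assms(2)] by (auto simp: inj_on_def)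
    show "{a \<in> c ` {..m}. a \<noteq> c i \<and> (a, c i) \<in> topspace mor} \<subseteq> c ` {..<i}"
    proof
      fix a assume a: "a \<in> {a \<in> c ` {..m}. a \<noteq> c i \<and> (a, c i) \<in> topspace mor}"
      then obtain j where j: "j \<le> m" "a = c j" by auto
      then have "\<not> i \<le> j"
        using a simplex_mono[OF assms(2), of i j] antisym_mor by auto
      then show "a \<in> c ` {..<i}"
        using j by auto
    qed
  qed
  moreover have "inj_on c {..<i}"
    using inj by (rule inj_on_subset) (use assms(3) in auto)
  then have "card (c ` {..<i}) = i"
    by (simp add: card_image)
  ultimately show ?thesis
    by simp
qed

lemma nondegenerate_eqI:
  assumes z: "z \<in> topspace (simplex_sum obj mor)" "nondegenerate z"
    and w: "w \<in> topspace (simplex_sum obj mor)" "nondegenerate w"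
    and eq: "weight z = weight w"
  shows "z = w"
proof -
  obtain m c t where z_eq: "z = (m, c, t)" by (cases z)
  obtain n d s where w_eq: "w = (n, d, s)" by (cases w)
  have c: "c \<in> nerve_simplices obj mor m" and t: "t \<in> standard_simplex m"
    and d: "d \<in> nerve_simplices obj mor n" and s: "s \<in> standard_simplex n"
    using z w by (auto simp: z_eq w_eq topspace_simplex_sum)
  have nz: "nondegenerate (m, c, t)" and nw: "nondegenerate (n, d, s)"
    using z w by (auto simp: z_eq w_eq)
  have supp: "c ` {..m} = d ` {..n}"
    using support_weight_nondegenerate[OF nz] support_weight_nondegenerate[OF nw] eq
    by (simp add: z_eq w_eq)
  have "inj_on c {..m}" "inj_on d {..n}"
    using nz nw by (auto simp: nondegenerate_def)
  then have "card {..m} = card {..n}"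
    using supp by (metis card_image)
  then have mn: "m = n" by simp
  have cd: "c i = d i" if "i \<le> m" for i
  proof -
    have "c i \<in> d ` {..n}"
      unfolding supp[symmetric] using that by simp
    then obtain j where j: "j \<le> n" "c i = d j"
      by auto
    then have "i = j"
      using nondegenerate_rank[OF nz c that] nondegenerate_rank[OF nw d j(1)] supp by simp
    then show ?thesis using j by simp
  qed
  have "c = d"
    using c d cd mn by (intro extensionalityI[of _ "{..m}"]) (auto simp: nerve_simplices_def PiE_iff)
  moreover have "t i = s i" for i
  proof (cases "i \<le> m")
    case True
    then show ?thesis
      using weight_nondegenerate[OF nz, of i] weight_nondegenerate[OF nw, of i] eq cd mn
      by (simp add: z_eq w_eq)
  qed (use t s mn in \<open>auto simp: standard_simplex_def\<close>)
  ultimately show ?thesis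
    by (auto simp: z_eq w_eq mn)
qed

lemma equivclp_iff_weight:
  assumes "z \<in> topspace (simplex_sum obj mor)" "w \<in> topspace (simplex_sum obj mor)"
  shows "equivclp step z w \<longleftrightarrow> weight z = weight w"
proof
  assume eq: "weight z = weight w"
  obtain z' where z': "z' \<in> topspace (simplex_sum obj mor)" "nondegenerate z'" "equivclp step z z'"
    using exists_nondegenerate[OF assms(1)] .
  obtain w' where w': "w' \<in> topspace (simplex_sum obj mor)" "nondegenerate w'" "equivclp step w w'"
    using exists_nondegenerate[OF assms(2)] .
  have "z' = w'"
    using nondegenerate_eqI z' w' eq weight_equivclp by metis
  then show "equivclp step z w"
    using z' w' by (metis equivclp_sym equivclp_trans)
qed (rule weight_equivclp)

end


section \<open>Hausdorff and compact realizations\<close>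

definition barycentric_sum :: "('a \<Rightarrow> real) \<Rightarrow> 'a simplex_point \<Rightarrow> real" where
  "barycentric_sum f z = (case z of (m, c, t) \<Rightarrow> \<Sum>i\<le>m. t i * f (c i))"

lemma barycentric_sum_weight:
  assumes "finite S" "c ` {..m} \<subseteq> S"
  shows "barycentric_sum f (m, c, t) = (\<Sum>a\<in>S. weight (m, c, t) a * f a)"
proof -
  have "(\<Sum>a\<in>S. weight (m, c, t) a * f a) =
      (\<Sum>a\<in>S. \<Sum>i\<in>{i \<in> {..m}. c i = a}. t i * f (c i))"
    by (intro sum.cong) (auto simp: weight_def sum_distrib_right)
  also have "\<dots> = (\<Sum>i\<in>{..m}. t i * f (c i))"
    using assms by (intro sum.group) auto
  finally show ?thesis
    by (simp add: barycentric_sum_def)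
qed

lemma barycentric_sum_cong_weight:
  assumes "weight z = weight w"
  shows "barycentric_sum f z = barycentric_sum f w"
proof -
  obtain m c t n d s where eq: "z = (m, c, t)" "w = (n, d, s)"
    by (cases z, cases w) auto
  let ?S = "c ` {..m} \<union> d ` {..n}"
  have "barycentric_sum f z = (\<Sum>a\<in>?S. weight z a * f a)"
    unfolding eq by (rule barycentric_sum_weight) auto
  also have "\<dots> = barycentric_sum f w"
    unfolding assms unfolding eq by (rule barycentric_sum_weight[symmetric]) auto
  finally show ?thesis .
qed

lemma continuous_map_barycentric_sum:
  assumes f: "continuous_map obj euclideanreal f"
  shows "continuous_map (simplex_sum obj mor) euclideanreal (barycentric_sum f)"
  unfolding simplex_sum_def
proof (rule continuous_map_from_sum_topology)
  fix m :: nat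
  let ?X = "prod_topology (nerve obj mor m) (subtopology (powertop_real UNIV) (standard_simplex m))"
  have "continuous_map ?X euclideanreal (\<lambda>x. snd x i * f (fst x i))" if "i \<le> m" for i
  proof (rule continuous_map_real_mult)
    have "continuous_map (subtopology (powertop_real UNIV) (standard_simplex m)) euclideanreal (\<lambda>t. t i)"
      by (intro continuous_map_from_subtopology continuous_map_product_projection) auto
    then show "continuous_map ?X euclideanreal (\<lambda>x. snd x i)"
      using continuous_map_compose[OF continuous_map_snd] by (fastforce simp: comp_def)
    have "continuous_map (nerve obj mor m) euclideanreal (\<lambda>c. f (c i))"
      using continuous_map_compose[OF continuous_map_nerve_vertex[OF that] f] by (simp add: comp_def)
    then show "continuous_map ?X euclideanreal (\<lambda>x. f (fst x i))"
      using continuous_map_compose[OF continuous_map_fst] by (fastforce simp: comp_def)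
  qed
  then have "continuous_map ?X euclideanreal (\<lambda>x. \<Sum>i\<le>m. snd x i * f (fst x i))"
    by (intro continuous_map_sum) auto
  then show "continuous_map ?X euclideanreal (\<lambda>x. barycentric_sum f (m, x))"
    by (simp add: barycentric_sum_def case_prod_unfold)
qed

context topological_poset
begin

lemma point_class_eq_iff_weight:
  assumes "z \<in> topspace (simplex_sum obj mor)" "w \<in> topspace (simplex_sum obj mor)"
  shows "point_class obj mor z = point_class obj mor w \<longleftrightarrow> weight z = weight w"
  using assms by (simp add: point_class_eq_iff equivclp_iff_weight)

text \<open>
  A continuous function on objects extends affinely over the simplices: its integral against the
  weight is continuous on the sum of the simplices and depends on the weight alone.
\<close>

lemma continuous_map_realization_extension:
  assumes f: "continuous_map obj euclideanreal f"
  obtains g where "continuous_map (realization obj mor) euclideanreal g"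
    "\<And>z. z \<in> topspace (simplex_sum obj mor) \<Longrightarrow> g (point_class obj mor z) = barycentric_sum f z"
proof
  let ?g = "\<lambda>x. barycentric_sum f (SOME z. z \<in> x)"
  show g: "?g (point_class obj mor z) = barycentric_sum f z" for z
  proof -
    have "(SOME w. w \<in> point_class obj mor z) \<in> point_class obj mor z"
      by (rule someI) (rule self_in_point_class)
    then have "weight z = weight (SOME w. w \<in> point_class obj mor z)"
      by (intro weight_equivclp) (simp add: point_class_def)
    then show ?thesis
      by (intro barycentric_sum_cong_weight) simp
  qed
  show "continuous_map (realization obj mor) euclideanreal ?g"
    unfolding realization_def
    using continuous_map_barycentric_sum[OF f]
    by (intro continuous_map_from_quotient_topology) (simp only: g[unfolded point_class_def])
qed

lemma exists_nondegenerate_representative: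
  assumes "x \<in> topspace (realization obj mor)"
  obtains m c t where "(m, c, t) \<in> topspace (simplex_sum obj mor)" "nondegenerate (m, c, t)"
    "x = point_class obj mor (m, c, t)"
proof -
  obtain z where z: "z \<in> topspace (simplex_sum obj mor)" "x = point_class obj mor z"
    using assms by (auto simp: topspace_realization)
  obtain w where "w \<in> topspace (simplex_sum obj mor)" "nondegenerate w" "equivclp step z w"
    using exists_nondegenerate[OF z(1)] .
  then show thesis
    using that z(2) by (metis point_class_eq_iff prod_cases3)
qed

text \<open>
  Distinct points have different weights. A product of functions that separate objects isolates one
  vertex at which the weights differ.
\<close>

theorem Hausdorff_realization:
  assumes sep: "\<And>a b. \<lbrakk>a \<in> topspace obj; b \<in> topspace obj; a \<noteq> b\<rbrakk> \<Longrightarrow>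
                   \<exists>f. continuous_map obj euclideanreal f \<and> f a \<noteq> f b"
  shows "Hausdorff_space (realization obj mor)"
proof (rule Hausdorff_space_if_separated_by_real_functions)
  fix x y
  assume x: "x \<in> topspace (realization obj mor)" and y: "y \<in> topspace (realization obj mor)"
    and "x \<noteq> y"
  obtain m c t where z: "(m, c, t) \<in> topspace (simplex_sum obj mor)" "x = point_class obj mor (m, c, t)"
    using exists_nondegenerate_representative[OF x] by metis
  obtain n d s where w: "(n, d, s) \<in> topspace (simplex_sum obj mor)" "y = point_class obj mor (n, d, s)"
    using exists_nondegenerate_representative[OF y] by metis
  have "weight (m, c, t) \<noteq> weight (n, d, s)"
    using point_class_eq_iff_weight[OF z(1) w(1)] \<open>x \<noteq> y\<close> z(2) w(2) by simp
  then obtain a where a: "weight (m, c, t) a \<noteq> weight (n, d, s) a"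
    by auto
  define S where "S = c ` {..m} \<union> d ` {..n}"
  have S: "finite S" "c ` {..m} \<subseteq> S" "d ` {..n} \<subseteq> S"
    by (auto simp: S_def)
  have S_obj: "S \<subseteq> topspace obj"
    using z(1) w(1) by (auto simp: S_def topspace_simplex_sum simplex_vertex)
  have "a \<in> S"
  proof (rule ccontr)
    assume "a \<notin> S"
    then have "{i. i \<le> m \<and> c i = a} = {}" "{i. i \<le> n \<and> d i = a} = {}"
      by (auto simp: S_def)
    then have "weight (m, c, t) a = 0" "weight (n, d, s) a = 0"
      unfolding weight_def prod.case by (simp_all only: sum.empty)
    then show False
      using a by simp
  qed
  have "\<exists>f. continuous_map obj euclideanreal f \<and> f a \<noteq> f b" if "b \<in> S - {a}" for b
    using sep[of a b] that \<open>a \<in> S\<close> S_obj by auto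
  then obtain g where g: "\<And>b. b \<in> S - {a} \<Longrightarrow> continuous_map obj euclideanreal (g b) \<and> g b a \<noteq> g b b"
    by metis
  \<comment> \<open>\<open>f\<close> vanishes at all vertices of the two points except \<open>a\<close>, so its extension compares the
    weights of \<open>a\<close>\<close>
  define f where "f x = (\<Prod>b\<in>S - {a}. g b x - g b b)" for x
  have f: "continuous_map obj euclideanreal f"
    unfolding f_def using S(1) g
    by (intro continuous_map_prod continuous_map_diff continuous_map_const[THEN iffD2]) auto
  have fa: "f a \<noteq> 0"
    using S(1) g by (simp add: f_def)
  have fb: "f b = 0" if "b \<in> S - {a}" for b
    unfolding f_def using S(1) that by (intro prod_zero) auto
  have eval: "(\<Sum>b\<in>S. u b * f b) = u a * f a" for u :: "'a \<Rightarrow> real"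
  proof -
    have "(\<Sum>b\<in>S. u b * f b) = u a * f a + (\<Sum>b\<in>S - {a}. u b * f b)"
      using S(1) \<open>a \<in> S\<close> by (rule sum.remove)
    then show ?thesis
      using fb by simp
  qed
  obtain h where h: "continuous_map (realization obj mor) euclideanreal h"
    "\<And>z. z \<in> topspace (simplex_sum obj mor) \<Longrightarrow> h (point_class obj mor z) = barycentric_sum f z"
    using continuous_map_realization_extension[OF f] by blast
  have "h x = weight (m, c, t) a * f a" "h y = weight (n, d, s) a * f a"
    using h(2)[OF z(1)] h(2)[OF w(1)] S
    by (simp_all add: z(2) w(2) barycentric_sum_weight[of S] eval)
  then show "\<exists>h. continuous_map (realization obj mor) euclideanreal h \<and> h x \<noteq> h y"
    using h(1) a fa by auto
qed

text \<open>
  Only the simplices of dimension less than the number of objects contain nondegenerate points. Over a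
  finite set of objects there are finitely many of them, and they cover the realization by compact sets.
\<close>

theorem compact_realization:
  assumes fin: "finite (topspace obj)"
  shows "compact_space (realization obj mor)"
proof -
  define cell where "cell m c = (\<lambda>t. point_class obj mor (m, c, t)) ` standard_simplex m" for m c
  define C where "C = (\<Union>m<card (topspace obj). cell m ` nerve_simplices obj mor m)"
  have compact_cell: "compactin (realization obj mor) (cell m c)"
    if "c \<in> nerve_simplices obj mor m" for m c
  proof -
    let ?S = "subtopology (powertop_real UNIV) (standard_simplex m)"
    have "continuous_map ?S (prod_topology (nerve obj mor m) ?S) (\<lambda>t. (c, t))"
      using that by (intro continuous_map_pairedI) auto
    moreover have "continuous_map (prod_topology (nerve obj mor m) ?S) (simplex_sum obj mor) (\<lambda>x. (m, x))"
      unfolding simplex_sum_def by (rule continuous_map_component_injection) simp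
    moreover have "continuous_map (simplex_sum obj mor) (realization obj mor) (point_class obj mor)"
      unfolding realization_def point_class_def by (rule continuous_map_quotient_topology)
    ultimately have "continuous_map ?S (realization obj mor) (point_class obj mor \<circ> ((\<lambda>x. (m, x)) \<circ> (\<lambda>t. (c, t))))"
      by (intro continuous_map_compose)
    moreover have "compactin ?S (standard_simplex m)"
      by (simp add: compactin_subtopology compactin_standard_simplex)
    ultimately have "compactin (realization obj mor)
        ((point_class obj mor \<circ> ((\<lambda>x. (m, x)) \<circ> (\<lambda>t. (c, t)))) ` standard_simplex m)"
      by (rule image_compactin[rotated])
    then show ?thesis
      by (simp add: cell_def comp_def)
  qed
  have "finite (nerve_simplices obj mor m)" for m
    unfolding nerve_simplices_def using fin by (intro finite_Collect_conjI disjI1) (simp add: finite_PiE)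
  then have "finite C"
    by (simp add: C_def)
  moreover have "compactin (realization obj mor) K" if "K \<in> C" for K
    using that compact_cell by (auto simp: C_def)
  ultimately have "compactin (realization obj mor) (\<Union>C)"
    by (intro compactin_Union)
  moreover have "topspace (realization obj mor) \<subseteq> \<Union>C"
  proof
    fix x assume "x \<in> topspace (realization obj mor)"
    then obtain m c t where z: "(m, c, t) \<in> topspace (simplex_sum obj mor)" "nondegenerate (m, c, t)"
      "x = point_class obj mor (m, c, t)"
      by (rule exists_nondegenerate_representative)
    then have c: "c \<in> nerve_simplices obj mor m" and t: "t \<in> standard_simplex m"
      by (auto simp: topspace_simplex_sum)
    have "inj_on c {..m}"
      using z(2) by (simp add: nondegenerate_def)
    then have "card {..m} \<le> card (topspace obj)"
      using simplex_vertex[OF c] fin by (intro card_inj_on_le) auto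
    then have "m < card (topspace obj)"
      by simp
    then show "x \<in> \<Union>C"
      using c t z(3) unfolding C_def cell_def by blast
  qed
  ultimately show ?thesis
    by (metis compact_space_def compactin_subset_topspace subset_antisym)
qed

end

section \<open>Maps of topological posets\<close>

text \<open>
  \<open>realization_map\<close> at the level of a single representative.
\<close>

definition map_point :: "('a \<Rightarrow> 'b) \<Rightarrow> 'a simplex_point \<Rightarrow> 'b simplex_point" where
  "map_point f = (\<lambda>(m, c, t). (m, \<lambda>i\<in>{..m}. f (c i), t))"

lemma realization_map_eq_image: "realization_map f x = map_point f ` x"
  by (simp add: realization_map_def map_point_def)

lemma nondegenerate_map_point:
  assumes "nondegenerate (m, c, t)" "inj_on f (c ` {..m})"
  shows "nondegenerate (map_point f (m, c, t))"
  using assms by (auto simp: nondegenerate_def map_point_def inj_on_def)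

locale poset_map = P: topological_poset obj mor + Q: topological_poset obj' mor'
  for obj :: "'a topology" and mor and obj' :: "'b topology" and mor' +
  fixes f :: "'a \<Rightarrow> 'b"
  assumes map_obj: "a \<in> topspace obj \<Longrightarrow> f a \<in> topspace obj'"
    and map_mor: "(a, b) \<in> topspace mor \<Longrightarrow> (f a, f b) \<in> topspace mor'"
begin

lemma map_point_in_nerve_simplices:
  "c \<in> nerve_simplices obj mor m \<Longrightarrow> (\<lambda>i\<in>{..m}. f (c i)) \<in> nerve_simplices obj' mor' m"
  by (auto simp: nerve_simplices_def PiE_iff map_obj map_mor)

lemma map_point_in_simplex_sum:
  "z \<in> topspace (simplex_sum obj mor) \<Longrightarrow> map_point f z \<in> topspace (simplex_sum obj' mor')"
  by (auto simp: topspace_simplex_sum map_point_def map_point_in_nerve_simplices)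

lemma realization_step_map_point:
  assumes "P.step z w"
  shows "Q.step (map_point f z) (map_point f w)"
  using assms
proof cases
  case (1 m \<theta> n c t)
  have "(\<lambda>i\<in>{..m}. f ((\<lambda>i\<in>{..m}. c (\<theta> i)) i)) = (\<lambda>i\<in>{..m}. (\<lambda>j\<in>{..n}. f (c j)) (\<theta> i))"
    using 1(4) by (intro restrict_ext) (auto simp: Pi_iff)
  then show ?thesis
    using realization_step.intros[OF 1(3,4) map_point_in_nerve_simplices[OF 1(5)] 1(6)]
    by (simp only: 1(1,2) map_point_def prod.case)
qed

lemma equivclp_map_point:
  assumes "equivclp P.step z w"
  shows "equivclp Q.step (map_point f z) (map_point f w)"
  using assms
  by (induction rule: equivclp_induct) (auto dest: realization_step_map_point intro: equivclp_into_equivclp)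

text \<open>
  Unless \<open>f\<close> is an isomorphism, the image of a class need not be a whole class, so the classes of its
  elements are united; by \<open>induced_point_class\<close> they all coincide.
\<close>

definition induced :: "'a simplex_point set \<Rightarrow> 'b simplex_point set" where
  "induced x = (\<Union>z\<in>x. point_class obj' mor' (map_point f z))"

lemma induced_point_class:
  "induced (point_class obj mor z) = point_class obj' mor' (map_point f z)"
proof -
  have "point_class obj' mor' (map_point f w) = point_class obj' mor' (map_point f z)"
    if "w \<in> point_class obj mor z" for w
    using that equivclp_map_point[of z w]
    by (auto simp: point_class_eq_iff point_class_def[of obj] intro: equivclp_sym)
  then have "induced (point_class obj mor z) = (\<Union>w\<in>point_class obj mor z. point_class obj' mor' (map_point f z))"
    unfolding induced_def by (rule SUP_cong[OF refl])
  then show ?thesis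
    using self_in_point_class[of z obj mor] by blast
qed

theorem continuous_map_induced:
  assumes "continuous_map obj obj' f" "continuous_map mor mor' (map_prod f f)"
  shows "continuous_map (realization obj mor) (realization obj' mor') induced"
  unfolding realization_def
proof (rule continuous_map_from_quotient_topology)
  have "continuous_map (simplex_sum obj mor) (simplex_sum obj' mor') (map_point f)"
    unfolding simplex_sum_def[of obj]
  proof (rule continuous_map_from_sum_topology)
    fix m :: nat
    let ?S = "subtopology (powertop_real UNIV) (standard_simplex m)"
    have "continuous_map (nerve obj mor m) (nerve obj' mor' m) (\<lambda>c. \<lambda>i\<in>{..m}. f (c i))"
    proof (rule continuous_map_into_nerve)
      fix i assume "i \<le> m"
      then show "continuous_map (nerve obj mor m) obj' (\<lambda>c. (\<lambda>i\<in>{..m}. f (c i)) i)"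
        using continuous_map_compose[OF continuous_map_nerve_vertex assms(1), of i m]
        by (simp add: comp_def)
    next
      fix i assume "i < m"
      then show "continuous_map (nerve obj mor m) mor'
          (\<lambda>c. ((\<lambda>i\<in>{..m}. f (c i)) i, (\<lambda>i\<in>{..m}. f (c i)) (Suc i)))"
        using continuous_map_compose[OF continuous_map_nerve_edge assms(2), of i m]
        by (simp add: comp_def)
    qed auto
    then have "continuous_map (prod_topology (nerve obj mor m) ?S) (prod_topology (nerve obj' mor' m) ?S)
        (\<lambda>(c, t). (\<lambda>i\<in>{..m}. f (c i), t))"
      by (simp add: continuous_map_prod_top)
    moreover have "continuous_map (prod_topology (nerve obj' mor' m) ?S) (simplex_sum obj' mor') (\<lambda>x. (m, x))"
      unfolding simplex_sum_def by (rule continuous_map_component_injection) simp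
    ultimately have "continuous_map (prod_topology (nerve obj mor m) ?S) (simplex_sum obj' mor')
        ((\<lambda>x. (m, x)) \<circ> (\<lambda>(c, t). (\<lambda>i\<in>{..m}. f (c i), t)))"
      by (rule continuous_map_compose)
    then show "continuous_map (prod_topology (nerve obj mor m) ?S) (simplex_sum obj' mor')
        (\<lambda>x. map_point f (m, x))"
      by (simp add: map_point_def comp_def case_prod_unfold)
  qed
  moreover have "continuous_map (simplex_sum obj' mor') (realization obj' mor') (point_class obj' mor')"
    unfolding realization_def point_class_def by (rule continuous_map_quotient_topology)
  ultimately have "continuous_map (simplex_sum obj mor) (realization obj' mor')
      (point_class obj' mor' \<circ> map_point f)"
    by (rule continuous_map_compose)
  then show "continuous_map (simplex_sum obj mor)
      (quotient_topology (simplex_sum obj' mor') (\<lambda>z. {w. equivclp Q.step z w}))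
      (\<lambda>z. induced {w. equivclp P.step z w})"
    by (simp add: comp_def induced_point_class[unfolded point_class_def[of obj]] realization_def)
qed

end

section \<open>Fixed points of a realization\<close>

locale poset_action = topological_poset obj mor
  for obj :: "'a topology" and mor +
  fixes act :: "'g \<Rightarrow> 'a \<Rightarrow> 'a" and H :: "'g set"
  assumes act_bij: "h \<in> H \<Longrightarrow> bij_betw (act h) (topspace obj) (topspace obj)"
    and act_mor: "\<lbrakk>h \<in> H; a \<in> topspace obj; b \<in> topspace obj\<rbrakk> \<Longrightarrow>
                    (act h a, act h b) \<in> topspace mor \<longleftrightarrow> (a, b) \<in> topspace mor"
begin

lemma mor_in_obj: "(a, b) \<in> topspace mor \<Longrightarrow> a \<in> topspace obj \<and> b \<in> topspace obj"
  using partial_order_onD(4)[OF poset] by auto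

lemma poset_map_act:
  assumes "h \<in> H"
  shows "poset_map obj mor obj mor (act h)"
proof unfold_locales
  show "act h a \<in> topspace obj" if "a \<in> topspace obj" for a
    using act_bij[OF assms] that by (auto simp: bij_betw_def)
  show "(act h a, act h b) \<in> topspace mor" if "(a, b) \<in> topspace mor" for a b
    using act_mor[OF assms] mor_in_obj[OF that] that by auto
qed

lemma poset_map_act_inverse:
  assumes "h \<in> H"
  shows "poset_map obj mor obj mor (inv_into (topspace obj) (act h))"
proof unfold_locales
  let ?i = "inv_into (topspace obj) (act h)"
  have image: "act h ` topspace obj = topspace obj"
    using act_bij[OF assms] by (simp add: bij_betw_def)
  show i: "?i a \<in> topspace obj" if "a \<in> topspace obj" for a
    using that image by (metis inv_into_into)
  show "(?i a, ?i b) \<in> topspace mor" if "(a, b) \<in> topspace mor" for a b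
    using act_mor[OF assms i i, of a b] mor_in_obj[OF that] that image by (simp add: f_inv_into_f)
qed

text \<open>
  If \<open>h\<close> fixes the class, then \<open>h\<close> maps its nondegenerate representative to a nondegenerate
  representative, and there is only one. The converse uses that \<open>h\<inverse>\<close> also acts, to see that the image of the class is all of it.
\<close>

lemma point_class_fixed_iff:
  assumes z: "(m, c, t) \<in> topspace (simplex_sum obj mor)" "nondegenerate (m, c, t)"
  shows "(\<forall>h\<in>H. realization_map (act h) (point_class obj mor (m, c, t)) = point_class obj mor (m, c, t))
     \<longleftrightarrow> (\<forall>h\<in>H. \<forall>i\<le>m. act h (c i) = c i)"
proof (intro ball_cong refl iffI allI impI)
  fix h i
  assume h: "h \<in> H" and i: "i \<le> m"
    and eq: "realization_map (act h) (point_class obj mor (m, c, t)) = point_class obj mor (m, c, t)"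
  interpret h: poset_map obj mor obj mor "act h"
    using h by (rule poset_map_act)
  have c: "c \<in> nerve_simplices obj mor m"
    using z(1) by (simp add: topspace_simplex_sum)
  have "map_point (act h) (m, c, t) \<in> point_class obj mor (m, c, t)"
    using eq self_in_point_class[of "(m, c, t)" obj mor] by (auto simp: realization_map_eq_image)
  then have "weight (m, c, t) = weight (map_point (act h) (m, c, t))"
    by (intro weight_equivclp) (simp add: point_class_def)
  moreover have "inj_on (act h) (c ` {..m})"
    using act_bij[OF h] simplex_vertex[OF c] by (auto simp: bij_betw_def intro: inj_on_subset)
  ultimately have "(m, c, t) = map_point (act h) (m, c, t)"
    using z by (intro nondegenerate_eqI h.map_point_in_simplex_sum nondegenerate_map_point)
  then have "c = (\<lambda>i\<in>{..m}. act h (c i))"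
    by (simp add: map_point_def)
  then show "act h (c i) = c i"
    using i by (metis atMost_iff restrict_apply')
next
  fix h
  assume h: "h \<in> H" and fixed: "\<forall>i\<le>m. act h (c i) = c i"
  interpret h: poset_map obj mor obj mor "act h"
    using h by (rule poset_map_act)
  let ?i = "inv_into (topspace obj) (act h)"
  interpret i: poset_map obj mor obj mor ?i
    using h by (rule poset_map_act_inverse)
  have c: "c \<in> nerve_simplices obj mor m"
    using z(1) by (simp add: topspace_simplex_sum)
  have c_ext: "(\<lambda>i\<in>{..m}. c i) = c"
    using c by (auto simp: nerve_simplices_def PiE_iff extensional_restrict)
  have image: "act h ` topspace obj = topspace obj" and inj: "inj_on (act h) (topspace obj)"
    using act_bij[OF h] by (simp_all add: bij_betw_def)
  have "map_point (act h) (m, c, t) = (m, \<lambda>i\<in>{..m}. c i, t)"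
    using fixed by (auto simp: map_point_def)
  then have h_fix: "map_point (act h) (m, c, t) = (m, c, t)"
    by (simp add: c_ext)
  have "?i (c j) = c j" if "j \<le> m" for j
    using inv_into_f_f[OF inj simplex_vertex[OF c that]] fixed that by simp
  then have "map_point ?i (m, c, t) = (m, \<lambda>i\<in>{..m}. c i, t)"
    by (auto simp: map_point_def)
  then have i_fix: "map_point ?i (m, c, t) = (m, c, t)"
    by (simp add: c_ext)
  show "realization_map (act h) (point_class obj mor (m, c, t)) = point_class obj mor (m, c, t)"
    unfolding realization_map_eq_image
  proof
    show "map_point (act h) ` point_class obj mor (m, c, t) \<subseteq> point_class obj mor (m, c, t)"
      using h.equivclp_map_point[of "(m, c, t)"] by (auto simp: h_fix point_class_def)
    show "point_class obj mor (m, c, t) \<subseteq> map_point (act h) ` point_class obj mor (m, c, t)"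
    proof
      fix w assume w: "w \<in> point_class obj mor (m, c, t)"
      obtain n d s where w_eq: "w = (n, d, s)"
        by (cases w)
      have d: "d \<in> nerve_simplices obj mor n"
        using w point_class_subset[OF z(1)] by (auto simp: w_eq topspace_simplex_sum)
      then have "d \<in> extensional {..n}"
        by (auto simp: nerve_simplices_def PiE_iff)
      moreover have "act h (?i (d j)) = d j" if "j \<le> n" for j
        using simplex_vertex[OF d that] image by (simp add: f_inv_into_f)
      ultimately have "w = map_point (act h) (map_point ?i w)"
        by (auto simp: w_eq map_point_def intro!: extensionalityI[of _ "{..n}"])
      moreover have "map_point ?i w \<in> point_class obj mor (m, c, t)"
        using i.equivclp_map_point[of "(m, c, t)" w] w by (simp add: i_fix point_class_def)
      ultimately show "w \<in> map_point (act h) ` point_class obj mor (m, c, t)"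
        by blast
    qed
  qed
qed

text \<open>
  The bijection \<open>\<phi>\<close> induces a map from a compact realization to the Hausdorff space of fixed points. It
  is onto because the nondegenerate representative of a fixed point has fixed vertices, and injective
  because \<open>\<phi>\<close> carries nondegenerate representatives to nondegenerate representatives.
\<close>

theorem realization_fixed_points_homeomorphic:
  fixes r :: "('b \<times> 'b) set"
  assumes sep: "\<And>a b. \<lbrakk>a \<in> topspace obj; b \<in> topspace obj; a \<noteq> b\<rbrakk> \<Longrightarrow>
                   \<exists>f. continuous_map obj euclideanreal f \<and> f a \<noteq> f b"
    and fin: "finite T" and r: "r \<subseteq> T \<times> T"
    and \<phi>: "bij_betw \<phi> T {a \<in> topspace obj. \<forall>h\<in>H. act h a = a}"
    and \<phi>_mor: "\<And>x y. \<lbrakk>x \<in> T; y \<in> T\<rbrakk> \<Longrightarrow> (\<phi> x, \<phi> y) \<in> topspace mor \<longleftrightarrow> (x, y) \<in> r"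
  shows "realization_fixed_points obj mor act H homeomorphic_space
         realization (discrete_topology T) (discrete_topology r)"
proof -
  have \<phi>_obj: "\<phi> x \<in> topspace obj" and \<phi>_fixed: "h \<in> H \<Longrightarrow> act h (\<phi> x) = \<phi> x" if "x \<in> T" for x h
    using \<phi> that by (auto simp: bij_betw_def)
  have \<phi>_inj: "inj_on \<phi> T"
    using \<phi> by (simp add: bij_betw_def)
  let ?T = "discrete_topology T" and ?r = "discrete_topology r"
  interpret T: topological_poset ?T ?r
  proof unfold_locales
    have "refl_on T r"
      using refl_mor \<phi>_obj \<phi>_mor by (auto simp: refl_on_def)
    moreover have "trans r"
    proof (rule transI)
      fix x y z assume xy: "(x, y) \<in> r" "(y, z) \<in> r"
      then have "x \<in> T" "y \<in> T" "z \<in> T"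
        using r by auto
      then show "(x, z) \<in> r"
        using xy \<phi>_mor trans_mor by metis
    qed
    moreover have "antisym r"
    proof (rule antisymI)
      fix x y assume xy: "(x, y) \<in> r" "(y, x) \<in> r"
      then have "x \<in> T" "y \<in> T"
        using r by auto
      then show "x = y"
        using xy \<phi>_mor antisym_mor \<phi>_inj by (metis inj_onD)
    qed
    ultimately show "partial_order_on (topspace ?T) (topspace ?r)"
      using r by (simp add: partial_order_on_def preorder_on_def)
  qed
  interpret F: poset_map ?T ?r obj mor \<phi>
    using \<phi>_obj \<phi>_mor r by unfold_locales auto
  let ?X = "realization ?T ?r" and ?Y = "realization_fixed_points obj mor act H"
  have top_Y: "topspace ?Y = {x \<in> topspace (realization obj mor). \<forall>h\<in>H. realization_map (act h) x = x}"
    by (auto simp: realization_fixed_points_def)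
  have nondeg: "nondegenerate (map_point \<phi> (m, c, t))"
    if "(m, c, t) \<in> topspace (simplex_sum ?T ?r)" "nondegenerate (m, c, t)" for m c t
    using that(2)
  proof (rule nondegenerate_map_point)
    have "c ` {..m} \<subseteq> T"
      using that(1) T.simplex_vertex by (auto simp: topspace_simplex_sum)
    then show "inj_on \<phi> (c ` {..m})"
      using \<phi>_inj by (rule inj_on_subset[rotated])
  qed
  have "continuous_map ?X (realization obj mor) F.induced"
  proof (rule F.continuous_map_induced)
    show "continuous_map ?T obj \<phi>"
      using \<phi>_obj by auto
    show "continuous_map ?r mor (map_prod \<phi> \<phi>)"
      using F.map_mor by auto
  qed
  moreover have image_subset: "F.induced ` topspace ?X \<subseteq> topspace ?Y"
  proof
    fix y assume "y \<in> F.induced ` topspace ?X"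
    then obtain x where x: "x \<in> topspace ?X" "y = F.induced x"
      by auto
    obtain m c t where z: "(m, c, t) \<in> topspace (simplex_sum ?T ?r)" "nondegenerate (m, c, t)"
      "x = point_class ?T ?r (m, c, t)"
      using T.exists_nondegenerate_representative[OF x(1)] .
    have y: "y = point_class obj mor (map_point \<phi> (m, c, t))"
      by (simp add: x(2) z(3) F.induced_point_class)
    have w: "map_point \<phi> (m, c, t) \<in> topspace (simplex_sum obj mor)"
      using z(1) by (rule F.map_point_in_simplex_sum)
    have "c i \<in> T" if "i \<le> m" for i
      using z(1) that T.simplex_vertex by (auto simp: topspace_simplex_sum)
    then have "\<forall>h\<in>H. \<forall>i\<le>m. act h ((\<lambda>i\<in>{..m}. \<phi> (c i)) i) = (\<lambda>i\<in>{..m}. \<phi> (c i)) i"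
      using \<phi>_fixed by simp
    then have "\<forall>h\<in>H. realization_map (act h) y = y"
      using point_class_fixed_iff[of m "\<lambda>i\<in>{..m}. \<phi> (c i)" t] w nondeg[OF z(1,2)]
      by (simp add: y map_point_def)
    moreover have "y \<in> topspace (realization obj mor)"
      using w by (simp add: y topspace_realization)
    ultimately show "y \<in> topspace ?Y"
      by (simp add: top_Y)
  qed
  ultimately have cont: "continuous_map ?X ?Y F.induced"
    unfolding top_Y unfolding realization_fixed_points_def
    by (auto simp: continuous_map_in_subtopology)
  have surj: "topspace ?Y \<subseteq> F.induced ` topspace ?X"
  proof
    fix y assume y: "y \<in> topspace ?Y"
    then have "y \<in> topspace (realization obj mor)"
      by (simp add: top_Y)
    then obtain m c t where z: "(m, c, t) \<in> topspace (simplex_sum obj mor)" "nondegenerate (m, c, t)"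
      "y = point_class obj mor (m, c, t)"
      by (rule exists_nondegenerate_representative)
    have c: "c \<in> nerve_simplices obj mor m" and t: "t \<in> standard_simplex m"
      using z(1) by (auto simp: topspace_simplex_sum)
    have "\<forall>h\<in>H. \<forall>i\<le>m. act h (c i) = c i"
      using y point_class_fixed_iff[OF z(1,2)] by (simp add: top_Y z(3))
    then have c_fixed: "c i \<in> \<phi> ` T" if "i \<le> m" for i
      using \<phi> simplex_vertex[OF c that] that by (auto simp: bij_betw_def)
    define d where "d = (\<lambda>i\<in>{..m}. inv_into T \<phi> (c i))"
    have d: "d i \<in> T" "\<phi> (d i) = c i" if "i \<le> m" for i
      using c_fixed[OF that] that by (auto simp: d_def inv_into_into f_inv_into_f)
    have "(d i, d (Suc i)) \<in> r" if "i < m" for i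
      using c that d[of i] d[of "Suc i"] \<phi>_mor[of "d i" "d (Suc i)"] by (auto simp: nerve_simplices_def)
    then have "d \<in> nerve_simplices ?T ?r m"
      using d by (auto simp: nerve_simplices_def PiE_iff d_def)
    then have "(m, d, t) \<in> topspace (simplex_sum ?T ?r)"
      using t by (simp add: topspace_simplex_sum)
    moreover have "(\<lambda>i\<in>{..m}. \<phi> (d i)) = c"
      using c d by (intro extensionalityI[of _ "{..m}"]) (auto simp: nerve_simplices_def PiE_iff)
    then have "map_point \<phi> (m, d, t) = (m, c, t)"
      by (simp add: map_point_def)
    ultimately show "y \<in> F.induced ` topspace ?X"
      by (metis F.induced_point_class imageI topspace_realization z(3))
  qed
  have inj: "inj_on F.induced (topspace ?X)"
  proof (rule inj_onI)
    fix x y assume x: "x \<in> topspace ?X" and y: "y \<in> topspace ?X" and eq: "F.induced x = F.induced y"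
    obtain m c t where z: "(m, c, t) \<in> topspace (simplex_sum ?T ?r)" "nondegenerate (m, c, t)"
      "x = point_class ?T ?r (m, c, t)"
      using T.exists_nondegenerate_representative[OF x] .
    obtain n d s where w: "(n, d, s) \<in> topspace (simplex_sum ?T ?r)" "nondegenerate (n, d, s)"
      "y = point_class ?T ?r (n, d, s)"
      using T.exists_nondegenerate_representative[OF y] .
    have "weight (map_point \<phi> (m, c, t)) = weight (map_point \<phi> (n, d, s))"
      using eq by (intro weight_equivclp) (simp add: z(3) w(3) F.induced_point_class point_class_eq_iff)
    then have "map_point \<phi> (m, c, t) = map_point \<phi> (n, d, s)"
      by (intro nondegenerate_eqI F.map_point_in_simplex_sum nondeg z(1,2) w(1,2))
    then have mn: "m = n" and ts: "t = s" and "(\<lambda>i\<in>{..m}. \<phi> (c i)) = (\<lambda>i\<in>{..n}. \<phi> (d i))"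
      by (auto simp: map_point_def)
    then have "\<phi> (c i) = \<phi> (d i)" if "i \<le> m" for i
      using that by (metis atMost_iff restrict_apply')
    moreover have c: "c \<in> nerve_simplices ?T ?r m" and d: "d \<in> nerve_simplices ?T ?r n"
      using z(1) w(1) by (auto simp: topspace_simplex_sum)
    ultimately have "c i = d i" if "i \<le> m" for i
      using that \<phi>_inj T.simplex_vertex mn by (metis inj_onD topspace_discrete_topology)
    then have "c = d"
      using c d mn by (intro extensionalityI[of _ "{..m}"]) (auto simp: nerve_simplices_def PiE_iff)
    then show "x = y"
      by (simp add: z(3) w(3) mn ts)
  qed
  have "homeomorphic_map ?X ?Y F.induced"
  proof (rule continuous_imp_homeomorphic_map)
    show "compact_space ?X"
      using fin by (intro T.compact_realization) simp
    show "Hausdorff_space ?Y"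
      unfolding realization_fixed_points_def
      using Hausdorff_realization[OF sep] by (rule Hausdorff_space_subtopology)
    show "F.induced ` topspace ?X = topspace ?Y"
      using image_subset surj by (rule subset_antisym)
  qed (use cont inj in auto)
  then show ?thesis
    using homeomorphic_map_imp_homeomorphic_space homeomorphic_space_sym by blast
qed

end


section \<open>Sums of orbits\<close>

text \<open>
  The set must be stable under the action: an orbit that leaves \<open>D\<close> need not meet \<open>D\<close> in an open set.
\<close>

lemma topspace_orbit_sum_topology:
  assumes stable: "\<And>g x. \<lbrakk>g \<in> topspace G; x \<in> D\<rbrakk> \<Longrightarrow> act g x \<in> D"
  shows "topspace (orbit_sum_topology G act D) = D"
proof -
  have "D \<inter> (\<lambda>g. act g x) ` topspace G = topspace (quotient_topology G (\<lambda>g. act g x))" if "x \<in> D" for x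
    using stable that by auto
  then have "openin (orbit_sum_topology G act D) D"
    unfolding openin_orbit_sum_topology by (metis openin_topspace order_refl)
  moreover have "W \<subseteq> D" if "openin (orbit_sum_topology G act D) W" for W
    using that by (simp add: openin_orbit_sum_topology)
  ultimately show ?thesis
    by (metis openin_subset openin_topspace subset_antisym)
qed

lemma continuous_map_from_orbit_sum_topology:
  assumes stable: "\<And>g x. \<lbrakk>g \<in> topspace G; x \<in> D\<rbrakk> \<Longrightarrow> act g x \<in> D"
    and f: "\<And>x. x \<in> D \<Longrightarrow> continuous_map G Y (\<lambda>g. f (act g x))"
    and range: "f ` D \<subseteq> topspace Y"
  shows "continuous_map (orbit_sum_topology G act D) Y f"
  unfolding continuous_map_def topspace_orbit_sum_topology[of G D act, OF stable, simplified]
proof (intro conjI allI impI)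
  show "f \<in> D \<rightarrow> topspace Y"
    using range by auto
  fix U assume U: "openin Y U"
  show "openin (orbit_sum_topology G act D) {x \<in> D. f x \<in> U}"
    unfolding openin_orbit_sum_topology openin_quotient_topology
  proof (intro conjI ballI)
    fix x assume x: "x \<in> D"
    have "{g \<in> topspace G. act g x \<in> {x \<in> D. f x \<in> U} \<inter> (\<lambda>g. act g x) ` topspace G} =
        {g \<in> topspace G. f (act g x) \<in> U}"
      using stable x by auto
    then show "openin G {g \<in> topspace G. act g x \<in> {x \<in> D. f x \<in> U} \<inter> (\<lambda>g. act g x) ` topspace G}"
      using f[OF x] U by (simp add: continuous_map_def)
  qed auto
qed

section \<open>Unitary matrices\<close>

lemma conj_transpose_mult: "conj_transpose (A ** B) = conj_transpose B ** conj_transpose A"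
  by (simp add: conj_transpose_def matrix_matrix_mult_def vec_eq_iff mult.commute)

lemma conj_transpose_conj_transpose [simp]: "conj_transpose (conj_transpose A) = A"
  by (simp add: conj_transpose_def vec_eq_iff)

lemma unitary_mult: "A \<in> unitary \<Longrightarrow> B \<in> unitary \<Longrightarrow> A ** B \<in> unitary"
proof -
  assume A: "A \<in> unitary" and B: "B \<in> unitary"
  have "A ** B ** (conj_transpose B ** conj_transpose A) = A ** (B ** conj_transpose B) ** conj_transpose A"
    "conj_transpose B ** conj_transpose A ** (A ** B) = conj_transpose B ** (conj_transpose A ** A) ** B"
    by (simp_all add: matrix_mul_assoc)
  then show "A ** B \<in> unitary"
    using A B by (simp add: unitary_def conj_transpose_mult)
qed

lemma unitary_conj_transpose: "A \<in> unitary \<Longrightarrow> conj_transpose A \<in> unitary"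
  by (auto simp: unitary_def)

lemma conj_transpose_mat: "conj_transpose (mat c) = mat (cnj c)"
  by (auto simp: conj_transpose_def mat_def vec_eq_iff)

lemma unitary_mat_1: "mat 1 \<in> unitary"
  by (simp add: unitary_def conj_transpose_mat)

lemma unitary_cancel:
  assumes "A \<in> unitary"
  shows "conj_transpose A *v (A *v x) = x" "A *v (conj_transpose A *v x) = x"
  using assms by (simp_all add: unitary_def matrix_vector_mul_assoc)

lemma inj_unitary: "A \<in> unitary \<Longrightarrow> inj ((*v) A)"
  by (metis injI unitary_cancel(1))

lemma surj_unitary: "A \<in> unitary \<Longrightarrow> surj ((*v) A)"
  by (metis surjI unitary_cancel(2))

lemma hermitian_inner_add_right: "hermitian_inner x (y + z) = hermitian_inner x y + hermitian_inner x z"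
  by (simp add: hermitian_inner_def algebra_simps sum.distrib)

lemma hermitian_inner_add_left: "hermitian_inner (x + y) z = hermitian_inner x z + hermitian_inner y z"
  by (simp add: hermitian_inner_def algebra_simps sum.distrib)

lemma hermitian_inner_scale_right: "hermitian_inner x (c *s y) = c * hermitian_inner x y"
  by (simp add: hermitian_inner_def sum_distrib_left algebra_simps)

lemma hermitian_inner_scale_left: "hermitian_inner (c *s x) y = cnj c * hermitian_inner x y"
  by (simp add: hermitian_inner_def sum_distrib_left algebra_simps)

lemma hermitian_inner_zero [simp]: "hermitian_inner x 0 = 0" "hermitian_inner 0 x = 0"
  by (simp_all add: hermitian_inner_def)

lemma Re_hermitian_inner: "Re (hermitian_inner x y) = x \<bullet> y"
  by (simp add: hermitian_inner_def inner_vec_def inner_complex_def)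

lemma hermitian_inner_self_eq_0: "hermitian_inner x x = 0 \<longleftrightarrow> x = 0"
  by (metis Re_hermitian_inner hermitian_inner_zero(1) inner_eq_zero_iff zero_complex.simps(1))

lemma hermitian_inner_conj_transpose:
  "hermitian_inner (A *v x) y = hermitian_inner x (conj_transpose A *v y)"
proof -
  have "hermitian_inner (A *v x) y = (\<Sum>i\<in>UNIV. \<Sum>j\<in>UNIV. cnj (A $ i $ j) * cnj (x $ j) * y $ i)"
    by (simp add: hermitian_inner_def matrix_vector_mult_def sum_distrib_right)
  also have "\<dots> = (\<Sum>j\<in>UNIV. \<Sum>i\<in>UNIV. cnj (A $ i $ j) * cnj (x $ j) * y $ i)"
    by (rule sum.swap)
  also have "\<dots> = hermitian_inner x (conj_transpose A *v y)"
    by (simp add: hermitian_inner_def matrix_vector_mult_def conj_transpose_def sum_distrib_left mult_ac)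
  finally show ?thesis .
qed

lemma hermitian_inner_unitary: "A \<in> unitary \<Longrightarrow> hermitian_inner (A *v x) (A *v y) = hermitian_inner x y"
  by (simp add: hermitian_inner_conj_transpose unitary_cancel)

lemma norm_unitary: "A \<in> unitary \<Longrightarrow> norm (A *v x) = norm x"
  by (simp add: norm_eq_sqrt_inner Re_hermitian_inner[symmetric] hermitian_inner_unitary)

lemma infdist_unitary_image:
  assumes "A \<in> unitary"
  shows "infdist v ((*v) A ` S) = infdist (conj_transpose A *v v) S"
proof -
  have "dist v (A *v x) = dist (conj_transpose A *v v) x" for x
  proof -
    have "v - A *v x = A *v (conj_transpose A *v v - x)"
      by (simp add: matrix_vector_mult_diff_distrib unitary_cancel[OF assms])
    then show ?thesis
      by (simp add: dist_norm norm_unitary[OF assms])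
  qed
  then show ?thesis
    by (simp add: infdist_def image_image)
qed

lemma continuous_on_conj_transpose_vector: "continuous_on S (\<lambda>A. conj_transpose A *v v)"
  unfolding conj_transpose_def matrix_vector_mult_def by (auto intro!: continuous_intros)

section \<open>The poset of proper decompositions\<close>

lemma proper_decompositionsD:
  assumes "L \<in> proper_decompositions"
  shows "V \<in> L \<Longrightarrow> vec.subspace V" "V \<in> L \<Longrightarrow> V \<noteq> {0}" "V \<in> L \<Longrightarrow> V \<noteq> UNIV"
    "\<lbrakk>V \<in> L; W \<in> L; V \<noteq> W; x \<in> V; y \<in> W\<rbrakk> \<Longrightarrow> hermitian_inner x y = 0"
    "vec.span (\<Union>L) = UNIV"
  using assms by (auto simp: proper_decompositions_def)

lemma decomposition_component_nonzero:
  assumes "L \<in> proper_decompositions" "V \<in> L"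
  obtains x where "x \<in> V" "x \<noteq> 0"
  using proper_decompositionsD(1,2)[OF assms] vec.subspace_0 by blast

lemma decomposition_component_eq:
  assumes "L \<in> proper_decompositions" "V \<in> L" "W \<in> L" "x \<in> V" "x \<in> W" "x \<noteq> 0"
  shows "V = W"
  using proper_decompositionsD(4)[OF assms(1-3), of x x] assms(4-6) by (auto simp: hermitian_inner_self_eq_0)

lemma decomposition_nonempty:
  fixes L :: "'n::finite decomposition"
  assumes "L \<in> proper_decompositions"
  shows "L \<noteq> {}"
proof
  assume "L = {}"
  then have UNIV: "(UNIV :: (complex^'n) set) = {0}"
    using proper_decompositionsD(5)[OF assms] by (metis Union_empty vec.span_empty)
  have "(\<chi> i. (1 :: complex)) = (0 :: complex^'n)"
    using UNIV by blast
  then show False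
    by (simp add: vec_eq_iff)
qed

text \<open>
  Nonzero vectors chosen from the components are pairwise orthogonal.
\<close>

lemma finite_decomposition:
  assumes L: "L \<in> proper_decompositions"
  shows "finite L"
proof -
  have "\<exists>x. x \<in> V \<and> x \<noteq> 0" if "V \<in> L" for V
    using decomposition_component_nonzero[OF L that] by blast
  then obtain f where f: "\<And>V. V \<in> L \<Longrightarrow> f V \<in> V \<and> f V \<noteq> 0"
    by metis
  have "inj_on f L"
    using f decomposition_component_eq[OF L] by (metis inj_onI)
  moreover have "pairwise orthogonal (f ` L)"
  proof (clarsimp simp: pairwise_def)
    fix V W assume VW: "V \<in> L" "W \<in> L" "f V \<noteq> f W"
    then have "hermitian_inner (f V) (f W) = 0"
      using f proper_decompositionsD(4)[OF L] by metis
    then show "orthogonal (f V) (f W)"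
      by (metis Re_hermitian_inner orthogonal_def zero_complex.simps(1))
  qed
  then have "finite (f ` L)"
    using pairwise_orthogonal_imp_finite by blast
  ultimately show ?thesis
    using finite_imageD by blast
qed

lemma closed_complex_subspace:
  fixes V :: "(complex^'n::finite) set"
  assumes "vec.subspace V"
  shows "closed V"
proof (rule closed_subspace)
  have "c *\<^sub>R x = complex_of_real c *s x" for c and x :: "complex^'n"
    by (simp add: vec_eq_iff complex_eq_iff)
  then show "subspace V"
    using assms by (simp add: subspace_def vec.subspace_def)
qed

lemma closed_Union_decomposition:
  assumes "L \<in> proper_decompositions"
  shows "closed (\<Union>L)"
  using finite_decomposition[OF assms] proper_decompositionsD(1)[OF assms] closed_complex_subspace
  by (intro closed_Union) auto

text \<open>
  If \<open>x\<close> and \<open>y\<close> are nonzero vectors of different components, then \<open>x + y\<close> lies in no component: it is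
  orthogonal neither to \<open>x\<close> nor to \<open>y\<close>, so it would have to lie in both components.
\<close>

lemma subspace_in_Union_decomposition:
  assumes L: "L \<in> proper_decompositions" and V: "vec.subspace V" "V \<noteq> {0}" "V \<subseteq> \<Union>L"
  shows "\<exists>W\<in>L. V \<subseteq> W"
proof -
  obtain x where x: "x \<in> V" "x \<noteq> 0"
    using V(1,2) vec.subspace_0 by blast
  obtain W where W: "W \<in> L" "x \<in> W"
    using x V(3) by blast
  have "y \<in> W" if y: "y \<in> V" for y
  proof (rule ccontr)
    assume "y \<notin> W"
    obtain W' where W': "W' \<in> L" "y \<in> W'"
      using y V(3) by blast
    obtain W'' where W'': "W'' \<in> L" "x + y \<in> W''"
      using x y V(1,3) vec.subspace_add by blast
    have neq: "W' \<noteq> W"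
      using W' \<open>y \<notin> W\<close> by blast
    then have xy: "hermitian_inner x y = 0" "hermitian_inner y x = 0"
      using proper_decompositionsD(4)[OF L] W W' by blast+
    have "W'' \<noteq> W \<or> W'' \<noteq> W'"
      using neq by blast
    then show False
    proof
      assume "W'' \<noteq> W"
      then have "hermitian_inner (x + y) x = 0"
        using proper_decompositionsD(4)[OF L] W W'' by blast
      then show False
        using xy x(2) by (simp add: hermitian_inner_add_left hermitian_inner_self_eq_0)
    next
      assume "W'' \<noteq> W'"
      then have "hermitian_inner (x + y) y = 0"
        using proper_decompositionsD(4)[OF L] W' W'' by blast
      then have "y = 0"
        using xy by (simp add: hermitian_inner_add_left hermitian_inner_self_eq_0)
      then show False
        using \<open>y \<notin> W\<close> vec.subspace_0 proper_decompositionsD(1)[OF L W(1)] by blast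
    qed
  qed
  then show ?thesis
    using W(1) by blast
qed

lemma refines_antisym:
  fixes L M :: "'n::finite decomposition"
  assumes L: "L \<in> proper_decompositions" and M: "M \<in> proper_decompositions"
    and "refines L M" "refines M L"
  shows "L = M"
proof -
  have "L \<subseteq> M" if L: "L \<in> proper_decompositions" and M: "M \<in> proper_decompositions"
    and refines: "refines L M" "refines M L" for L M :: "'n decomposition"
  proof
    fix V assume V: "V \<in> L"
    then obtain W where W: "W \<in> M" "V \<subseteq> W"
      using refines(1) by (auto simp: refines_def)
    then obtain V' where V': "V' \<in> L" "W \<subseteq> V'"
      using refines(2) by (auto simp: refines_def)
    obtain x where "x \<in> V" "x \<noteq> 0"
      using decomposition_component_nonzero[OF L V] .
    then have "V = V'"
      using decomposition_component_eq[OF L V V'(1)] W V' by blast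
    then have "V = W"
      using W V' by blast
    then show "V \<in> M"
      using W by simp
  qed
  then show ?thesis
    using assms by blast
qed

text \<open>
  The components are the maximal subspaces contained in the union.
\<close>

lemma Union_decomposition_inj:
  assumes L: "L \<in> proper_decompositions" and M: "M \<in> proper_decompositions" and "\<Union>L = \<Union>M"
  shows "L = M"
proof (rule refines_antisym[OF L M])
  show "refines L M" "refines M L"
    unfolding refines_def
    using subspace_in_Union_decomposition[OF M] subspace_in_Union_decomposition[OF L]
      proper_decompositionsD(1,2)[OF L] proper_decompositionsD(1,2)[OF M] \<open>\<Union>L = \<Union>M\<close>
    by (metis Union_upper)+
qed

lemma Union_decomposition_act: "\<Union>(decomposition_act A L) = (*v) A ` \<Union>L"
  by (auto simp: decomposition_act_def)

lemma decomposition_act_mult: "decomposition_act (A ** B) L = decomposition_act A (decomposition_act B L)"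
  by (simp add: decomposition_act_def image_image matrix_vector_mul_assoc)

lemma decomposition_act_mat_1 [simp]: "decomposition_act (mat 1) L = L"
  by (simp add: decomposition_act_def)

lemma subspace_matrix_image:
  "vec.subspace V \<Longrightarrow> vec.subspace ((*v) A ` V)"
  by (rule vec.linear_subspace_image[OF matrix_vector_mul_linear_gen])

lemma decomposition_act_proper:
  assumes A: "A \<in> unitary" and L: "L \<in> proper_decompositions"
  shows "decomposition_act A L \<in> proper_decompositions"
proof -
  have "vec.subspace ((*v) A ` V)" "(*v) A ` V \<noteq> {0}" "(*v) A ` V \<noteq> UNIV" if V: "V \<in> L" for V
  proof -
    show "vec.subspace ((*v) A ` V)"
      using proper_decompositionsD(1)[OF L V] by (rule subspace_matrix_image)
    show "(*v) A ` V \<noteq> {0}"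
    proof -
      obtain x where "x \<in> V" "x \<noteq> 0"
        using decomposition_component_nonzero[OF L V] .
      then have "A *v x \<in> (*v) A ` V" "A *v x \<noteq> 0"
        using unitary_cancel(1)[OF A, of x] by auto
      then show ?thesis
        by blast
    qed
    show "(*v) A ` V \<noteq> UNIV"
    proof
      assume "(*v) A ` V = UNIV"
      then have "(*v) A ` V = (*v) A ` UNIV"
        using surj_unitary[OF A] by simp
      then show False
        using inj_image_eq_iff[OF inj_unitary[OF A]] proper_decompositionsD(3)[OF L V] by blast
    qed
  qed
  moreover have "hermitian_inner x y = 0"
    if "V \<in> L" "W \<in> L" "(*v) A ` V \<noteq> (*v) A ` W" "x \<in> (*v) A ` V" "y \<in> (*v) A ` W" for V W x y
  proof -
    have "V \<noteq> W"
      using that(3) by blast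
    then show ?thesis
      using that proper_decompositionsD(4)[OF L that(1,2)] by (auto simp: hermitian_inner_unitary[OF A])
  qed
  moreover have "vec.span (\<Union>(decomposition_act A L)) = UNIV"
    using surj_unitary[OF A] proper_decompositionsD(5)[OF L]
    by (simp only: Union_decomposition_act vec.linear_span_image[OF matrix_vector_mul_linear_gen])
  ultimately show ?thesis
    by (auto simp: proper_decompositions_def decomposition_act_def)
qed

lemma refines_decomposition_act_iff:
  assumes "A \<in> unitary"
  shows "refines (decomposition_act A L) (decomposition_act A M) \<longleftrightarrow> refines L M"
  by (simp add: refines_def decomposition_act_def inj_image_subset_iff[OF inj_unitary[OF assms]])

lemma topspace_decomposition_obj [simp]:
  "topspace (decomposition_obj :: 'n::finite decomposition topology) = proper_decompositions"
  unfolding decomposition_obj_def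
  by (rule topspace_orbit_sum_topology) (simp add: decomposition_act_proper)

lemma topspace_decomposition_mor [simp]:
  "topspace (decomposition_mor :: ('n::finite decomposition \<times> 'n decomposition) topology) =
     {(L, M). L \<in> proper_decompositions \<and> M \<in> proper_decompositions \<and> refines L M}"
  unfolding decomposition_mor_def
  by (rule topspace_orbit_sum_topology) (auto simp: decomposition_act_proper refines_decomposition_act_iff)

text \<open>
  By unitarity the distance from \<open>v\<close> to \<open>A(\<Union>L)\<close> is that from \<open>A\<^sup>*v\<close> to \<open>\<Union>L\<close>, which is continuous
  in \<open>A\<close>; so the function is continuous on every orbit.
\<close>

lemma continuous_map_infdist_Union:
  "continuous_map (decomposition_obj :: 'n::finite decomposition topology) euclideanreal (\<lambda>L. infdist v (\<Union>L))"
  unfolding decomposition_obj_def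
proof (rule continuous_map_from_orbit_sum_topology)
  fix L :: "'n decomposition"
  have "continuous_on unitary (\<lambda>A. infdist (conj_transpose A *v v) (\<Union>L))"
    by (intro continuous_on_infdist continuous_on_conj_transpose_vector)
  then have "continuous_on unitary (\<lambda>A. infdist v (\<Union>(decomposition_act A L)))"
    by (rule continuous_on_eq) (simp add: Union_decomposition_act infdist_unitary_image)
  then show "continuous_map (top_of_set unitary) euclideanreal (\<lambda>A. infdist v (\<Union>(decomposition_act A L)))"
    by simp
qed (auto simp: decomposition_act_proper)

text \<open>
  A vector in only one of the two closed sets \<open>\<Union>L\<close> and \<open>\<Union>M\<close> has distance 0 from that one only.
\<close>

lemma decompositions_separated_by_real_functions:
  fixes L M :: "'n::finite decomposition"
  assumes L: "L \<in> proper_decompositions" and M: "M \<in> proper_decompositions" and "L \<noteq> M"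
  shows "\<exists>f. continuous_map decomposition_obj euclideanreal f \<and> f L \<noteq> f M"
proof -
  have "\<Union>L \<noteq> \<Union>M"
    using Union_decomposition_inj[OF L M] \<open>L \<noteq> M\<close> by blast
  then obtain v where "v \<in> \<Union>L \<longleftrightarrow> v \<notin> \<Union>M"
    by blast
  moreover have "\<Union>L \<noteq> {}" "\<Union>M \<noteq> {}"
    using L M decomposition_nonempty decomposition_component_nonzero by (metis Union_iff empty_iff ex_in_conv)+
  ultimately have "infdist v (\<Union>L) \<noteq> infdist v (\<Union>M)"
    using in_closed_iff_infdist_zero[OF closed_Union_decomposition[OF L]]
      in_closed_iff_infdist_zero[OF closed_Union_decomposition[OF M]] by metis
  then show ?thesis
    using continuous_map_infdist_Union by blast
qed

lemma poset_action_decompositions: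
  assumes H: "H \<subseteq> unitary"
  shows "poset_action (decomposition_obj :: 'n::finite decomposition topology) decomposition_mor decomposition_act H"
proof unfold_locales
  let ?D = "proper_decompositions :: 'n decomposition set"
  have "partial_order_on ?D {(L, M). L \<in> ?D \<and> M \<in> ?D \<and> refines L M}"
    unfolding partial_order_on_def preorder_on_def
  proof (intro conjI)
    show "refl_on ?D {(L, M). L \<in> ?D \<and> M \<in> ?D \<and> refines L M}"
      by (auto simp: refl_on_def refines_def)
    show "trans {(L, M). L \<in> ?D \<and> M \<in> ?D \<and> refines L M}"
      by (auto simp: trans_def refines_def) (meson subset_trans)
    show "antisym {(L, M). L \<in> ?D \<and> M \<in> ?D \<and> refines L M}"
      using refines_antisym by (auto simp: antisym_def)
  qed auto
  then show "partial_order_on (topspace (decomposition_obj :: 'n decomposition topology)) (topspace decomposition_mor)"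
    by simp
next
  fix A :: "'n cmatrix" assume "A \<in> H"
  then have A: "A \<in> unitary"
    using H by blast
  then have "decomposition_act (conj_transpose A) (decomposition_act A L) = L"
    "decomposition_act A (decomposition_act (conj_transpose A) L) = L" for L
    by (simp_all add: decomposition_act_mult[symmetric] unitary_def)
  then show "bij_betw (decomposition_act A) (topspace decomposition_obj) (topspace decomposition_obj)"
    using decomposition_act_proper[OF A] decomposition_act_proper[OF unitary_conj_transpose[OF A]]
    by (intro bij_betwI[where g = "decomposition_act (conj_transpose A)"]) auto
  fix L M :: "'n decomposition"
  assume "L \<in> topspace decomposition_obj" "M \<in> topspace decomposition_obj"
  then show "(decomposition_act A L, decomposition_act A M) \<in> topspace decomposition_mor \<longleftrightarrow>
      (L, M) \<in> topspace decomposition_mor"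
    using A by (simp add: decomposition_act_proper refines_decomposition_act_iff)
qed


section \<open>Characters of the prime field\<close>

lemma to_int_mod_ring_of_nat:
  "to_int_mod_ring (of_nat n :: 'p::prime_card mod_ring) = int (n mod CARD('p))"
  unfolding of_nat_of_int_mod_ring by transfer (simp add: zmod_int)

lemma zeta_power_of_nat:
  "zeta_power (of_nat n :: 'p::prime_card mod_ring) = exp (2 * pi * \<i> * of_nat n / of_nat CARD('p))"
proof -
  let ?p = "CARD('p)"
  have power: "exp (2 * pi * \<i> / of_nat ?p) ^ m = exp (2 * pi * \<i> * of_nat m / of_nat ?p)" for m
    by (simp add: exp_of_nat_mult[symmetric] mult_ac)
  have "zeta_power (of_nat n :: 'p mod_ring) = exp (2 * pi * \<i> * of_nat (n mod ?p) / of_nat ?p)"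
    by (simp only: zeta_power_def to_int_mod_ring_of_nat nat_int power)
  also have "\<dots> = exp (2 * pi * \<i> * of_nat n / of_nat ?p)"
    using complex_root_unity_eq[of ?p "n mod ?p" n] by (simp add: Suc_leI)
  finally show ?thesis .
qed

lemma zeta_power_add:
  fixes c d :: "'p::prime_card mod_ring"
  shows "zeta_power (c + d) = zeta_power c * zeta_power d"
proof -
  obtain i j where "c = of_nat i" "d = of_nat j"
    using surj_of_nat_mod_ring by metis
  then have "zeta_power (c + d) = zeta_power (of_nat (i + j) :: 'p mod_ring)"
    by simp
  then show ?thesis
    unfolding \<open>c = of_nat i\<close> \<open>d = of_nat j\<close> zeta_power_of_nat
    by (simp add: exp_add[symmetric] ring_distribs add_divide_distrib)
qed

lemma zeta_power_0 [simp]: "zeta_power 0 = 1"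
  using zeta_power_of_nat[of 0] by simp

lemma norm_zeta_power [simp]: "cmod (zeta_power c) = 1"
proof -
  obtain i where "c = of_nat i"
    using surj_of_nat_mod_ring by metis
  then show ?thesis
    by (simp add: zeta_power_of_nat norm_exp_eq_Re)
qed

lemma zeta_power_nonzero [simp]: "zeta_power c \<noteq> 0"
  using norm_zeta_power[of c] by force

lemma zeta_power_minus_mult [simp]: "zeta_power (- c) * zeta_power c = 1" "zeta_power c * zeta_power (- c) = 1"
  by (simp_all add: zeta_power_add[symmetric])

lemma zeta_power_eq_1_iff: "zeta_power (c :: 'p::prime_card mod_ring) = 1 \<longleftrightarrow> c = 0"
proof -
  obtain i where c: "c = of_nat i" "i < CARD('p)"
    using surj_of_nat_mod_ring by metis
  have "zeta_power c = 1 \<longleftrightarrow> CARD('p) dvd i"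
    unfolding c(1) zeta_power_of_nat using complex_root_unity_eq_1[of "CARD('p)" i] by (simp add: Suc_leI)
  then show ?thesis
    using c of_nat_0_mod_ring_dvd[of i, where 'a = 'p] by (auto dest: nat_dvd_not_less)
qed

lemma zeta_power_inj: "zeta_power c = zeta_power d \<longleftrightarrow> c = d"
proof
  assume "zeta_power c = zeta_power d"
  then have "zeta_power (c - d) * zeta_power d = 1 * zeta_power d"
    by (simp add: zeta_power_add[symmetric])
  then have "zeta_power (c - d) = 1"
    using zeta_power_nonzero mult_right_cancel by blast
  then show "c = d"
    by (simp add: zeta_power_eq_1_iff)
qed simp

lemma cnj_zeta_power: "cnj (zeta_power c) = zeta_power (- c)"
proof -
  have "cnj (zeta_power c) * zeta_power c = zeta_power (- c) * zeta_power c"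
    using complex_norm_square[of "zeta_power c"] by (simp add: mult.commute)
  then show ?thesis
    using zeta_power_nonzero mult_right_cancel by blast
qed

section \<open>Shift and clock operators\<close>

definition dot :: "('p::prime_card, 'k::finite) Fpk \<Rightarrow> ('p, 'k) Fpk \<Rightarrow> 'p mod_ring" where
  "dot b x = (\<Sum>i\<in>UNIV. b $ i * x $ i)"

lemma dot_add_right: "dot b (x + y) = dot b x + dot b y"
  by (simp add: dot_def algebra_simps sum.distrib)

lemma dot_add_left: "dot (a + b) x = dot a x + dot b x"
  by (simp add: dot_def algebra_simps sum.distrib)

lemma dot_minus_right: "dot b (- x) = - dot b x"
  by (simp add: dot_def sum_negf)

lemma dot_minus_left: "dot (- b) x = - dot b x"
  by (simp add: dot_def sum_negf)

lemma dot_diff_right: "dot b (x - y) = dot b x - dot b y"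
  using dot_add_right[of b x "- y"] by (simp add: dot_minus_right)

lemma dot_zero [simp]: "dot 0 x = 0" "dot b 0 = 0"
  by (simp_all add: dot_def)

lemma dot_axis: "dot b (axis i 1) = b $ i"
proof -
  have "dot b (axis i 1) = (\<Sum>j\<in>UNIV. if j = i then b $ j else 0)"
    unfolding dot_def by (intro sum.cong) (auto simp: axis_def)
  then show ?thesis
    by simp
qed

text \<open>
  Orthogonality of characters.
\<close>

lemma sum_zeta_power_dot:
  fixes u :: "('p::prime_card, 'k::finite) Fpk"
  shows "(\<Sum>b\<in>UNIV. zeta_power (dot b u)) = (if u = 0 then of_nat CARD(('p, 'k) Fpk) else 0)"
proof (cases "u = 0")
  case False
  then obtain i where "u $ i \<noteq> 0"
    by (auto simp: vec_eq_iff)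
  moreover have "dot (axis i 1) u = u $ i"
    using dot_axis[of u i] by (simp add: dot_def mult.commute)
  ultimately obtain a where a: "zeta_power (dot a u) \<noteq> 1"
    by (metis zeta_power_eq_1_iff)
  have "(\<Sum>b\<in>UNIV. zeta_power (dot b u)) = (\<Sum>b\<in>UNIV. zeta_power (dot (a + b) u))"
    by (rule sum.reindex_bij_witness[of _ "\<lambda>b. a + b" "\<lambda>b. b - a"]) auto
  also have "\<dots> = zeta_power (dot a u) * (\<Sum>b\<in>UNIV. zeta_power (dot b u))"
    by (simp add: dot_add_left zeta_power_add sum_distrib_left)
  finally show ?thesis
    using a False by simp
qed simp

definition shift_part :: "('p::prime_card, 'k::finite + 'k) Fpk \<Rightarrow> ('p, 'k) Fpk" where
  "shift_part v = (\<chi> i. v $ Inl i)"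

definition clock_part :: "('p::prime_card, 'k::finite + 'k) Fpk \<Rightarrow> ('p, 'k) Fpk" where
  "clock_part v = (\<chi> i. v $ Inr i)"

definition combine :: "('p::prime_card, 'k::finite) Fpk \<Rightarrow> ('p, 'k) Fpk \<Rightarrow> ('p, 'k + 'k) Fpk" where
  "combine a b = (\<chi> s. case s of Inl i \<Rightarrow> a $ i | Inr i \<Rightarrow> b $ i)"

lemma parts_combine [simp]: "shift_part (combine a b) = a" "clock_part (combine a b) = b"
  by (simp_all add: shift_part_def clock_part_def combine_def vec_eq_iff)

lemma parts_eqI: "shift_part v = shift_part w \<Longrightarrow> clock_part v = clock_part w \<Longrightarrow> v = w"
  unfolding shift_part_def clock_part_def vec_eq_iff vec_lambda_beta by (metis sumE)

lemma parts_add [simp]: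
  "shift_part (v + w) = shift_part v + shift_part w" "clock_part (v + w) = clock_part v + clock_part w"
  by (simp_all add: shift_part_def clock_part_def vec_eq_iff)

lemma parts_minus [simp]: "shift_part (- v) = - shift_part v" "clock_part (- v) = - clock_part v"
  by (simp_all add: shift_part_def clock_part_def vec_eq_iff)

lemma parts_zero [simp]: "shift_part 0 = 0" "clock_part 0 = 0"
  by (simp_all add: shift_part_def clock_part_def vec_eq_iff)

text \<open>
  For \<open>v = (a, b)\<close> this is \<open>z X\<^sub>a Z\<^sub>b\<close>. With \<open>|z| = 1\<close> these operators are the elements of \<open>\<Gamma>\<close>, see
  \<open>Gamma_eq_weyl\<close>.
\<close>

definition weyl :: "complex \<Rightarrow> ('p::prime_card, 'k::finite + 'k) Fpk \<Rightarrow> ('p, 'k) Fpk cmatrix" where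
  "weyl z v = mat z ** shift_matrix (shift_part v) ** clock_matrix (clock_part v)"

lemma mat_mult_vector: "mat z *v x = z *s (x :: complex^'n::finite)"
proof -
  have "(\<Sum>j\<in>UNIV. (if i = j then z else 0) * x $ j) = z * x $ i" for i
  proof -
    have "(\<Sum>j\<in>UNIV. (if i = j then z else 0) * x $ j) = (\<Sum>j\<in>UNIV. if i = j then z * x $ j else 0)"
      by (intro sum.cong) auto
    then show ?thesis
      by simp
  qed
  then show ?thesis
    by (simp add: vec_eq_iff matrix_vector_mult_def mat_def)
qed

lemma shift_matrix_mult_vector: "shift_matrix a *v x = (\<chi> y. x $ (y - a))"
proof -
  have "(\<Sum>u\<in>UNIV. (if y = u + a then 1 else 0) * x $ u) = x $ (y - a)" for y
  proof -
    have "(\<Sum>u\<in>UNIV. (if y = u + a then 1 else 0) * x $ u) = (\<Sum>u\<in>UNIV. if u = y - a then x $ u else 0)"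
      by (intro sum.cong) auto
    then show ?thesis
      by simp
  qed
  then show ?thesis
    by (simp add: vec_eq_iff matrix_vector_mult_def shift_matrix_def)
qed

lemma clock_matrix_mult_vector: "clock_matrix b *v x = (\<chi> y. zeta_power (dot b y) * x $ y)"
proof -
  have "(\<Sum>u\<in>UNIV. clock_matrix b $ y $ u * x $ u) = zeta_power (dot b y) * x $ y" for y
  proof -
    have "(\<Sum>u\<in>UNIV. clock_matrix b $ y $ u * x $ u) =
        (\<Sum>u\<in>UNIV. if y = u then zeta_power (dot b u) * x $ u else 0)"
      by (intro sum.cong) (auto simp: clock_matrix_def dot_def)
    then show ?thesis
      by simp
  qed
  then show ?thesis
    by (simp add: matrix_vector_mult_def)
qed

lemma weyl_mult_vector:
  "(weyl z v *v x) $ y = z * zeta_power (dot (clock_part v) (y - shift_part v)) * x $ (y - shift_part v)"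
  by (simp add: weyl_def matrix_vector_mul_assoc[symmetric] mat_mult_vector shift_matrix_mult_vector
      clock_matrix_mult_vector)

text \<open>
  Moving \<open>Z\<^sub>b\<close> past \<open>X\<^sub>a\<^sub>'\<close> costs the phase \<open>\<zeta>\<^bsup>b\<cdot>a'\<^esup>\<close>.
\<close>

lemma weyl_mult:
  "weyl z v ** weyl z' v' = weyl (z * z' * zeta_power (dot (clock_part v) (shift_part v'))) (v + v')"
proof -
  have "(weyl z v ** weyl z' v') *v x = weyl (z * z' * zeta_power (dot (clock_part v) (shift_part v'))) (v + v') *v x" for x
  proof (subst vec_eq_iff, intro allI)
    fix y
    have "y - (shift_part v + shift_part v') = y - shift_part v - shift_part v'"
      by simp
    moreover have "dot (clock_part v) (y - shift_part v) =
        dot (clock_part v) (shift_part v') + dot (clock_part v) (y - shift_part v - shift_part v')"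
      by (simp add: dot_add_right[symmetric])
    ultimately show "((weyl z v ** weyl z' v') *v x) $ y =
        (weyl (z * z' * zeta_power (dot (clock_part v) (shift_part v'))) (v + v') *v x) $ y"
      by (simp add: matrix_vector_mul_assoc[symmetric] weyl_mult_vector dot_add_left zeta_power_add
          diff_diff_eq mult_ac)
  qed
  then show ?thesis
    by (simp add: matrix_eq)
qed

lemma mat_eq_weyl: "mat z = weyl z 0"
  by (simp add: matrix_eq vec_eq_iff weyl_mult_vector mat_mult_vector)

lemma shift_matrix_eq_weyl: "shift_matrix a = weyl 1 (combine a 0)"
  by (simp add: matrix_eq vec_eq_iff weyl_mult_vector shift_matrix_mult_vector)

lemma clock_matrix_eq_weyl: "clock_matrix b = weyl 1 (combine 0 b)"
  by (simp add: matrix_eq vec_eq_iff weyl_mult_vector clock_matrix_mult_vector)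

lemma mat_mult_weyl: "mat c ** weyl z v = weyl (c * z) v"
  by (simp add: mat_eq_weyl weyl_mult)

text \<open>
  The image of \<open>e\<^sub>0\<close> determines the shift and the phase; the images of the other basis vectors then
  determine the character \<open>x \<mapsto> \<zeta>\<^bsup>b\<cdot>x\<^esup>\<close> and with it \<open>b\<close>.
\<close>

lemma weyl_eqD:
  fixes v w :: "('p::prime_card, 'k::finite + 'k) Fpk"
  assumes eq: "weyl z v = weyl z' w" and z: "cmod z = 1"
  shows "z = z'" "v = w"
proof -
  have nonzero: "z \<noteq> 0"
    using z by auto
  have entry: "(weyl c u *v axis x 1) $ (x + shift_part u) = c * zeta_power (dot (clock_part u) x)"
    and off: "y \<noteq> x + shift_part u \<Longrightarrow> (weyl c u *v axis x 1) $ y = 0" for c x y and u :: "('p, 'k + 'k) Fpk"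
    by (auto simp: weyl_mult_vector axis_def)
  have shift: "shift_part v = shift_part w"
    using entry[of z v 0] off[of "shift_part v" 0 w z'] nonzero by (auto simp: eq)
  show z_eq: "z = z'"
    using entry[of z v 0] entry[of z' w 0] by (simp add: eq shift)
  have "zeta_power (dot (clock_part v) x) = zeta_power (dot (clock_part w) x)" for x
    using entry[of z v x] entry[of z' w x] nonzero eq shift z_eq by (metis mult_left_cancel)
  then have "clock_part v $ i = clock_part w $ i" for i
    using dot_axis[of "clock_part v" i] dot_axis[of "clock_part w" i] by (simp add: zeta_power_inj)
  then show "v = w"
    using shift by (intro parts_eqI) (auto simp: vec_eq_iff)
qed

lemma weyl_entry:
  "weyl z v $ y $ x = (if y = x + shift_part v then z * zeta_power (dot (clock_part v) x) else 0)"
proof -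
  have "weyl z v $ y $ x = (weyl z v *v axis x 1) $ y"
  proof -
    have "(weyl z v *v axis x 1) $ y = (\<Sum>j\<in>UNIV. if j = x then weyl z v $ y $ j else 0)"
      unfolding matrix_vector_mult_def vec_lambda_beta by (intro sum.cong) (auto simp: axis_def)
    then show ?thesis
      by simp
  qed
  also have "\<dots> = (if y = x + shift_part v then z * zeta_power (dot (clock_part v) x) else 0)"
    by (auto simp: weyl_mult_vector axis_def)
  finally show ?thesis .
qed

lemma conj_transpose_weyl:
  "conj_transpose (weyl z v) = weyl (cnj z * zeta_power (dot (clock_part v) (shift_part v))) (- v)"
proof -
  let ?a = "shift_part v" and ?b = "clock_part v"
  have phase: "zeta_power (dot ?b ?a) * zeta_power (- dot ?b (y + ?a)) = zeta_power (- dot ?b y)" for y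
    by (simp add: zeta_power_add[symmetric] dot_add_right)
  have "conj_transpose (weyl z v) $ y $ x = weyl (cnj z * zeta_power (dot ?b ?a)) (- v) $ y $ x" for x y
  proof (cases "x = y + ?a")
    case True
    then show ?thesis
      by (simp add: conj_transpose_def weyl_entry cnj_zeta_power dot_minus_left mult.assoc phase)
  next
    case False
    then have "y \<noteq> x + - ?a"
      by auto
    with False show ?thesis
      by (simp add: conj_transpose_def weyl_entry)
  qed
  then show ?thesis
    by (simp add: vec_eq_iff)
qed

lemma weyl_unitary:
  assumes "cmod z = 1"
  shows "weyl z v \<in> unitary"
proof -
  have "cnj z * z = 1" "z * cnj z = 1"
    using complex_norm_square[of z] assms by (simp_all add: mult.commute)
  then show ?thesis
    by (simp add: unitary_def conj_transpose_weyl weyl_mult mat_eq_weyl dot_minus_left dot_minus_right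
        mult_ac zeta_power_add[symmetric])
qed

section \<open>The group \<open>\<Gamma>\<close>\<close>

abbreviation \<Gamma> :: "('p::prime_card, 'k::finite) Fpk cmatrix set" where
  "\<Gamma> \<equiv> Gamma_group TYPE('p) TYPE('k)"

lemma group_unitary: "group (unitary_group :: 'n::finite cmatrix monoid)"
proof (rule groupI)
  fix A :: "'n cmatrix"
  assume "A \<in> carrier unitary_group"
  then show "\<exists>B\<in>carrier unitary_group. B \<otimes>\<^bsub>unitary_group\<^esub> A = \<one>\<^bsub>unitary_group\<^esub>"
    by (intro bexI[of _ "conj_transpose A"]) (auto simp: unitary_group_def unitary_def)
qed (auto simp: unitary_group_def unitary_mult unitary_mat_1 matrix_mul_assoc)

lemma inv_unitary_group:
  assumes "A \<in> unitary"
  shows "inv\<^bsub>unitary_group\<^esub> A = conj_transpose A"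
proof (rule group.inv_equality[OF group_unitary])
  show "conj_transpose A \<otimes>\<^bsub>unitary_group\<^esub> A = \<one>\<^bsub>unitary_group\<^esub>"
    using assms by (simp add: unitary_group_def unitary_def)
qed (use assms unitary_conj_transpose in \<open>simp_all add: unitary_group_def\<close>)

lemma Gamma_eq_weyl:
  "(\<Gamma> :: ('p::prime_card, 'k::finite) Fpk cmatrix set) = {weyl z v |z v. cmod z = 1}"
proof
  let ?gens = "{mat z |z. cmod z = 1} \<union> range shift_matrix \<union> range clock_matrix :: ('p, 'k) Fpk cmatrix set"
  let ?W = "{weyl z v |z v. cmod z = 1} :: ('p, 'k) Fpk cmatrix set"
  have gens: "?gens \<subseteq> ?W"
    by (auto simp: mat_eq_weyl shift_matrix_eq_weyl clock_matrix_eq_weyl intro: norm_one)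
  have conj: "conj_transpose A \<in> ?W" if "A \<in> ?W" for A
    using that by (force simp: conj_transpose_weyl norm_mult)
  have mult: "A ** B \<in> ?W" if "A \<in> ?W" "B \<in> ?W" for A B
    using that by (force simp: weyl_mult norm_mult)
  have unitary: "A \<in> unitary" if "A \<in> ?W" for A
    using that weyl_unitary by blast
  show "\<Gamma> \<subseteq> ?W"
  proof
    fix A :: "('p, 'k) Fpk cmatrix"
    assume "A \<in> \<Gamma>"
    then show "A \<in> ?W"
      unfolding Gamma_group_def
    proof (induction rule: generate.induct)
      case one
      have "mat 1 \<in> ?W"
        by (intro CollectI exI[of _ 1] exI[of _ 0]) (simp add: mat_eq_weyl)
      then show ?case
        by (simp only: unitary_group_def monoid.simps)
    next
      case (incl A)
      then show ?case
        using gens by blast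
    next
      case (inv A)
      then have "A \<in> ?W"
        using gens by blast
      then show ?case
        by (simp only: inv_unitary_group unitary conj)
    next
      case (eng A B)
      then show ?case
        using mult by (simp add: unitary_group_def)
    qed
  qed
  show "?W \<subseteq> \<Gamma>"
  proof
    fix A assume "A \<in> ?W"
    then obtain z v where A: "A = mat z ** shift_matrix (shift_part v) ** clock_matrix (clock_part v)" "cmod z = 1"
      by (auto simp: weyl_def)
    have "mat z \<in> generate unitary_group ?gens" "shift_matrix (shift_part v) \<in> generate unitary_group ?gens"
      "clock_matrix (clock_part v) \<in> generate unitary_group ?gens"
      using A(2) by (auto intro: generate.incl)
    then have "mat z \<otimes>\<^bsub>unitary_group\<^esub> shift_matrix (shift_part v) \<otimes>\<^bsub>unitary_group\<^esub> clock_matrix (clock_part v)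
        \<in> generate unitary_group ?gens"
      by (intro generate.eng)
    then show "A \<in> \<Gamma>"
      by (simp add: A(1) Gamma_group_def unitary_group_def)
  qed
qed

lemma weyl_in_Gamma: "cmod z = 1 \<Longrightarrow> weyl z v \<in> \<Gamma>"
  by (auto simp: Gamma_eq_weyl)

lemma Gamma_proj_weyl [simp]:
  assumes "cmod z = 1"
  shows "Gamma_proj (weyl z v) = v"
  unfolding Gamma_proj_def shift_part_def[symmetric] clock_part_def[symmetric] weyl_def[symmetric]
  using assms by (intro the_equality) (auto dest: weyl_eqD)

lemma GammaE:
  assumes "g \<in> \<Gamma>"
  obtains z where "cmod z = 1" "g = weyl z (Gamma_proj g)"
  using assms by (auto simp: Gamma_eq_weyl)

lemma Gamma_unitary: "g \<in> \<Gamma> \<Longrightarrow> g \<in> unitary"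
  by (auto simp: Gamma_eq_weyl weyl_unitary)

lemma mat_1_in_Gamma: "mat 1 \<in> \<Gamma>"
  by (simp add: mat_eq_weyl weyl_in_Gamma)

lemma Gamma_mult: 
  assumes "g \<in> \<Gamma>" "h \<in> \<Gamma>"
  shows "g ** h \<in> \<Gamma>" "Gamma_proj (g ** h) = Gamma_proj g + Gamma_proj h"
proof -
  obtain z z' where "cmod z = 1" "cmod z' = 1"
    and gh: "g = weyl z (Gamma_proj g)" "h = weyl z' (Gamma_proj h)"
    using assms by (metis GammaE)
  then have norm: "cmod (z * z' * zeta_power (dot (clock_part (Gamma_proj g)) (shift_part (Gamma_proj h)))) = 1"
    by (simp add: norm_mult)
  have gh: "g ** h = weyl (z * z' * zeta_power (dot (clock_part (Gamma_proj g)) (shift_part (Gamma_proj h))))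
      (Gamma_proj g + Gamma_proj h)"
    by (subst gh(1), subst gh(2)) (rule weyl_mult)
  show "g ** h \<in> \<Gamma>" "Gamma_proj (g ** h) = Gamma_proj g + Gamma_proj h"
    unfolding gh using norm by (simp_all add: weyl_in_Gamma)
qed

lemma Gamma_conj_transpose:
  assumes "g \<in> \<Gamma>"
  shows "conj_transpose g \<in> \<Gamma>" "Gamma_proj (conj_transpose g) = - Gamma_proj g"
proof -
  obtain z where z: "cmod z = 1" "g = weyl z (Gamma_proj g)"
    using assms by (rule GammaE)
  let ?v = "Gamma_proj g"
  have norm: "cmod (cnj z * zeta_power (dot (clock_part ?v) (shift_part ?v))) = 1"
    using z(1) by (simp add: norm_mult)
  have "conj_transpose g = weyl (cnj z * zeta_power (dot (clock_part ?v) (shift_part ?v))) (- ?v)"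
    by (subst z(2)) (rule conj_transpose_weyl)
  then show "conj_transpose g \<in> \<Gamma>" "Gamma_proj (conj_transpose g) = - ?v"
    using norm by (simp_all add: weyl_in_Gamma)
qed

lemma Gamma_lift:
  obtains g where "g \<in> \<Gamma>" "Gamma_proj g = v"
  using weyl_in_Gamma[of 1 v] Gamma_proj_weyl[of 1 v] by simp

lemma Gamma_same_proj:
  assumes "g \<in> \<Gamma>" "h \<in> \<Gamma>" "Gamma_proj g = Gamma_proj h"
  obtains c where "c \<noteq> 0" "\<And>x. g *v x = c *s (h *v x)"
proof -
  obtain z z' where z: "cmod z = 1" "cmod z' = 1"
    and gh: "g = weyl z (Gamma_proj h)" "h = weyl z' (Gamma_proj h)"
    using assms by (metis GammaE)
  have nonzero: "z \<noteq> 0" "z' \<noteq> 0"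
    using z by auto
  have "mat (z / z') ** h = g"
    by (subst gh(1), subst gh(2)) (simp add: mat_mult_weyl nonzero)
  then have "g *v x = (z / z') *s (h *v x)" for x
    by (metis mat_mult_vector matrix_vector_mul_assoc)
  then show thesis
    using that[of "z / z'"] nonzero by simp
qed

section \<open>The commutator form\<close>

lemma weyl_commute:
  "weyl z v ** weyl z' w =
     mat (zeta_power (dot (clock_part v) (shift_part w) - dot (clock_part w) (shift_part v))) ** (weyl z' w ** weyl z v)"
proof -
  let ?c = "dot (clock_part v) (shift_part w)" and ?d = "dot (clock_part w) (shift_part v)"
  have "zeta_power ?c = zeta_power (?c - ?d) * zeta_power ?d"
    by (simp add: zeta_power_add[symmetric])
  then show ?thesis
    by (simp add: weyl_mult mat_mult_weyl add.commute mult_ac)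
qed

lemma matrix_inv_unitary:
  assumes "A \<in> unitary"
  shows "matrix_inv A = conj_transpose A"
proof -
  have "A ** matrix_inv A = mat 1 \<and> matrix_inv A ** A = mat 1"
    unfolding matrix_inv_def by (rule someI[of _ "conj_transpose A"]) (use assms in \<open>simp add: unitary_def\<close>)
  then have "conj_transpose A ** (A ** matrix_inv A) = conj_transpose A"
    by simp
  moreover have "conj_transpose A ** (A ** matrix_inv A) = matrix_inv A"
    using assms by (simp add: matrix_mul_assoc unitary_def)
  ultimately show ?thesis
    by simp
qed

lemma commutator_form_eq:
  fixes v w :: "('p::prime_card, 'k::finite + 'k) Fpk"
  shows "commutator_form v w = dot (clock_part v) (shift_part w) - dot (clock_part w) (shift_part v)"
proof -
  let ?\<omega> = "dot (clock_part v) (shift_part w) - dot (clock_part w) (shift_part v)"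
  have commutator: "g ** h ** matrix_inv g ** matrix_inv h = mat (zeta_power ?\<omega>)"
    if gh: "g \<in> \<Gamma>" "h \<in> \<Gamma>" "Gamma_proj g = v" "Gamma_proj h = w" for g h :: "('p, 'k) Fpk cmatrix"
  proof -
    obtain z z' where "g = weyl z v" "h = weyl z' w"
      using gh by (metis GammaE)
    then have "g ** h = mat (zeta_power ?\<omega>) ** (h ** g)"
      using weyl_commute by blast
    then have "g ** h ** matrix_inv g ** matrix_inv h =
        mat (zeta_power ?\<omega>) ** (h ** (g ** conj_transpose g) ** conj_transpose h)"
      using gh by (simp add: matrix_inv_unitary Gamma_unitary matrix_mul_assoc)
    also have "\<dots> = mat (zeta_power ?\<omega>)"
      using Gamma_unitary[OF gh(1)] Gamma_unitary[OF gh(2)] by (simp add: unitary_def)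
    finally show ?thesis .
  qed
  show ?thesis
    unfolding commutator_form_def
  proof (rule the_equality)
    fix c :: "'p mod_ring"
    assume c: "\<forall>g\<in>\<Gamma>. \<forall>h\<in>\<Gamma>. Gamma_proj g = v \<and> Gamma_proj h = w \<longrightarrow>
        g ** h ** matrix_inv g ** matrix_inv h = (mat (zeta_power c) :: ('p, 'k) Fpk cmatrix)"
    obtain g h :: "('p, 'k) Fpk cmatrix" where gh: "g \<in> \<Gamma>" "h \<in> \<Gamma>" "Gamma_proj g = v" "Gamma_proj h = w"
      using Gamma_lift by metis
    then have "(mat (zeta_power c) :: ('p, 'k) Fpk cmatrix) = mat (zeta_power ?\<omega>)"
      using c commutator by metis
    then have "zeta_power c = zeta_power ?\<omega>"
      by (simp add: mat_eq_weyl weyl_eqD(1))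
    then show "c = ?\<omega>"
      by (simp add: zeta_power_inj)
  qed (use commutator in blast)
qed

lemma commutator_form_alternating: "commutator_form v v = 0"
  by (simp add: commutator_form_eq)

lemma commutator_form_skew: "commutator_form w v = - commutator_form v w"
  by (simp add: commutator_form_eq)

lemma commutator_form_add_right: "commutator_form v (w + w') = commutator_form v w + commutator_form v w'"
  by (simp add: commutator_form_eq dot_add_left dot_add_right)

lemma commutator_form_minus_right: "commutator_form v (- w) = - commutator_form v w"
  by (simp add: commutator_form_eq dot_minus_left dot_minus_right)

lemma commutator_form_diff_right: "commutator_form v (w - w') = commutator_form v w - commutator_form v w'"
  using commutator_form_add_right[of v w "- w'"] by (simp add: commutator_form_minus_right)

lemma Gamma_commute_vector:
  assumes "g \<in> \<Gamma>" "h \<in> \<Gamma>"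
  shows "g *v (h *v x) = zeta_power (commutator_form (Gamma_proj g) (Gamma_proj h)) *s (h *v (g *v x))"
proof -
  obtain z z' where "g = weyl z (Gamma_proj g)" "h = weyl z' (Gamma_proj h)"
    using assms by (metis GammaE)
  then have "g ** h = mat (zeta_power (commutator_form (Gamma_proj g) (Gamma_proj h))) ** (h ** g)"
    using weyl_commute commutator_form_eq by metis
  then have "(g ** h) *v x = (mat (zeta_power (commutator_form (Gamma_proj g) (Gamma_proj h))) ** (h ** g)) *v x"
    by (rule arg_cong)
  then show ?thesis
    by (simp only: matrix_vector_mul_assoc[symmetric] mat_mult_vector)
qed

text \<open>
  A linear functional that vanishes on \<open>W\<close> but not at \<open>u\<close> exists, and nondegeneracy of the form
  represents it by a vector.
\<close>

lemma perp_separation: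
  fixes W :: "('p::prime_card, 'k::finite + 'k) Fpk set"
  assumes W: "vec.subspace W" and u: "u \<notin> W"
  obtains w where "w \<in> perp W" "commutator_form w u \<noteq> 0"
proof -
  obtain B where B: "B \<subseteq> W" "vec.independent B" "W \<subseteq> vec.span B"
    using vec.maximal_independent_subset by blast
  then have "vec.span B = W"
    using W vec.span_minimal by blast
  then have "vec.independent (insert u B)" "u \<notin> B"
    using u B by (auto simp: vec.independent_insert)
  then obtain f where f: "Vector_Spaces.linear (*s) (*s) f" "\<And>x. x \<in> insert u B \<Longrightarrow> f x = (if x = u then u else 0)"
    using vec.linear_independent_extend[of "insert u B" "\<lambda>x. if x = u then u else 0"] by blast
  define A where "A = matrix f"
  have A: "f x = A *v x" for x
    using matrix_works[OF f(1)] by (simp add: A_def)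
  have "vec.span B \<subseteq> {x. f x = 0}"
  proof (rule vec.span_minimal)
    show "B \<subseteq> {x. f x = 0}"
      using f(2) \<open>u \<notin> B\<close> by auto
    show "vec.subspace {x. f x = 0}"
      by (rule vec.linear_subspace_kernel[OF f(1)])
  qed
  then have kernel: "A *v x = 0" if "x \<in> W" for x
    using that \<open>vec.span B = W\<close> A by auto
  have "u \<noteq> 0"
    using u vec.subspace_0[OF W] by blast
  then obtain s where s: "(A *v u) $ s \<noteq> 0"
    using f(2)[of u] A by (auto simp: vec_eq_iff)
  \<comment> \<open>row \<open>s\<close> of \<open>A\<close> is the functional; \<open>w\<close> is the vector that represents it under the symplectic form\<close>
  define w where "w = combine (\<chi> i. - A $ s $ Inr i) (\<chi> i. A $ s $ Inl i)"
  have form: "commutator_form w x = (A *v x) $ s" for x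
  proof -
    have "commutator_form w x = (\<Sum>i\<in>UNIV. A $ s $ Inl i * x $ Inl i) + (\<Sum>i\<in>UNIV. A $ s $ Inr i * x $ Inr i)"
      by (simp add: commutator_form_eq w_def dot_def shift_part_def[of x] clock_part_def[of x] sum_negf mult.commute)
    also have "\<dots> = (\<Sum>j\<in>UNIV. A $ s $ j * x $ j)"
      by (simp add: UNIV_Plus_UNIV[symmetric] sum.Plus del: UNIV_Plus_UNIV)
    finally show ?thesis
      by (simp add: matrix_vector_mult_def)
  qed
  show thesis
  proof (rule that)
    show "w \<in> perp W"
      by (simp add: perp_def form kernel)
    show "commutator_form w u \<noteq> 0"
      using s by (simp add: form)
  qed
qed

lemma perp_perp:
  assumes "vec.subspace W"
  shows "perp (perp W) = W"
proof
  show "perp (perp W) \<subseteq> W"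
  proof
    fix u assume u: "u \<in> perp (perp W)"
    show "u \<in> W"
    proof (rule ccontr)
      assume "u \<notin> W"
      then obtain w where "w \<in> perp W" "commutator_form w u \<noteq> 0"
        using perp_separation[OF assms] by blast
      then show False
        using u commutator_form_skew[of w u] by (auto simp: perp_def)
    qed
  qed
  show "W \<subseteq> perp (perp W)"
  proof
    fix u assume "u \<in> W"
    then have "commutator_form u w = 0" if "w \<in> perp W" for w
      using that commutator_form_skew[of u w] by (auto simp: perp_def)
    then show "u \<in> perp (perp W)"
      by (simp add: perp_def)
  qed
qed

lemma perp_antimono: "W \<subseteq> W' \<Longrightarrow> perp W' \<subseteq> perp W"
  by (auto simp: perp_def)

section \<open>Irreducibility and eigenvectors\<close>

text \<open>
  Averaging over the clock operators against a character projects \<open>x\<close> onto a coordinate axis. Choosing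
  a nonzero coordinate of \<open>x\<close> gives one basis vector in \<open>S\<close>, and the shifts give the others.
\<close>

lemma Gamma_irreducible:
  fixes S :: "(complex^('p::prime_card, 'k::finite) Fpk) set"
  assumes S: "vec.subspace S" and invariant: "\<And>g x. \<lbrakk>g \<in> \<Gamma>; x \<in> S\<rbrakk> \<Longrightarrow> g *v x \<in> S"
    and nonzero: "x \<in> S" "x \<noteq> 0"
  shows "S = UNIV"
proof -
  let ?N = "of_nat CARD(('p, 'k) Fpk) :: complex"
  obtain j where j: "x $ j \<noteq> 0"
    using nonzero(2) by (auto simp: vec_eq_iff)
  have clock: "clock_matrix b *v x \<in> S" for b
    using invariant[OF weyl_in_Gamma nonzero(1), of 1] by (simp add: clock_matrix_eq_weyl)
  define y where "y = (\<Sum>b\<in>UNIV. zeta_power (- dot b j) *s (clock_matrix b *v x))"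
  have "y \<in> S"
    unfolding y_def using S clock by (intro vec.subspace_sum vec.subspace_scale) auto
  have "y $ i = (if i = j then ?N * x $ j else 0)" for i
  proof -
    have "y $ i = (\<Sum>b\<in>UNIV. zeta_power (dot b (i - j))) * x $ i"
      by (simp add: y_def clock_matrix_mult_vector sum_distrib_right zeta_power_add[symmetric] dot_diff_right
          mult.assoc[symmetric])
    then show ?thesis
      by (simp add: sum_zeta_power_dot)
  qed
  then have "y = (?N * x $ j) *s axis j 1"
    by (simp add: vec_eq_iff axis_def)
  then have "axis j 1 = (1 / (?N * x $ j)) *s y"
    using j by (simp add: vec_eq_iff axis_def)
  then have axis_j: "axis j 1 \<in> S"
    using S \<open>y \<in> S\<close> vec.subspace_scale by metis
  have axis: "axis i 1 \<in> S" for i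
  proof -
    have "shift_matrix (i - j) *v axis j 1 \<in> S"
      using invariant[OF weyl_in_Gamma axis_j, of 1] by (simp add: shift_matrix_eq_weyl)
    moreover have "shift_matrix (i - j) *v axis j 1 = axis i (1 :: complex)"
      by (auto simp: vec_eq_iff shift_matrix_mult_vector axis_def)
    ultimately show ?thesis
      by simp
  qed
  have "z \<in> S" for z
  proof -
    have "(\<Sum>i\<in>UNIV. z $ i *s axis i 1) \<in> S"
      using S axis by (intro vec.subspace_sum vec.subspace_scale) auto
    then show ?thesis
      by (simp add: basis_expansion)
  qed
  then show ?thesis
    by auto
qed

lemma sum_zeta_power_mult:
  fixes u :: "'p::prime_card mod_ring"
  shows "(\<Sum>c\<in>UNIV. zeta_power (c * u)) = (if u = 0 then of_nat CARD('p) else 0)"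
proof (cases "u = 0")
  case False
  then have "zeta_power u \<noteq> 1"
    by (simp add: zeta_power_eq_1_iff)
  have "(\<Sum>c\<in>UNIV. zeta_power (c * u)) = (\<Sum>c\<in>UNIV. zeta_power ((1 + c) * u))"
    by (rule sum.reindex_bij_witness[of _ "\<lambda>c. 1 + c" "\<lambda>c. c - 1"]) auto
  also have "\<dots> = zeta_power u * (\<Sum>c\<in>UNIV. zeta_power (c * u))"
    by (simp add: ring_distribs zeta_power_add sum_distrib_left)
  finally show ?thesis
    using \<open>zeta_power u \<noteq> 1\<close> False by simp
qed simp

text \<open>
  If \<open>g\<close> lies over \<open>v\<close>, its \<open>p\<close>-th power lies over \<open>p v = 0\<close>.
\<close>

lemma Gamma_power_scalar:
  fixes g :: "('p::prime_card, 'k::finite) Fpk cmatrix"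
  assumes "g \<in> \<Gamma>"
  obtains c where "c \<noteq> 0" "\<And>x. ((*v) g ^^ CARD('p)) x = c *s x"
proof -
  have "\<exists>h\<in>\<Gamma>. Gamma_proj h = of_nat n *s Gamma_proj g \<and> (\<forall>x. ((*v) g ^^ n) x = h *v x)" for n
  proof (induction n)
    case 0
    show ?case
      using mat_1_in_Gamma by (intro bexI[of _ "mat 1"]) (simp_all add: mat_eq_weyl[of 1, symmetric] Gamma_proj_weyl[of 1 0, folded mat_eq_weyl])
  next
    case (Suc n)
    then obtain h where h: "h \<in> \<Gamma>" "Gamma_proj h = of_nat n *s Gamma_proj g" "\<forall>x. ((*v) g ^^ n) x = h *v x"
      by blast
    then show ?case
      using Gamma_mult[OF assms h(1)]
      by (intro bexI[of _ "g ** h"]) (simp_all add: vec.scale_left_distrib matrix_vector_mul_assoc)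
  qed
  then obtain h where h: "h \<in> \<Gamma>" "Gamma_proj h = of_nat CARD('p) *s Gamma_proj g"
    "\<And>x. ((*v) g ^^ CARD('p)) x = h *v x"
    by metis
  have "Gamma_proj h = Gamma_proj (mat 1 :: ('p, 'k) Fpk cmatrix)"
    using Gamma_proj_weyl[of 1 "0 :: ('p, 'k + 'k) Fpk"] by (simp add: h(2) mat_eq_weyl)
  then obtain c where "c \<noteq> 0" "\<And>x. h *v x = c *s (mat 1 *v x)"
    using Gamma_same_proj[OF h(1) mat_1_in_Gamma] by metis
  then show thesis
    using that h(3) by simp
qed

text \<open>
  After division by a \<open>p\<close>-th root \<open>r\<close> of the scalar \<open>g\<^sup>p\<close> the operator generates an action of \<open>\<int>/p\<close>,
  and \<open>v\<close> is, up to the factor \<open>p\<close>, the sum of its projections \<open>y e\<close> to the eigenspaces.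
\<close>

lemma Gamma_eigenvector:
  fixes g :: "('p::prime_card, 'k::finite) Fpk cmatrix"
  assumes g: "g \<in> \<Gamma>" and S: "vec.subspace S" and invariant: "\<And>x. x \<in> S \<Longrightarrow> g *v x \<in> S"
    and v: "v \<in> S" "v \<noteq> 0"
  obtains x d where "x \<in> S" "x \<noteq> 0" "g *v x = d *s x"
proof -
  let ?p = "CARD('p)" and ?f = "(*v) g"
  obtain c where c: "c \<noteq> 0" "\<And>x. (?f ^^ ?p) x = c *s x"
    using Gamma_power_scalar[OF g] by blast
  obtain r where r: "r \<noteq> 0" "r ^ ?p = c"
    using exists_complex_root_nonzero[of c ?p] c(1) by auto
  define F where "F e n = (zeta_power (e * of_nat n) / r ^ n) *s (?f ^^ n) v" for e :: "'p mod_ring" and n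
  define y where "y e = (\<Sum>n<?p. F e n)" for e
  have pow: "(?f ^^ n) v \<in> S" for n
    by (induction n) (auto simp: v invariant)
  have y_S: "y e \<in> S" for e
    unfolding y_def F_def using S pow by (intro vec.subspace_sum vec.subspace_scale) auto
  have "g *v y e = (r * zeta_power (- e)) *s y e" for e
  proof -
    have F_Suc: "g *v F e n = (r * zeta_power (- e)) *s F e (Suc n)" for n
    proof -
      have "zeta_power (e * of_nat (Suc n)) = zeta_power e * zeta_power (e * of_nat n)"
        by (simp add: zeta_power_add[symmetric] ring_distribs)
      then show ?thesis
        using r(1) by (simp add: F_def vec.scale field_simps)
    qed
    have "F e ?p = F e 0"
      using r(1) by (simp add: F_def c(2) r(2) c(1))
    then have "(\<Sum>n<?p. F e (Suc n)) = (\<Sum>n<?p. F e n)"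
      using sum.lessThan_Suc_shift[of "F e" ?p] by simp
    then show ?thesis
      by (simp add: y_def vec.sum F_Suc vec.scale_sum_right[symmetric])
  qed
  moreover have "\<exists>e. y e \<noteq> 0"
  proof (rule ccontr)
    assume "\<nexists>e. y e \<noteq> 0"
    then have "(\<Sum>e\<in>UNIV. y e) = 0"
      by simp
    moreover have "(\<Sum>e\<in>UNIV. y e) = (\<Sum>n<?p. \<Sum>e\<in>UNIV. F e n)"
      unfolding y_def by (rule sum.swap)
    moreover have "(\<Sum>e\<in>UNIV. F e n) = (if n = 0 then of_nat ?p *s v else 0)" if "n < ?p" for n
    proof -
      have "(\<Sum>e\<in>UNIV. F e n) = ((\<Sum>e\<in>UNIV. zeta_power (e * (of_nat n :: 'p mod_ring))) / r ^ n) *s (?f ^^ n) v"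
        by (simp add: F_def vec.scale_sum_left[symmetric] sum_divide_distrib)
      moreover have "(of_nat n :: 'p mod_ring) = 0 \<longleftrightarrow> n = 0"
        using of_nat_0_mod_ring_dvd[of n, where 'a = 'p] that by (auto dest: nat_dvd_not_less)
      ultimately show ?thesis
        by (simp add: sum_zeta_power_mult)
    qed
    ultimately have "of_nat ?p *s v = 0"
      by simp
    then show False
      using v(2) by simp
  qed
  ultimately show thesis
    using that y_S by blast
qed


section \<open>Invariant decompositions\<close>

lemma subspace_eigenspace: "vec.subspace {x. A *v x = d *s x}"
  by (auto simp: vec.subspace_def vec.add vec.scale vec.scale_right_distrib mult.commute)

lemma subspace_hermitian_orthogonal:
  "vec.subspace {x. hermitian_inner a x = 0}" "vec.subspace {x. hermitian_inner x a = 0}"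
  by (auto simp: vec.subspace_def hermitian_inner_add_right hermitian_inner_scale_right
      hermitian_inner_add_left hermitian_inner_scale_left)

lemma hermitian_inner_span_right:
  assumes "\<And>x. x \<in> X \<Longrightarrow> hermitian_inner a x = 0" "y \<in> vec.span X"
  shows "hermitian_inner a y = 0"
proof -
  have "vec.span X \<subseteq> {x. hermitian_inner a x = 0}"
    using assms(1) subspace_hermitian_orthogonal(1) by (intro vec.span_minimal) auto
  then show ?thesis
    using assms(2) by blast
qed

lemma hermitian_inner_span_left:
  assumes "\<And>x. x \<in> X \<Longrightarrow> hermitian_inner x a = 0" "y \<in> vec.span X"
  shows "hermitian_inner y a = 0"
proof -
  have "vec.span X \<subseteq> {x. hermitian_inner x a = 0}"
    using assms(1) subspace_hermitian_orthogonal(2) by (intro vec.span_minimal) auto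
  then show ?thesis
    using assms(2) by blast
qed

lemma span_matrix_invariant:
  assumes "\<And>x. x \<in> X \<Longrightarrow> A *v x \<in> vec.span X" "y \<in> vec.span X"
  shows "A *v y \<in> vec.span X"
proof -
  have "(*v) A ` vec.span X = vec.span ((*v) A ` X)"
    by (rule vec.linear_span_image[OF matrix_vector_mul_linear_gen, symmetric])
  also have "\<dots> \<subseteq> vec.span X"
    using assms(1) by (intro vec.span_minimal) auto
  finally show ?thesis
    using assms(2) by blast
qed

lemma unitary_eigenvalue:
  assumes "A \<in> unitary" "A *v x = d *s x" "x \<noteq> 0"
  shows "cnj d * d = 1"
proof -
  have "hermitian_inner (A *v x) (A *v x) = hermitian_inner x x"
    using assms(1) by (rule hermitian_inner_unitary)
  moreover have "hermitian_inner (A *v x) (A *v x) = cnj d * d * hermitian_inner x x"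
    by (simp add: assms(2) hermitian_inner_scale_left hermitian_inner_scale_right mult_ac)
  ultimately have "cnj d * d * hermitian_inner x x = 1 * hermitian_inner x x"
    by simp
  then show ?thesis
    using assms(3) hermitian_inner_self_eq_0 mult_right_cancel by blast
qed

lemma unitary_eigenvectors_orthogonal:
  assumes A: "A \<in> unitary" and x: "A *v x = d *s x" and y: "A *v y = e *s y" and "d \<noteq> e"
  shows "hermitian_inner x y = 0"
proof (cases "x = 0")
  case False
  then have d: "cnj d * d = 1"
    using unitary_eigenvalue[OF A x] by simp
  then have "cnj d * e \<noteq> 1"
    using \<open>d \<noteq> e\<close> by (metis mult_left_cancel mult_zero_left zero_neq_one)
  moreover have "hermitian_inner (A *v x) (A *v y) = cnj d * e * hermitian_inner x y"
    by (simp add: x y hermitian_inner_scale_left hermitian_inner_scale_right mult_ac)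
  then have "hermitian_inner x y = cnj d * e * hermitian_inner x y"
    using hermitian_inner_unitary[OF A, of x y] by simp
  ultimately show ?thesis
    by (metis mult_cancel_right1)
qed simp

lemma Gamma_orbit_spans:
  fixes x :: "complex^('p::prime_card, 'k::finite) Fpk"
  assumes "x \<noteq> 0"
  shows "vec.span ((\<lambda>h. h *v x) ` \<Gamma>) = UNIV"
proof (rule Gamma_irreducible)
  let ?X = "(\<lambda>h. h *v x) ` \<Gamma>"
  show "g *v y \<in> vec.span ?X" if g: "g \<in> \<Gamma>" and y: "y \<in> vec.span ?X" for g y
  proof (rule span_matrix_invariant[OF _ y])
    fix z assume "z \<in> ?X"
    then obtain h where h: "h \<in> \<Gamma>" "z = h *v x"
      by auto
    then have "g *v z = (g ** h) *v x"
      by (simp add: matrix_vector_mul_assoc)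
    then have "g *v z \<in> ?X"
      using Gamma_mult(1)[OF g h(1)] by blast
    then show "g *v z \<in> vec.span ?X"
      by (rule vec.span_base)
  qed
  have "mat 1 *v x \<in> ?X"
    using mat_1_in_Gamma by blast
  then show "x \<in> vec.span ?X"
    by (simp add: vec.span_base)
qed (use assms in auto)

definition invariant_decompositions :: "('p::prime_card, 'k::finite) Fpk decomposition set" where
  "invariant_decompositions = {L \<in> proper_decompositions. \<forall>g\<in>\<Gamma>. decomposition_act g L = L}"

text \<open>
  For invariant decompositions it is enough to preserve one component, see \<open>stabilizerI\<close>.
\<close>

definition stabilizer :: "('p::prime_card, 'k::finite) Fpk decomposition \<Rightarrow> ('p, 'k) Fpk cmatrix set" where
  "stabilizer L = {g \<in> \<Gamma>. \<forall>V\<in>L. (*v) g ` V = V}"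

lemma image_image_mult: "(*v) g ` (*v) h ` V = (*v) (g ** h) ` V"
  by (simp add: image_image matrix_vector_mul_assoc)

lemma scale_subspace_image:
  assumes V: "vec.subspace V" and c: "c \<noteq> 0"
  shows "(*s) c ` V = V"
proof
  show "(*s) c ` V \<subseteq> V"
    using V by (auto intro: vec.subspace_scale)
  show "V \<subseteq> (*s) c ` V"
  proof
    fix x assume "x \<in> V"
    then have "(1 / c) *s x \<in> V"
      using V by (auto intro: vec.subspace_scale)
    moreover have "x = c *s ((1 / c) *s x)"
      using c by simp
    ultimately show "x \<in> (*s) c ` V"
      by blast
  qed
qed

lemma Gamma_same_proj_image:
  assumes "g \<in> \<Gamma>" "h \<in> \<Gamma>" "Gamma_proj g = Gamma_proj h" "vec.subspace V"
  shows "(*v) g ` V = (*v) h ` V"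
proof -
  obtain c where c: "c \<noteq> 0" "\<And>x. g *v x = c *s (h *v x)"
    using Gamma_same_proj[OF assms(1-3)] by blast
  then have "(*v) g ` V = (*s) c ` (*v) h ` V"
    by (simp add: image_image)
  then show ?thesis
    using scale_subspace_image[OF subspace_matrix_image[OF assms(4)] c(1)] by simp
qed

context
  fixes L :: "('p::prime_card, 'k::finite) Fpk decomposition"
  assumes L: "L \<in> invariant_decompositions"
begin

lemma invariant_decomposition_proper: "L \<in> proper_decompositions"
  using L by (simp add: invariant_decompositions_def)

lemma component_translate: "g \<in> \<Gamma> \<Longrightarrow> V \<in> L \<Longrightarrow> (*v) g ` V \<in> L"
proof -
  assume "g \<in> \<Gamma>" "V \<in> L"
  then have "decomposition_act g L = L"
    using L by (simp add: invariant_decompositions_def)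
  then show "(*v) g ` V \<in> L"
    using \<open>V \<in> L\<close> by (auto simp: decomposition_act_def)
qed

text \<open>
  The orbit of a nonzero vector of \<open>V\<close> spans the whole space. If no translate of \<open>V\<close> were \<open>V'\<close>, then
  \<open>V'\<close> would be orthogonal to this orbit.
\<close>

lemma components_transitive:
  assumes V: "V \<in> L" and V': "V' \<in> L"
  obtains g where "g \<in> \<Gamma>" "(*v) g ` V = V'"
proof -
  obtain v where v: "v \<in> V" "v \<noteq> 0"
    using decomposition_component_nonzero[OF invariant_decomposition_proper V] .
  obtain x where x: "x \<in> V'" "x \<noteq> 0"
    using decomposition_component_nonzero[OF invariant_decomposition_proper V'] .
  have "\<exists>g\<in>\<Gamma>. (*v) g ` V = V'"
  proof (rule ccontr)
    assume none: "\<not> (\<exists>g\<in>\<Gamma>. (*v) g ` V = V')"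
    have orthogonal: "hermitian_inner x y = 0" if y: "y \<in> (\<lambda>g. g *v v) ` \<Gamma>" for y
    proof -
      obtain g where g: "g \<in> \<Gamma>" "y \<in> (*v) g ` V"
        using y v(1) by blast
      then have "V' \<noteq> (*v) g ` V"
        using none by blast
      then show ?thesis
        using proper_decompositionsD(4)[OF invariant_decomposition_proper V' component_translate[OF g(1) V]] x(1) g(2) by blast
    qed
    have "x \<in> vec.span ((\<lambda>g. g *v v) ` \<Gamma>)"
      using Gamma_orbit_spans[OF v(2)] by simp
    with orthogonal have "hermitian_inner x x = 0"
      by (rule hermitian_inner_span_right)
    then show False
      using x(2) by (simp add: hermitian_inner_self_eq_0)
  qed
  then show thesis
    using that by blast
qed

text \<open>
  The other components are the translates \<open>h V\<close>, and \<open>g h\<close> is a scalar multiple of \<open>h g\<close>.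
\<close>

lemma stabilizerI:
  assumes g: "g \<in> \<Gamma>" and V: "V \<in> L" and gV: "(*v) g ` V = V"
  shows "g \<in> stabilizer L"
  unfolding stabilizer_def
proof (intro CollectI conjI ballI g)
  fix V' assume "V' \<in> L"
  then obtain h where h: "h \<in> \<Gamma>" "(*v) h ` V = V'"
    using components_transitive[OF V] by blast
  have "(*v) (g ** h) ` V = (*v) (h ** g) ` V"
    using g h(1) proper_decompositionsD(1)[OF invariant_decomposition_proper V]
    by (intro Gamma_same_proj_image) (simp_all add: Gamma_mult add.commute)
  then show "(*v) g ` V' = V'"
    by (simp add: h(2)[symmetric] image_image_mult[symmetric] gV)
qed

lemma stabilizer_eq: "stabilizer L = {g \<in> \<Gamma>. Gamma_proj g \<in> Gamma_proj ` stabilizer L}"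
proof
  show "{g \<in> \<Gamma>. Gamma_proj g \<in> Gamma_proj ` stabilizer L} \<subseteq> stabilizer L"
  proof
    fix g assume g: "g \<in> {g \<in> \<Gamma>. Gamma_proj g \<in> Gamma_proj ` stabilizer L}"
    then obtain h where h: "h \<in> stabilizer L" "Gamma_proj g = Gamma_proj h"
      by auto
    have "(*v) g ` V = V" if "V \<in> L" for V
      using Gamma_same_proj_image[of g h V] g h that proper_decompositionsD(1)[OF invariant_decomposition_proper that]
      by (auto simp: stabilizer_def)
    then show "g \<in> stabilizer L"
      using g by (simp add: stabilizer_def)
  qed
qed (auto simp: stabilizer_def)

lemma stabilizer_mult: "g \<in> stabilizer L \<Longrightarrow> h \<in> stabilizer L \<Longrightarrow> g ** h \<in> stabilizer L"
  by (auto simp: stabilizer_def Gamma_mult image_image_mult[symmetric])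

lemma mat_1_in_stabilizer: "mat 1 \<in> stabilizer L"
  by (simp add: stabilizer_def mat_1_in_Gamma)

lemma subspace_proj_stabilizer: "vec.subspace (Gamma_proj ` stabilizer L)"
proof -
  let ?W = "Gamma_proj ` stabilizer L"
  have zero: "0 \<in> ?W"
    using mat_1_in_stabilizer Gamma_proj_weyl[of 1 "0 :: ('p, 'k + 'k) Fpk"] by (force simp: mat_eq_weyl)
  have add: "v + w \<in> ?W" if vw: "v \<in> ?W" "w \<in> ?W" for v w
  proof -
    obtain g h where "g \<in> stabilizer L" "h \<in> stabilizer L" "v = Gamma_proj g" "w = Gamma_proj h"
      using vw by auto
    then have "g ** h \<in> stabilizer L" "v + w = Gamma_proj (g ** h)"
      by (auto simp: stabilizer_mult) (auto simp: stabilizer_def Gamma_mult)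
    then show ?thesis
      by blast
  qed
  have "of_nat n *s v \<in> ?W" if "v \<in> ?W" for n v
    by (induction n) (simp_all add: zero add that vec.scale_left_distrib)
  then have "c *s v \<in> ?W" if "v \<in> ?W" for c v
    using that surj_of_nat_mod_ring[of c] by metis
  then show ?thesis
    using zero add by (simp add: vec.subspace_def)
qed

text \<open>
  Let \<open>C\<close> be the centralizer of \<open>g\<close> in \<open>\<Gamma>\<close>, which contains the stabilizer of \<open>L\<close>, and let \<open>U\<close> be the
  sum of the translates of \<open>V\<close> under \<open>C\<close>. It contains an eigenvector \<open>x\<close> of \<open>g\<close>, and the orbit of \<open>x\<close>
  under \<open>\<Gamma>\<close> spans the whole space. The translates of \<open>x\<close> under \<open>C\<close> are eigenvectors for the same
  eigenvalue. Those under the rest of \<open>\<Gamma>\<close> are orthogonal to \<open>U\<close>, because an element that carries a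
  \<open>C\<close>-translate of \<open>V\<close> to a \<open>C\<close>-translate of \<open>V\<close> differs from an element of the stabilizer by
  elements of \<open>C\<close>. So all of \<open>U\<close>, and with it \<open>V\<close>, consists of eigenvectors for this eigenvalue.
\<close>

lemma perp_acts_by_scalars:
  assumes g: "g \<in> \<Gamma>" "Gamma_proj g \<in> perp (Gamma_proj ` stabilizer L)" and V: "V \<in> L"
  obtains d where "\<And>u. u \<in> V \<Longrightarrow> g *v u = d *s u"
proof -
  let ?\<omega> = "commutator_form (Gamma_proj g)"
  define C where "C = {h \<in> \<Gamma>. ?\<omega> (Gamma_proj h) = 0}"
  have C_Gamma: "h \<in> \<Gamma>" if "h \<in> C" for h
    using that by (simp add: C_def)
  have commute: "g *v (h *v x) = h *v (g *v x)" if "h \<in> C" for h x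
    using Gamma_commute_vector[OF g(1), of h x] that by (simp add: C_def)
  have C_mult: "q ** h \<in> C" if "q \<in> C" "h \<in> C" for q h
    using that by (simp add: C_def Gamma_mult commutator_form_add_right)
  have g_C: "g \<in> C"
    using g(1) by (simp add: C_def commutator_form_alternating)
  have stabilizer_C: "stabilizer L \<subseteq> C"
    using g(2) by (auto simp: C_def perp_def stabilizer_def)
  define X where "X = (\<Union>h\<in>C. (*v) h ` V)"
  define U where "U = vec.span X"
  have C_U: "h *v x \<in> U" if h: "h \<in> C" and x: "x \<in> U" for h x
    unfolding U_def
  proof (rule span_matrix_invariant[OF _ x[unfolded U_def]])
    fix y assume "y \<in> X"
    then obtain q u where q: "q \<in> C" "u \<in> V" "y = q *v u"
      by (auto simp: X_def)
    then have "h *v y = (h ** q) *v u"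
      by (simp add: matrix_vector_mul_assoc)
    then have "h *v y \<in> X"
      unfolding X_def using C_mult[OF h q(1)] q(2) by blast
    then show "h *v y \<in> vec.span X"
      by (rule vec.span_base)
  qed
  have V_U: "V \<subseteq> U"
  proof
    fix x assume "x \<in> V"
    then have "mat 1 *v x \<in> X"
      unfolding X_def using mat_1_in_stabilizer stabilizer_C by blast
    then show "x \<in> U"
      by (simp add: U_def vec.span_base)
  qed
  have U: "vec.subspace U"
    by (simp add: U_def vec.subspace_span)
  obtain v where v: "v \<in> V" "v \<noteq> 0"
    using decomposition_component_nonzero[OF invariant_decomposition_proper V] .
  obtain x d where x: "x \<in> U" "x \<noteq> 0" "g *v x = d *s x"
    using Gamma_eigenvector[OF g(1) U C_U[OF g_C]] v V_U by blast
  have orthogonal: "hermitian_inner (h *v a) b = 0" if h: "h \<in> \<Gamma>" "h \<notin> C" and a: "a \<in> U" and b: "b \<in> U" for h a b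
  proof (rule hermitian_inner_span_right[OF _ b[unfolded U_def]])
    fix y assume "y \<in> X"
    then obtain q where q: "q \<in> C" "y \<in> (*v) q ` V"
      by (auto simp: X_def)
    have "hermitian_inner a (conj_transpose h *v y) = 0"
    proof (rule hermitian_inner_span_left[OF _ a[unfolded U_def]])
      fix z assume "z \<in> X"
      then obtain q' where q': "q' \<in> C" "z \<in> (*v) q' ` V"
        by (auto simp: X_def)
      have hq': "h ** q' \<in> \<Gamma>"
        using h(1) q'(1) by (simp add: C_Gamma Gamma_mult)
      have q_inv: "conj_transpose q \<in> \<Gamma>" "Gamma_proj (conj_transpose q) = - Gamma_proj q"
        using Gamma_conj_transpose[OF C_Gamma[OF q(1)]] by simp_all
      have "(*v) (h ** q') ` V \<noteq> (*v) q ` V"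
      proof
        assume "(*v) (h ** q') ` V = (*v) q ` V"
        then have "(*v) (conj_transpose q ** (h ** q')) ` V = (*v) (conj_transpose q ** q) ` V"
          by (simp add: image_image_mult[symmetric])
        also have "\<dots> = V"
          using Gamma_unitary[OF C_Gamma[OF q(1)]] by (simp add: unitary_def)
        finally have "conj_transpose q ** (h ** q') \<in> C"
          using stabilizerI[OF Gamma_mult(1)[OF q_inv(1) hq'] V] stabilizer_C by blast
        then have "?\<omega> (- Gamma_proj q + (Gamma_proj h + Gamma_proj q')) = 0"
          using q_inv hq' h(1) C_Gamma[OF q'(1)] by (simp add: C_def Gamma_mult)
        then have "?\<omega> (Gamma_proj h) = 0"
          using q(1) q'(1) by (simp add: C_def commutator_form_add_right commutator_form_diff_right)
        then show False
          using h by (simp add: C_def)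
      qed
      moreover have "h *v z \<in> (*v) (h ** q') ` V"
        using q'(2) by (auto simp: matrix_vector_mul_assoc)
      ultimately have "hermitian_inner (h *v z) y = 0"
        using proper_decompositionsD(4)[OF invariant_decomposition_proper component_translate[OF hq' V] component_translate[OF C_Gamma[OF q(1)] V]] q(2) by blast
      then show "hermitian_inner z (conj_transpose h *v y) = 0"
        by (simp add: hermitian_inner_conj_transpose)
    qed
    then show "hermitian_inner (h *v a) y = 0"
      by (simp add: hermitian_inner_conj_transpose)
  qed
  let ?S = "(\<lambda>h. h *v x) ` C" and ?R = "(\<lambda>h. h *v x) ` (\<Gamma> - C)"
  have "vec.span ((\<lambda>h. h *v x) ` \<Gamma>) = UNIV"
    using x(2) by (rule Gamma_orbit_spans)
  moreover have "(\<lambda>h. h *v x) ` \<Gamma> = ?S \<union> ?R"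
    using C_Gamma by blast
  ultimately have span: "vec.span (?S \<union> ?R) = UNIV"
    by simp
  show thesis
  proof (rule that)
    fix u assume "u \<in> V"
    then have u: "u \<in> U"
      using V_U by blast
    \<comment> \<open>\<open>r\<close> is orthogonal to \<open>U\<close> and, as the difference of \<open>u\<close> and \<open>s\<close>, lies in \<open>U\<close>; hence it is 0\<close>
    obtain s r where sr: "s \<in> vec.span ?S" "r \<in> vec.span ?R" "u = s + r"
      using span unfolding vec.span_Un by blast
    have "vec.span ?S \<subseteq> U"
      using U C_U[OF _ x(1)] by (intro vec.span_minimal) auto
    then have "u - s \<in> U"
      using u sr(1) U vec.subspace_diff by blast
    then have "r \<in> U"
      using sr(3) by simp
    have "hermitian_inner r r = 0"
      using orthogonal x(1) \<open>r \<in> U\<close> by (intro hermitian_inner_span_left[OF _ sr(2)]) auto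
    then have "r = 0"
      by (simp add: hermitian_inner_self_eq_0)
    have "vec.span ?S \<subseteq> {y. g *v y = d *s y}"
      using commute x(3) by (intro vec.span_minimal subspace_eigenspace) (auto simp: vec.scale)
    then show "g *v u = d *s u"
      using sr \<open>r = 0\<close> by auto
  qed
qed

text \<open>
  An operator that acts on a component as a scalar preserves it.
\<close>

lemma coisotropic_proj_stabilizer: "coisotropic (Gamma_proj ` stabilizer L)"
  unfolding coisotropic_def
proof (intro conjI subspace_proj_stabilizer subsetI)
  fix w assume w: "w \<in> perp (Gamma_proj ` stabilizer L)"
  obtain g :: "('p, 'k) Fpk cmatrix" where g: "g \<in> \<Gamma>" "Gamma_proj g = w"
    using Gamma_lift by blast
  obtain V where V: "V \<in> L"
    using decomposition_nonempty[OF invariant_decomposition_proper] by blast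
  obtain d where d: "\<And>u. u \<in> V \<Longrightarrow> g *v u = d *s u"
    using perp_acts_by_scalars[OF g(1) _ V] w g(2) by blast
  obtain v where "v \<in> V" "v \<noteq> 0"
    using decomposition_component_nonzero[OF invariant_decomposition_proper V] .
  then have "cnj d * d = 1"
    using unitary_eigenvalue[OF Gamma_unitary[OF g(1)] d] by blast
  then have "d \<noteq> 0"
    by auto
  have "(*v) g ` V = (*s) d ` V"
    using d by (intro image_cong) auto
  then have "(*v) g ` V = V"
    using scale_subspace_image[OF proper_decompositionsD(1)[OF invariant_decomposition_proper V] \<open>d \<noteq> 0\<close>] by simp
  then show "w \<in> Gamma_proj ` stabilizer L"
    using stabilizerI[OF g(1) V] g(2) by blast
qed

lemma stabilizer_proper_coisotropic:
  "stabilizer L \<in> proper_coisotropic_subgroups TYPE('p) TYPE('k)"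
proof -
  have "stabilizer L \<noteq> \<Gamma>"
  proof
    assume all: "stabilizer L = \<Gamma>"
    obtain V where V: "V \<in> L"
      using decomposition_nonempty[OF invariant_decomposition_proper] by blast
    obtain v where v: "v \<in> V" "v \<noteq> 0"
      using decomposition_component_nonzero[OF invariant_decomposition_proper V] .
    have "V = UNIV"
    proof (rule Gamma_irreducible[OF proper_decompositionsD(1)[OF invariant_decomposition_proper V] _ v])
      fix g :: "('p, 'k) Fpk cmatrix" and x
      assume "g \<in> \<Gamma>" "x \<in> V"
      then have "g *v x \<in> (*v) g ` V" "(*v) g ` V = V"
        using all V by (auto simp: stabilizer_def)
      then show "g *v x \<in> V"
        by simp
    qed
    then show False
      using proper_decompositionsD(3)[OF invariant_decomposition_proper V] by simp
  qed
  moreover have "stabilizer L \<in> coisotropic_subgroups TYPE('p) TYPE('k)"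
    unfolding coisotropic_subgroups_def using stabilizer_eq coisotropic_proj_stabilizer by blast
  ultimately show ?thesis
    by (simp add: proper_coisotropic_subgroups_def)
qed

text \<open>
  Write \<open>V' = h V\<close>. Then \<open>h\<close> lies outside the stabilizer, so some \<open>g\<close> over the orthogonal complement
  has a nontrivial commutator with \<open>h\<close>, and its eigenvalues on \<open>V\<close> and \<open>h V\<close> differ by this commutator.
\<close>

lemma components_separated:
  assumes V: "V \<in> L" and V': "V' \<in> L" and "V \<noteq> V'"
  obtains g d e where "g \<in> \<Gamma>" "Gamma_proj g \<in> perp (Gamma_proj ` stabilizer L)" "d \<noteq> e"
    "\<And>u. u \<in> V \<Longrightarrow> g *v u = d *s u" "\<And>u. u \<in> V' \<Longrightarrow> g *v u = e *s u"
proof -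
  obtain h where h: "h \<in> \<Gamma>" "(*v) h ` V = V'"
    using components_transitive[OF V V'] .
  then have "h \<notin> stabilizer L"
    using V \<open>V \<noteq> V'\<close> by (auto simp: stabilizer_def)
  then have "Gamma_proj h \<notin> Gamma_proj ` stabilizer L"
    using h(1) stabilizer_eq by blast
  then obtain w where w: "w \<in> perp (Gamma_proj ` stabilizer L)" "commutator_form w (Gamma_proj h) \<noteq> 0"
    using perp_separation[OF subspace_proj_stabilizer] by blast
  obtain g :: "('p, 'k) Fpk cmatrix" where g: "g \<in> \<Gamma>" "Gamma_proj g = w"
    using Gamma_lift by blast
  obtain d where d: "\<And>u. u \<in> V \<Longrightarrow> g *v u = d *s u"
    using perp_acts_by_scalars[OF g(1) _ V] w(1) g(2) by blast
  let ?e = "zeta_power (commutator_form w (Gamma_proj h)) * d"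
  have e: "g *v u = ?e *s u" if "u \<in> V'" for u
  proof -
    obtain v where "v \<in> V" "u = h *v v"
      using \<open>u \<in> V'\<close> h(2) by blast
    then show ?thesis
      using Gamma_commute_vector[OF g(1) h(1), of v] by (simp add: d g(2) vec.scale)
  qed
  obtain v where "v \<in> V" "v \<noteq> 0"
    using decomposition_component_nonzero[OF invariant_decomposition_proper V] .
  then have "cnj d * d = 1"
    using unitary_eigenvalue[OF Gamma_unitary[OF g(1)] d] by blast
  then have "d \<noteq> 0"
    by auto
  then have "d \<noteq> ?e"
    using w(2) by (simp add: zeta_power_eq_1_iff)
  then show thesis
    using that[of g d ?e] g w(1) d e by simp
qed

text \<open>
  Vectors with the eigenvalues of \<open>V\<close> are orthogonal to all other components, since there some
  eigenvalue is different. Apply this to the part of \<open>y\<close> in the sum of the other components.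
\<close>

lemma component_contains_eigenvectors:
  assumes V: "V \<in> L"
    and y: "\<And>g d. \<lbrakk>g \<in> \<Gamma>; Gamma_proj g \<in> perp (Gamma_proj ` stabilizer L); \<And>u. u \<in> V \<Longrightarrow> g *v u = d *s u\<rbrakk>
              \<Longrightarrow> g *v y = d *s y"
  shows "y \<in> V"
proof -
  have orthogonal: "hermitian_inner z u = 0"
    if z: "\<And>g d. \<lbrakk>g \<in> \<Gamma>; Gamma_proj g \<in> perp (Gamma_proj ` stabilizer L); \<And>u. u \<in> V \<Longrightarrow> g *v u = d *s u\<rbrakk>
              \<Longrightarrow> g *v z = d *s z"
      and u: "u \<in> \<Union>(L - {V})" for z u
  proof -
    obtain V' where V': "V' \<in> L" "V \<noteq> V'" "u \<in> V'"
      using u by blast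
    obtain g d e where g: "g \<in> \<Gamma>" "Gamma_proj g \<in> perp (Gamma_proj ` stabilizer L)" "d \<noteq> e"
      "\<And>u. u \<in> V \<Longrightarrow> g *v u = d *s u" "\<And>u. u \<in> V' \<Longrightarrow> g *v u = e *s u"
      using components_separated[OF V V'(1,2)] by blast
    then show ?thesis
      using unitary_eigenvectors_orthogonal[OF Gamma_unitary[OF g(1)] z[OF g(1,2,4)] g(5)[OF V'(3)]] by blast
  qed
  have "\<Union>L = V \<union> \<Union>(L - {V})"
    using V by blast
  then have "y \<in> vec.span (V \<union> \<Union>(L - {V}))"
    using proper_decompositionsD(5)[OF invariant_decomposition_proper] by auto
  then obtain v r where vr: "v \<in> vec.span V" "r \<in> vec.span (\<Union>(L - {V}))" "y = v + r"
    unfolding vec.span_Un by blast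
  have "v \<in> V"
    using vr(1) proper_decompositionsD(1)[OF invariant_decomposition_proper V] vec.span_eq_iff by blast
  have r: "g *v r = d *s r"
    if "g \<in> \<Gamma>" "Gamma_proj g \<in> perp (Gamma_proj ` stabilizer L)" "\<And>u. u \<in> V \<Longrightarrow> g *v u = d *s u" for g d
  proof -
    have "r = y - v"
      using vr(3) by simp
    then show ?thesis
      using y[OF that] that(3)[OF \<open>v \<in> V\<close>] by (simp add: vec.diff vec.scale_right_diff_distrib)
  qed
  have "hermitian_inner r r = 0"
    by (rule hermitian_inner_span_right[OF orthogonal[OF r] vr(2)])
  then show ?thesis
    using vr(3) \<open>v \<in> V\<close> by (simp add: hermitian_inner_self_eq_0)
qed

end

text \<open>
  If \<open>L\<close> refines \<open>M\<close>, an element that preserves a component of \<open>L\<close> preserves the component of \<open>M\<close>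
  around it. If the stabilizers are included, then elements over the orthogonal complement belonging to
  \<open>M\<close> act by scalars on each component \<open>V\<close> of \<open>L\<close>; these scalars are those on any component of \<open>M\<close>
  that is not orthogonal to \<open>V\<close>, and that component therefore contains \<open>V\<close>.
\<close>

lemma stabilizer_subset_iff_refines:
  fixes L M :: "('p::prime_card, 'k::finite) Fpk decomposition"
  assumes L: "L \<in> invariant_decompositions" and M: "M \<in> invariant_decompositions"
  shows "stabilizer L \<subseteq> stabilizer M \<longleftrightarrow> refines L M"
proof
  note L' = invariant_decomposition_proper[OF L] and M' = invariant_decomposition_proper[OF M]
  assume "refines L M"
  show "stabilizer L \<subseteq> stabilizer M"
  proof
    fix g assume g: "g \<in> stabilizer L"
    obtain V where V: "V \<in> L"
      using decomposition_nonempty[OF L'] by blast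
    obtain W where W: "W \<in> M" "V \<subseteq> W"
      using \<open>refines L M\<close> V by (auto simp: refines_def)
    obtain v where v: "v \<in> V" "v \<noteq> 0"
      using decomposition_component_nonzero[OF L' V] .
    have gG: "g \<in> \<Gamma>" and "(*v) g ` V = V"
      using g V by (auto simp: stabilizer_def)
    then have "v \<in> (*v) g ` W"
      using v(1) W(2) by blast
    then have "(*v) g ` W = W"
      using decomposition_component_eq[OF M' component_translate[OF M gG W(1)] W(1) _ _ v(2)] v(1) W(2) by blast
    then show "g \<in> stabilizer M"
      using stabilizerI[OF M gG W(1)] by blast
  qed
next
  note L' = invariant_decomposition_proper[OF L] and M' = invariant_decomposition_proper[OF M]
  assume "stabilizer L \<subseteq> stabilizer M"
  then have perp: "perp (Gamma_proj ` stabilizer M) \<subseteq> perp (Gamma_proj ` stabilizer L)"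
    by (intro perp_antimono image_mono)
  show "refines L M"
    unfolding refines_def
  proof
    fix V assume V: "V \<in> L"
    obtain v where v: "v \<in> V" "v \<noteq> 0"
      using decomposition_component_nonzero[OF L' V] .
    have "\<exists>W\<in>M. \<exists>w\<in>W. hermitian_inner v w \<noteq> 0"
    proof (rule ccontr)
      assume "\<not> (\<exists>W\<in>M. \<exists>w\<in>W. hermitian_inner v w \<noteq> 0)"
      then have orthogonal: "hermitian_inner v w = 0" if "w \<in> \<Union>M" for w
        using that by blast
      have "v \<in> vec.span (\<Union>M)"
        using proper_decompositionsD(5)[OF M'] by blast
      with orthogonal have "hermitian_inner v v = 0"
        by (rule hermitian_inner_span_right)
      then show False
        using v(2) by (simp add: hermitian_inner_self_eq_0)
    qed
    then obtain W w where W: "W \<in> M" "w \<in> W" "hermitian_inner v w \<noteq> 0"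
      by blast
    have "y \<in> W" if y: "y \<in> V" for y
    proof (rule component_contains_eigenvectors[OF M W(1)])
      fix g d
      assume g: "g \<in> \<Gamma>" "Gamma_proj g \<in> perp (Gamma_proj ` stabilizer M)"
        and d: "\<And>u. u \<in> W \<Longrightarrow> g *v u = d *s u"
      obtain e where e: "\<And>u. u \<in> V \<Longrightarrow> g *v u = e *s u"
        using perp_acts_by_scalars[OF L g(1) _ V] g(2) perp by blast
      have "e = d"
        using unitary_eigenvectors_orthogonal[OF Gamma_unitary[OF g(1)] e[OF v(1)] d[OF W(2)]] W(3) by blast
      then show "g *v y = d *s y"
        using e[OF y] by simp
    qed
    then show "\<exists>W\<in>M. V \<subseteq> W"
      using W(1) by blast
  qed
qed

section \<open>Joint eigenspaces of isotropic subgroups\<close>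

text \<open>
  Here \<open>\<psi>\<close> may be any function; unless its values are the eigenvalues of a common eigenvector of
  the elements over \<open>N\<close>, the eigenspace is zero.
\<close>

definition joint_eigenspace ::
  "('p::prime_card, 'k::finite + 'k) Fpk set \<Rightarrow> (('p, 'k) Fpk cmatrix \<Rightarrow> complex) \<Rightarrow> (complex^('p, 'k) Fpk) set" where
  "joint_eigenspace N \<psi> = {x. \<forall>g\<in>\<Gamma>. Gamma_proj g \<in> N \<longrightarrow> g *v x = \<psi> g *s x}"

definition eigenspace_decomposition ::
  "('p::prime_card, 'k::finite + 'k) Fpk set \<Rightarrow> ('p, 'k) Fpk decomposition" where
  "eigenspace_decomposition N = {joint_eigenspace N \<psi> |\<psi>. joint_eigenspace N \<psi> \<noteq> {0}}"

lemma subspace_joint_eigenspace: "vec.subspace (joint_eigenspace N \<psi>)"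
proof -
  have "joint_eigenspace N \<psi> = (\<Inter>g\<in>{g \<in> \<Gamma>. Gamma_proj g \<in> N}. {x. g *v x = \<psi> g *s x})"
    by (auto simp: joint_eigenspace_def)
  then show ?thesis
    by (simp only: vec.subspace_Inter subspace_eigenspace ball_simps image_iff)
       (auto intro!: vec.subspace_Inter subspace_eigenspace)
qed

text \<open>
  The operators over an isotropic set commute, so the next operator preserves the joint eigenspace of
  the previous ones and has an eigenvector in it.
\<close>

lemma joint_eigenvector_exists:
  fixes N :: "('p::prime_card, 'k::finite + 'k) Fpk set"
  assumes isotropic: "\<And>v w. v \<in> N \<Longrightarrow> w \<in> N \<Longrightarrow> commutator_form v w = 0"
  obtains x :: "complex^('p, 'k) Fpk" where "x \<noteq> 0"
    "\<And>g. g \<in> \<Gamma> \<Longrightarrow> Gamma_proj g \<in> N \<Longrightarrow> \<exists>d. g *v x = d *s x"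
proof -
  have "\<exists>x :: complex^('p, 'k) Fpk. x \<noteq> 0 \<and> (\<forall>g\<in>\<Gamma>. Gamma_proj g \<in> F \<longrightarrow> (\<exists>d. g *v x = d *s x))"
    if "finite F" "F \<subseteq> N" for F
    using that
  proof (induction F rule: finite_induct)
    case empty
    have "axis 0 1 \<noteq> (0 :: complex^('p, 'k) Fpk)"
      by simp
    then show ?case
      by blast
  next
    case (insert w F)
    then obtain x :: "complex^('p, 'k) Fpk" where x: "x \<noteq> 0"
      "\<And>g. g \<in> \<Gamma> \<Longrightarrow> Gamma_proj g \<in> F \<Longrightarrow> \<exists>d. g *v x = d *s x"
      by auto
    define S where "S = (\<Inter>(g, d)\<in>{(g, d). g \<in> \<Gamma> \<and> Gamma_proj g \<in> F \<and> g *v x = d *s x}. {y. g *v y = d *s y})"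
    have S: "vec.subspace S"
      unfolding S_def by (intro vec.subspace_Inter) (auto intro: subspace_eigenspace)
    have "x \<in> S"
      by (auto simp: S_def)
    obtain g0 :: "('p, 'k) Fpk cmatrix" where g0: "g0 \<in> \<Gamma>" "Gamma_proj g0 = w"
      using Gamma_lift by blast
    have invariant: "g0 *v y \<in> S" if y: "y \<in> S" for y
    proof -
      have "g *v (g0 *v y) = d *s (g0 *v y)"
        if g: "g \<in> \<Gamma>" "Gamma_proj g \<in> F" "g *v x = d *s x" for g d
      proof -
        have "commutator_form (Gamma_proj g) (Gamma_proj g0) = 0"
          using isotropic[of "Gamma_proj g" w] g(2) g0(2) insert.prems by auto
        moreover have "g *v y = d *s y"
          using y g by (auto simp: S_def)
        ultimately show ?thesis
          using Gamma_commute_vector[OF g(1) g0(1), of y] by (simp add: vec.scale)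
      qed
      then show ?thesis
        by (auto simp: S_def)
    qed
    obtain y d where y: "y \<in> S" "y \<noteq> 0" "g0 *v y = d *s y"
      using Gamma_eigenvector[OF g0(1) S invariant \<open>x \<in> S\<close> x(1)] by blast
    have "\<exists>e. g *v y = e *s y" if g: "g \<in> \<Gamma>" "Gamma_proj g \<in> insert w F" for g
    proof (cases "Gamma_proj g = w")
      case True
      then obtain c where "\<And>z. g *v z = c *s (g0 *v z)"
        using Gamma_same_proj[OF g(1) g0(1)] g0(2) by auto
      then show ?thesis
        using y(3) by (auto intro: exI[of _ "c * d"])
    next
      case False
      then obtain e where "g *v x = e *s x"
        using x(2) g by blast
      then have "g *v y = e *s y"
        using y(1) g False by (auto simp: S_def)
      then show ?thesis
        by blast
    qed
    then show ?case
      using y(2) by blast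
  qed
  then show thesis
    using that by (metis finite_code order_refl)
qed

text \<open>
  Conjugation by \<open>h\<close> multiplies each \<open>g\<close> by a commutator, which is a scalar.
\<close>

lemma joint_eigenspace_translate:
  fixes N :: "('p::prime_card, 'k::finite + 'k) Fpk set"
  assumes h: "h \<in> \<Gamma>"
  shows "(*v) h ` joint_eigenspace N \<psi> =
    joint_eigenspace N (\<lambda>g. zeta_power (commutator_form (Gamma_proj g) (Gamma_proj h)) * \<psi> g)"
proof -
  have *: "h *v x \<in> joint_eigenspace N (\<lambda>g. zeta_power (commutator_form (Gamma_proj g) (Gamma_proj h)) * \<psi> g)"
    if h: "h \<in> \<Gamma>" and x: "x \<in> joint_eigenspace N \<psi>" for h x \<psi>
    using x Gamma_commute_vector[OF _ h] by (auto simp: joint_eigenspace_def vec.scale)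
  show ?thesis
  proof
    show "(*v) h ` joint_eigenspace N \<psi> \<subseteq>
        joint_eigenspace N (\<lambda>g. zeta_power (commutator_form (Gamma_proj g) (Gamma_proj h)) * \<psi> g)"
      using *[OF h] by blast
    show "joint_eigenspace N (\<lambda>g. zeta_power (commutator_form (Gamma_proj g) (Gamma_proj h)) * \<psi> g) \<subseteq>
        (*v) h ` joint_eigenspace N \<psi>"
    proof
      fix y assume "y \<in> joint_eigenspace N (\<lambda>g. zeta_power (commutator_form (Gamma_proj g) (Gamma_proj h)) * \<psi> g)"
      then have "conj_transpose h *v y \<in> joint_eigenspace N \<psi>"
        using *[OF Gamma_conj_transpose(1)[OF h]]
        by (fastforce simp: Gamma_conj_transpose(2)[OF h] commutator_form_minus_right mult.assoc[symmetric])
      moreover have "y = h *v (conj_transpose h *v y)"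
        using unitary_cancel(2)[OF Gamma_unitary[OF h]] by simp
      ultimately show "y \<in> (*v) h ` joint_eigenspace N \<psi>"
        by blast
    qed
  qed
qed

text \<open>
  The joint eigenspaces are orthogonal and permuted by \<open>\<Gamma>\<close>; as one of them is nonzero, irreducibility
  shows that they span. An element \<open>h\<close> preserves one iff its commutators with all elements over \<open>W\<^sup>\<bottom>\<close>
  are trivial, that is, iff its image lies in \<open>W\<^sup>\<bottom>\<^sup>\<bottom> = W\<close>. They are proper subspaces because
  \<open>W\<close> is: otherwise some element over \<open>W\<^sup>\<bottom>\<close> would be a scalar and commute with all of \<open>\<Gamma>\<close>.
\<close>

lemma eigenspace_decomposition_invariant:
  fixes W :: "('p::prime_card, 'k::finite + 'k) Fpk set"
  assumes W: "coisotropic W" "W \<noteq> UNIV"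
  shows "eigenspace_decomposition (perp W) \<in> invariant_decompositions"
    and "stabilizer (eigenspace_decomposition (perp W)) = {g \<in> \<Gamma>. Gamma_proj g \<in> W}"
proof -
  let ?N = "perp W" and ?D = "eigenspace_decomposition (perp W)"
  have subspace: "vec.subspace W" and N_W: "?N \<subseteq> W"
    using W(1) by (auto simp: coisotropic_def)
  have "commutator_form v w = 0" if "v \<in> ?N" "w \<in> ?N" for v w
    using that N_W by (auto simp: perp_def)
  then obtain x0 :: "complex^('p, 'k) Fpk" where x0: "x0 \<noteq> 0"
    "\<And>g. g \<in> \<Gamma> \<Longrightarrow> Gamma_proj g \<in> ?N \<Longrightarrow> \<exists>d. g *v x0 = d *s x0"
    using joint_eigenvector_exists by blast
  define \<psi>0 where "\<psi>0 g = (SOME d. g *v x0 = d *s x0)" for g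
  have x0_E: "x0 \<in> joint_eigenspace ?N \<psi>0"
    using x0(2) by (auto simp: joint_eigenspace_def \<psi>0_def intro: someI_ex)
  then have E0: "joint_eigenspace ?N \<psi>0 \<in> ?D"
    using x0(1) by (auto simp: eigenspace_decomposition_def)
  have component_translate: "(*v) h ` V \<in> ?D" if h: "h \<in> \<Gamma>" and "V \<in> ?D" for h V
  proof -
    obtain \<psi> where V: "V = joint_eigenspace ?N \<psi>" "V \<noteq> {0}"
      using \<open>V \<in> ?D\<close> by (auto simp: eigenspace_decomposition_def)
    have "(*v) h ` V \<noteq> (*v) h ` {0}"
      using V(2) by (simp only: inj_image_eq_iff[OF inj_unitary[OF Gamma_unitary[OF h]]] not_False_eq_True)
    then have "(*v) h ` V \<noteq> {0}"
      by simp
    then show ?thesis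
      unfolding V(1) joint_eigenspace_translate[OF h] by (auto simp: eigenspace_decomposition_def)
  qed
  have not_scalar: "commutator_form (Gamma_proj g) (Gamma_proj h) = 0"
    if g: "g \<in> \<Gamma>" "Gamma_proj g \<in> ?N" and h: "h \<in> \<Gamma>" and x: "x \<in> joint_eigenspace ?N \<psi>" "x \<noteq> 0"
      and hx: "h *v x \<in> joint_eigenspace ?N \<psi>" for g h x \<psi>
  proof -
    have gx: "g *v x = \<psi> g *s x"
      using g x by (auto simp: joint_eigenspace_def)
    then have "cnj (\<psi> g) * \<psi> g = 1"
      using unitary_eigenvalue[OF Gamma_unitary[OF g(1)]] x(2) by blast
    then have "\<psi> g \<noteq> 0"
      by auto
    have "h *v x \<noteq> 0"
      using x(2) unitary_cancel(1)[OF Gamma_unitary[OF h], of x] by auto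
    have "\<psi> g *s (h *v x) = (zeta_power (commutator_form (Gamma_proj g) (Gamma_proj h)) * \<psi> g) *s (h *v x)"
      using Gamma_commute_vector[OF g(1) h, of x] hx g by (simp add: joint_eigenspace_def gx vec.scale)
    then have "\<psi> g = zeta_power (commutator_form (Gamma_proj g) (Gamma_proj h)) * \<psi> g"
      using \<open>h *v x \<noteq> 0\<close> vec.scale_right_imp_eq by blast
    then show ?thesis
      using \<open>\<psi> g \<noteq> 0\<close> by (simp add: zeta_power_eq_1_iff)
  qed
  have proper_D: "?D \<in> proper_decompositions"
    unfolding proper_decompositions_def
  proof (intro CollectI conjI ballI impI)
    fix V assume "V \<in> ?D"
    then obtain \<psi> where V: "V = joint_eigenspace ?N \<psi>" "V \<noteq> {0}"
      by (auto simp: eigenspace_decomposition_def)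
    show "vec.subspace V"
      by (simp add: V(1) subspace_joint_eigenspace)
    show "V \<noteq> {0}"
      by (rule V(2))
    show "V \<noteq> UNIV"
    proof
      assume "V = UNIV"
      obtain u where "u \<notin> W"
        using W(2) by blast
      then obtain w where w: "w \<in> ?N" "commutator_form w u \<noteq> 0"
        using perp_separation[OF subspace] by blast
      obtain g h :: "('p, 'k) Fpk cmatrix" where "g \<in> \<Gamma>" "Gamma_proj g = w" "h \<in> \<Gamma>" "Gamma_proj h = u"
        using Gamma_lift by metis
      then show False
        using not_scalar[of g h x0 \<psi>] w x0(1) \<open>V = UNIV\<close> V(1) by auto
    qed
  next
    fix V V' x y
    assume "V \<in> ?D" "V' \<in> ?D" "V \<noteq> V'" and xy: "x \<in> V" "y \<in> V'"
    then obtain \<psi> \<psi>' where V: "V = joint_eigenspace ?N \<psi>" "V' = joint_eigenspace ?N \<psi>'"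
      by (auto simp: eigenspace_decomposition_def)
    have "\<exists>g\<in>\<Gamma>. Gamma_proj g \<in> ?N \<and> \<psi> g \<noteq> \<psi>' g"
    proof (rule ccontr)
      assume "\<not> (\<exists>g\<in>\<Gamma>. Gamma_proj g \<in> ?N \<and> \<psi> g \<noteq> \<psi>' g)"
      then have "V = V'"
        by (auto simp: V joint_eigenspace_def)
      then show False
        using \<open>V \<noteq> V'\<close> by simp
    qed
    then obtain g where g: "g \<in> \<Gamma>" "Gamma_proj g \<in> ?N" "\<psi> g \<noteq> \<psi>' g"
      by blast
    then have "g *v x = \<psi> g *s x" "g *v y = \<psi>' g *s y"
      using xy by (auto simp: V joint_eigenspace_def)
    then show "hermitian_inner x y = 0"
      using unitary_eigenvectors_orthogonal[OF Gamma_unitary[OF g(1)]] g(3) by blast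
  next
    show "vec.span (\<Union>?D) = UNIV"
    proof (rule Gamma_irreducible)
      fix g :: "('p, 'k) Fpk cmatrix" and x
      assume g: "g \<in> \<Gamma>" and x: "x \<in> vec.span (\<Union>?D)"
      show "g *v x \<in> vec.span (\<Union>?D)"
      proof (rule span_matrix_invariant[OF _ x])
        fix y assume "y \<in> \<Union>?D"
        then have "g *v y \<in> \<Union>?D"
          using component_translate[OF g] by blast
        then show "g *v y \<in> vec.span (\<Union>?D)"
          by (rule vec.span_base)
      qed
    next
      show "x0 \<in> vec.span (\<Union>?D)"
        using x0_E E0 by (intro vec.span_base) blast
    qed (use x0 in auto)
  qed
  have act_subset: "decomposition_act h ?D \<subseteq> ?D" if "h \<in> \<Gamma>" for h
    using component_translate[OF that] by (auto simp: decomposition_act_def)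
  have "decomposition_act h ?D = ?D" if h: "h \<in> \<Gamma>" for h
  proof
    show "decomposition_act h ?D \<subseteq> ?D"
      using h by (rule act_subset)
    have "?D = decomposition_act h (decomposition_act (conj_transpose h) ?D)"
      using Gamma_unitary[OF h] by (simp add: decomposition_act_mult[symmetric] unitary_def)
    also have "\<dots> \<subseteq> decomposition_act h ?D"
      using act_subset[OF Gamma_conj_transpose(1)[OF h]] by (auto simp: decomposition_act_def)
    finally show "?D \<subseteq> decomposition_act h ?D" .
  qed
  then show "?D \<in> invariant_decompositions"
    using proper_D by (simp add: invariant_decompositions_def)
  show "stabilizer ?D = {g \<in> \<Gamma>. Gamma_proj g \<in> W}"
  proof (intro subset_antisym subsetI)
    fix h assume "h \<in> stabilizer ?D"
    then have h: "h \<in> \<Gamma>" "(*v) h ` joint_eigenspace ?N \<psi>0 = joint_eigenspace ?N \<psi>0"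
      using E0 by (auto simp: stabilizer_def)
    then have hx0: "h *v x0 \<in> joint_eigenspace ?N \<psi>0"
      using x0_E by blast
    have "commutator_form (Gamma_proj h) w = 0" if w: "w \<in> ?N" for w
    proof -
      obtain g :: "('p, 'k) Fpk cmatrix" where "g \<in> \<Gamma>" "Gamma_proj g = w"
        using Gamma_lift by blast
      then have "commutator_form w (Gamma_proj h) = 0"
        using not_scalar[OF _ _ h(1) x0_E x0(1) hx0] w by blast
      then show ?thesis
        using commutator_form_skew[of "Gamma_proj h" w] by simp
    qed
    then have "Gamma_proj h \<in> perp ?N"
      by (simp add: perp_def)
    then show "h \<in> {g \<in> \<Gamma>. Gamma_proj g \<in> W}"
      using h(1) perp_perp[OF subspace] by simp
  next
    fix h assume "h \<in> {g \<in> \<Gamma>. Gamma_proj g \<in> W}"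
    then have h: "h \<in> \<Gamma>" "Gamma_proj h \<in> W"
      by auto
    have "(*v) h ` joint_eigenspace ?N \<psi> = joint_eigenspace ?N \<psi>" for \<psi>
      unfolding joint_eigenspace_translate[OF h(1)] using h(2)
      by (auto simp: joint_eigenspace_def perp_def)
    then show "h \<in> stabilizer ?D"
      using h(1) by (auto simp: stabilizer_def eigenspace_decomposition_def)
  qed
qed

section \<open>The fixed point space\<close>

lemma bij_betw_stabilizer:
  "bij_betw stabilizer invariant_decompositions (proper_coisotropic_subgroups TYPE('p::prime_card) TYPE('k::finite))"
  unfolding bij_betw_def
proof (intro conjI subset_antisym)
  show "inj_on stabilizer (invariant_decompositions :: ('p, 'k) Fpk decomposition set)"
  proof (rule inj_onI)
    fix L M :: "('p, 'k) Fpk decomposition"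
    assume LM: "L \<in> invariant_decompositions" "M \<in> invariant_decompositions" "stabilizer L = stabilizer M"
    then have "refines L M" "refines M L"
      using stabilizer_subset_iff_refines by blast+
    then show "L = M"
      using LM by (intro refines_antisym invariant_decomposition_proper)
  qed
  show "stabilizer ` invariant_decompositions \<subseteq> proper_coisotropic_subgroups TYPE('p) TYPE('k)"
    using stabilizer_proper_coisotropic by blast
  show "proper_coisotropic_subgroups TYPE('p) TYPE('k) \<subseteq> stabilizer ` invariant_decompositions"
  proof
    fix K assume K: "K \<in> proper_coisotropic_subgroups TYPE('p) TYPE('k)"
    then obtain W where W: "coisotropic W" "K = {g \<in> \<Gamma>. Gamma_proj g \<in> W}" "K \<noteq> \<Gamma>"
      by (auto simp: proper_coisotropic_subgroups_def coisotropic_subgroups_def)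
    then have "W \<noteq> UNIV"
      by auto
    then show "K \<in> stabilizer ` invariant_decompositions"
      using eigenspace_decomposition_invariant[OF W(1)] W(2) by blast
  qed
qed

lemma finite_proper_coisotropic_subgroups:
  "finite (proper_coisotropic_subgroups TYPE('p::prime_card) TYPE('k::finite))"
proof (rule finite_subset)
  show "proper_coisotropic_subgroups TYPE('p) TYPE('k) \<subseteq>
      range (\<lambda>W. {g \<in> \<Gamma>. Gamma_proj g \<in> W})"
    by (auto simp: proper_coisotropic_subgroups_def coisotropic_subgroups_def)
qed simp

theorem theorem1p2:
  shows "decomposition_fixed_points (Gamma_group TYPE('p::prime_card) TYPE('k::finite))
           homeomorphic_space
         symplectic_building TYPE('p) TYPE('k)"
proof -
  let ?T = "proper_coisotropic_subgroups TYPE('p) TYPE('k)"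
  let ?r = "{(K, K'). K \<in> ?T \<and> K' \<in> ?T \<and> K \<subseteq> K'}"
  let ?\<phi> = "inv_into invariant_decompositions stabilizer"
  interpret poset_action decomposition_obj decomposition_mor decomposition_act
      "\<Gamma> :: ('p, 'k) Fpk cmatrix set"
    by (rule poset_action_decompositions) (auto simp: Gamma_unitary)
  have fixed: "{L \<in> topspace decomposition_obj. \<forall>g\<in>\<Gamma>. decomposition_act g L = L} =
      (invariant_decompositions :: ('p, 'k) Fpk decomposition set)"
    by (simp add: invariant_decompositions_def)
  have \<phi>: "?\<phi> K \<in> invariant_decompositions" "stabilizer (?\<phi> K) = K" if "K \<in> ?T" for K
  proof -
    have "K \<in> stabilizer ` invariant_decompositions"
      using bij_betw_imp_surj_on[OF bij_betw_stabilizer[where 'p = 'p and 'k = 'k]] that by simp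
    then show "?\<phi> K \<in> invariant_decompositions" "stabilizer (?\<phi> K) = K"
      by (simp_all only: inv_into_into f_inv_into_f)
  qed
  show ?thesis
    unfolding decomposition_fixed_points_def symplectic_building_def
  proof (rule realization_fixed_points_homeomorphic)
    show "bij_betw ?\<phi> ?T {L \<in> topspace decomposition_obj. \<forall>g\<in>\<Gamma>. decomposition_act g L = L}"
      unfolding fixed by (rule bij_betw_inv_into[OF bij_betw_stabilizer])
    show "(?\<phi> K, ?\<phi> K') \<in> topspace decomposition_mor \<longleftrightarrow> (K, K') \<in> ?r" if "K \<in> ?T" "K' \<in> ?T" for K K'
      using stabilizer_subset_iff_refines[OF \<phi>(1)[OF that(1)] \<phi>(1)[OF that(2)]] \<phi>(2) that
        invariant_decomposition_proper[OF \<phi>(1)[OF that(1)]] invariant_decomposition_proper[OF \<phi>(1)[OF that(2)]] by simp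
  qed (auto simp: finite_proper_coisotropic_subgroups intro: decompositions_separated_by_real_functions)
qed

end
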